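(* Let $(\mathbb{N}^{n+1},\bar g)$ be a space form of constant curvature $\bar K\in\{0,1,-1\}$. Let $(M^n,g)\subset(\mathbb{N}^{n+1},\bar g)$ be an immersed $C^2$ hypersurface with the induced metric $g=\bar g|_{M^n}$, and let $A=g^{-1}h$ be its normalized second fundamental form. Then the following hold. (1) For all integers $k,l\ge 0$ with $k+l\ge 1$, the product $\sigma_{2k+1}(A)\,\sigma_{2l+1}(A)$ is intrinsic. More precisely, for each given pair $(2k+1,2l+1)$ there is a polynomial $P_{2k+1,2l+1}$ of degree $k+l+1$ in the $(2,2)$ Riemann tensor $Riem_g$ such that $$\sigma_{2k+1}(A)\,\sigma_{2l+1}(A)=P_{2k+1,2l+1}(Riem_g).$$ (2) If $\sigma_{2k+1}(A)\neq 0$ for some $k\ge 1$, then $\sigma_{2l+1}(A)$ is intrinsic modulo orientation for every $l\ge 0$. As a consequence, $A$ is intrinsic up to orientation. (3) If the rank of $A$ is at least three, then $H^2=\sigma_1^2(A)$ is intrinsic. If in addition $H\neq 0$, then $A$ is intrinsic up to orientation.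
   Context: Here $h$ is the second fundamental form of $M$ with respect to a (chosen) unit normal, and $A=g^{-1}h$ is the associated endomorphism field of $TM$ (the normalized second fundamental form), whose eigenvalues are the principal curvatures $\kappa_1,\dots,\kappa_n$. For $m\ge 0$, $\sigma_m(A)$ denotes the $m$-th elementary symmetric function of $\kappa_1,\dots,\kappa_n$, and $H=\sigma_1(A)$. Definition (intrinsic). A geometric quantity $Q$ on a Riemannian manifold $(M,g)$ is called intrinsic if there is a continuous function $\phi$ such that $Q(x)=\phi(Riem_g(x))$ for all $x\in M$, where $Riem_g=R^{\alpha\beta}_{\gamma\eta}$ is the $(2,2)$ Riemann tensor of $(M,g)$. The induced metric $g$ of a $C^2$ hypersurface may a priori appear only $C^1$. Its Riemann tensor is nevertheless well defined and continuous: around each point $o$, the hypersurface is written as a graph over its tangent plane at $o$ (with vanishing gradient at $o$), and the Riemann tensor at $o$ is computed from the second derivatives of $g$ at $o$ in these coordinates, which depend only on up to second order derivatives of the immersion. Orientation. Replacing the unit normal by its opposite replaces $A$ by $-A$, and so changes the sign of every $\sigma_{2l+1}(A)$. "Intrinsic modulo orientation" (or "up to orientation") means intrinsic once the orientation has been fixed, i.e. once the unit normal has been chosen, equivalently once the sign of the nonvanishing quantity ($\sigma_{2k+1}(A)$ in (2), $H$ in (3)) has been given. The conditions $\sigma_{2k+1}(A)\ne 0$, $\operatorname{rank}A\ge 3$, $H\neq0$ are conditions at the points of $M$ considered. *)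

theory Defs
  imports "HOL-Analysis.Analysis" "HOL-Library.Poly_Mapping"
begin

section \<open>Functions of class $C^r$ and manifolds\<close>

primrec Ck_on :: "nat \<Rightarrow> ('a::real_normed_vector \<Rightarrow> 'b::real_normed_vector) \<Rightarrow> 'a set \<Rightarrow> bool" where
  "Ck_on 0 f U \<longleftrightarrow> continuous_on U f"
| "Ck_on (Suc k) f U \<longleftrightarrow>
     (\<forall>x\<in>U. f differentiable at x) \<and> (\<forall>v. Ck_on k (\<lambda>x. frechet_derivative f (at x) v) U)"

definition Cr_on :: "enat \<Rightarrow> ('a::real_normed_vector \<Rightarrow> 'b::real_normed_vector) \<Rightarrow> 'a set \<Rightarrow> bool" where
  "Cr_on r f U \<longleftrightarrow> (\<forall>k. enat k \<le> r \<longrightarrow> Ck_on k f U)"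

text \<open>A chart is a coordinate domain together with a coordinate map; the values of the
  coordinate map outside the domain are irrelevant.\<close>

type_synonym ('p, 'a) chart = "'p set \<times> ('p \<Rightarrow> 'a)"

definition is_chart :: "'p topology \<Rightarrow> ('p, 'a::euclidean_space) chart \<Rightarrow> bool" where
  "is_chart X = (\<lambda>(D, y).
     openin X D \<and> open (y ` D) \<and> homeomorphic_map (subtopology X D) (top_of_set (y ` D)) y)"

definition transition :: "('p, 'a) chart \<Rightarrow> ('p, 'b) chart \<Rightarrow> 'a \<Rightarrow> 'b" where
  "transition = (\<lambda>(D, y) (E, z). z \<circ> the_inv_into D y)"

definition compatible ::
    "enat \<Rightarrow> ('p, 'a::euclidean_space) chart \<Rightarrow> ('p, 'a) chart \<Rightarrow> bool" where
  "compatible r c c' \<longleftrightarrow>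
     Cr_on r (transition c c') (snd c ` (fst c \<inter> fst c')) \<and>
     Cr_on r (transition c' c) (snd c' ` (fst c \<inter> fst c'))"

record ('p, 'a) manifold =
  topo :: "'p topology"
  atlas :: "('p, 'a) chart set"

text \<open>The atlas is the maximal one, so that ``for every chart in the atlas'' means
  ``in every $C^r$ coordinate system''.\<close>

definition is_manifold :: "enat \<Rightarrow> ('p, 'a::euclidean_space, 'z) manifold_scheme \<Rightarrow> bool" where
  "is_manifold r M \<longleftrightarrow>
     Hausdorff_space (topo M) \<and> second_countable (topo M) \<and>
     (\<forall>c\<in>atlas M. is_chart (topo M) c) \<and>
     (\<Union>c\<in>atlas M. fst c) = topspace (topo M) \<and>
     (\<forall>c\<in>atlas M. \<forall>c'\<in>atlas M. compatible r c c') \<and>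
     (\<forall>c. is_chart (topo M) c \<and> (\<forall>c'\<in>atlas M. compatible r c c') \<longrightarrow> c \<in> atlas M)"

section \<open>Riemannian metrics and curvature in coordinates\<close>

text \<open>A metric on an open set of a Euclidean space assigns to a point \<open>x\<close> and two vectors
  \<open>v\<close>, \<open>w\<close> the number \<open>g x v w\<close>.\<close>

type_synonym 'a local_metric = "'a \<Rightarrow> 'a \<Rightarrow> 'a \<Rightarrow> real"

text \<open>The Christoffel symbols, i.e. \<open>\<nabla>\<^sub>v w\<close> for constant vector fields \<open>v\<close> and \<open>w\<close>, given by
  the Koszul formula.\<close>

definition christoffel :: "'a::euclidean_space local_metric \<Rightarrow> 'a \<Rightarrow> 'a \<Rightarrow> 'a \<Rightarrow> 'a" where
  "christoffel g x v w = (THE z. \<forall>u. g x z u =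
     (frechet_derivative (\<lambda>x. g x w u) (at x) v
      + frechet_derivative (\<lambda>x. g x v u) (at x) w
      - frechet_derivative (\<lambda>x. g x v w) (at x) u) / 2)"

text \<open>\<open>R(u,v)w = \<nabla>\<^sub>u \<nabla>\<^sub>v w - \<nabla>\<^sub>v \<nabla>\<^sub>u w\<close> for constant vector fields. At the point \<open>x\<close> this only
  needs \<open>g\<close> to be differentiable near \<open>x\<close> with first derivatives differentiable at \<open>x\<close>.\<close>

definition curvature :: "'a::euclidean_space local_metric \<Rightarrow> 'a \<Rightarrow> 'a \<Rightarrow> 'a \<Rightarrow> 'a \<Rightarrow> 'a" where
  "curvature g x u v w =
     frechet_derivative (\<lambda>x. christoffel g x v w) (at x) u
     - frechet_derivative (\<lambda>x. christoffel g x u w) (at x) v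
     + christoffel g x u (christoffel g x v w)
     - christoffel g x v (christoffel g x u w)"

record ('p, 'a) riemannian = "('p, 'a) manifold" +
  metric :: "('p, 'a) chart \<Rightarrow> 'a local_metric"

definition is_riemannian :: "('p, 'a::euclidean_space) riemannian \<Rightarrow> bool" where
  "is_riemannian N \<longleftrightarrow>
     is_manifold \<infinity> N \<and>
     (\<forall>c\<in>atlas N.
        (\<forall>x\<in>snd c ` fst c. bilinear (metric N c x) \<and>
           (\<forall>v w. metric N c x v w = metric N c x w v) \<and>
           (\<forall>v. v \<noteq> 0 \<longrightarrow> 0 < metric N c x v v)) \<and>
        (\<forall>v w. Cr_on \<infinity> (\<lambda>x. metric N c x v w) (snd c ` fst c))) \<and>
     (\<forall>c\<in>atlas N. \<forall>c'\<in>atlas N. \<forall>p\<in>fst c \<inter> fst c'. \<forall>v w.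
        metric N c (snd c p) v w =
        metric N c' (snd c' p) (frechet_derivative (transition c c') (at (snd c p)) v)
                               (frechet_derivative (transition c c') (at (snd c p)) w))"

text \<open>Constant sectional curvature \<open>K\<close>; the denominator
  \<open>|u|\<^sup>2 |v|\<^sup>2 - \<langle>u,v\<rangle>\<^sup>2\<close> of the sectional curvature is cleared.
  Neither completeness nor simple connectedness is required.\<close>

definition space_form :: "real \<Rightarrow> ('p, 'a::euclidean_space) riemannian \<Rightarrow> bool" where
  "space_form K N \<longleftrightarrow>
     is_riemannian N \<and>
     (\<forall>c\<in>atlas N. \<forall>x\<in>snd c ` fst c. \<forall>u v. let g = metric N c in
        g x (curvature g x u v v) u = K * (g x u u * g x v v - (g x u v)\<^sup>2))"

section \<open>Immersed hypersurfaces\<close>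

text \<open>The manifold has charts in \<open>\<real>\<^sup>n\<close> and the ambient space, of dimension \<open>n + 1\<close>, has charts in
  \<open>\<real>\<^sup>n \<times> \<real>\<close>.\<close>

record ('n, 'p, 'q) hypersurface =
  ambient :: "('p, (real^'n) \<times> real) riemannian"
  base :: "('q, real^'n) manifold"
  immersion :: "'q \<Rightarrow> 'p"

definition local_rep :: "('n::finite, 'p, 'q) hypersurface \<Rightarrow>
    ('q, real^'n) chart \<Rightarrow> ('p, (real^'n) \<times> real) chart \<Rightarrow> real^'n \<Rightarrow> (real^'n) \<times> real" where
  "local_rep H c b = snd b \<circ> immersion H \<circ> the_inv_into (fst c) (snd c)"

definition is_C2_hypersurface :: "real \<Rightarrow> ('n::finite, 'p, 'q) hypersurface \<Rightarrow> bool" where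
  "is_C2_hypersurface K H \<longleftrightarrow>
     space_form K (ambient H) \<and> is_manifold 2 (base H) \<and>
     continuous_map (topo (base H)) (topo (ambient H)) (immersion H) \<and>
     (\<forall>c\<in>atlas (base H). \<forall>b\<in>atlas (ambient H).
        let U = snd c ` (fst c \<inter> immersion H -` fst b) in
          Cr_on 2 (local_rep H c b) U \<and>
          (\<forall>x\<in>U. inj (frechet_derivative (local_rep H c b) (at x))))"

definition induced_metric :: "('n::finite, 'p, 'q) hypersurface \<Rightarrow>
    ('q, real^'n) chart \<Rightarrow> ('p, (real^'n) \<times> real) chart \<Rightarrow> (real^'n) local_metric" where
  "induced_metric H c b x v w = (let X = local_rep H c b in
     metric (ambient H) b (X x) (frechet_derivative X (at x) v) (frechet_derivative X (at x) w))"

definition unit_normals :: "('n::finite, 'p, 'q) hypersurface \<Rightarrow>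
    ('q, real^'n) chart \<Rightarrow> ('p, (real^'n) \<times> real) chart \<Rightarrow> real^'n \<Rightarrow> ((real^'n) \<times> real) set" where
  "unit_normals H c b x = {\<nu>. let X = local_rep H c b; G = metric (ambient H) b (X x) in
     G \<nu> \<nu> = 1 \<and> (\<forall>v. G (frechet_derivative X (at x) v) \<nu> = 0)}"

text \<open>\<open>h(v,w) = \<langle>\<nabla>\<^sub>v (dX w), \<nu>\<rangle>\<close> with the ambient Levi-Civita connection along the immersion.\<close>

definition second_form :: "('n::finite, 'p, 'q) hypersurface \<Rightarrow>
    ('q, real^'n) chart \<Rightarrow> ('p, (real^'n) \<times> real) chart \<Rightarrow> (real^'n) \<times> real \<Rightarrow> (real^'n) local_metric" where
  "second_form H c b \<nu> x v w = (let X = local_rep H c b; G = metric (ambient H) b in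
     G (X x)
       (frechet_derivative (\<lambda>x. frechet_derivative X (at x) w) (at x) v
        + christoffel G (X x) (frechet_derivative X (at x) v) (frechet_derivative X (at x) w))
       \<nu>)"

definition form_matrix :: "(real^'n \<Rightarrow> real^'n \<Rightarrow> real) \<Rightarrow> real^'n^'n" where
  "form_matrix f = (\<chi> i j. f (axis i 1) (axis j 1))"

definition normalized_form :: "('n::finite, 'p, 'q) hypersurface \<Rightarrow>
    ('q, real^'n) chart \<Rightarrow> ('p, (real^'n) \<times> real) chart \<Rightarrow> (real^'n) \<times> real \<Rightarrow> real^'n \<Rightarrow> real^'n^'n" where
  "normalized_form H c b \<nu> x =
     matrix_inv (form_matrix (induced_metric H c b x)) ** form_matrix (second_form H c b \<nu> x)"

text \<open>The entry \<open>$ \<alpha> $ \<beta> $ \<gamma> $ \<eta>\<close> is the component with upper indices \<open>\<alpha>\<close>, \<open>\<beta>\<close> and lower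
  indices \<open>\<gamma>\<close>, \<open>\<eta>\<close>. With these conventions a metric of constant curvature \<open>K\<close> has the tensor
  \<open>K (\<delta>\<^sup>\<alpha>\<^sub>\<gamma> \<delta>\<^sup>\<beta>\<^sub>\<eta> - \<delta>\<^sup>\<alpha>\<^sub>\<eta> \<delta>\<^sup>\<beta>\<^sub>\<gamma>)\<close>.\<close>

type_synonym 'n tensor22 = "real^'n^'n^'n^'n"

definition riemann22 :: "(real^'n) local_metric \<Rightarrow> real^'n \<Rightarrow> ('n::finite) tensor22" where
  "riemann22 g x = (\<chi> \<alpha> \<beta> \<gamma> \<eta>. \<Sum>\<mu>\<in>UNIV.
     matrix_inv (form_matrix (g x)) $ \<beta> $ \<mu>
       * curvature g x (axis \<gamma> 1) (axis \<eta> 1) (axis \<mu> 1) $ \<alpha>)"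

text \<open>Pairs of charts at \<open>p\<close> in which the hypersurface is a graph \<open>x \<mapsto> (x, f x)\<close> over its tangent
  plane at \<open>p\<close>: the gradient of \<open>f\<close> vanishes at \<open>p\<close>, and the direction of the graph is orthogonal
  to the tangent plane at \<open>p\<close>. In such coordinates the induced metric, which is only \<open>C\<^sup>1\<close> in
  general, has first derivatives that are differentiable at \<open>p\<close>, so its Riemann tensor at \<open>p\<close>
  is meaningful. Every basis of the tangent space at \<open>p\<close> is the coordinate basis of some of them.\<close>

definition graph_charts :: "('n::finite, 'p, 'q) hypersurface \<Rightarrow> 'q \<Rightarrow>
    (('q, real^'n) chart \<times> ('p, (real^'n) \<times> real) chart) set" where
  "graph_charts H p = {(c, b). c \<in> atlas (base H) \<and> b \<in> atlas (ambient H) \<and>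
     p \<in> fst c \<and> immersion H ` fst c \<subseteq> fst b \<and>
     (\<forall>x\<in>snd c ` fst c. fst (local_rep H c b x) = x) \<and>
     (\<forall>v. frechet_derivative (\<lambda>x. snd (local_rep H c b x)) (at (snd c p)) v = 0) \<and>
     (\<forall>v. metric (ambient H) b (snd b (immersion H p)) (v, 0) (0, 1) = 0)}"

section \<open>Symmetric functions of the principal curvatures\<close>

text \<open>\<open>\<kappa>\<close> lists the eigenvalues of \<open>A\<close> with multiplicity. The matrices considered are self-adjoint
  with respect to the induced metric, so all eigenvalues are real.\<close>

definition eigenvalue_list :: "real^'n^'n \<Rightarrow> ('n::finite \<Rightarrow> real) \<Rightarrow> bool" where
  "eigenvalue_list A \<kappa> \<longleftrightarrow> (\<forall>t. det (mat t - A) = (\<Prod>i\<in>UNIV. t - \<kappa> i))"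

definition sigma_sym :: "nat \<Rightarrow> real^'n^'n \<Rightarrow> real" where
  "sigma_sym m (A :: real^'n::finite^'n) = (let \<kappa> = (SOME \<kappa>. eigenvalue_list A \<kappa>) in
     \<Sum>S | S \<subseteq> UNIV \<and> card S = m. \<Prod>i\<in>S. \<kappa> i)"

section \<open>Polynomials in the Riemann tensor and intrinsic quantities\<close>

text \<open>Real polynomials in the components of a (2,2) tensor, as finitely supported families of
  coefficients indexed by exponent vectors.\<close>

type_synonym 'n tensor_poly = "(('n \<times> 'n \<times> 'n \<times> 'n) \<Rightarrow>\<^sub>0 nat) \<Rightarrow>\<^sub>0 real"

definition poly_eval :: "('n::finite) tensor_poly \<Rightarrow> 'n tensor22 \<Rightarrow> real" where
  "poly_eval P R = (\<Sum>m\<in>Poly_Mapping.keys P. Poly_Mapping.lookup P m *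
     (\<Prod>(\<alpha>, \<beta>, \<gamma>, \<eta>)\<in>Poly_Mapping.keys m.
        (R $ \<alpha> $ \<beta> $ \<gamma> $ \<eta>) ^ Poly_Mapping.lookup m (\<alpha>, \<beta>, \<gamma>, \<eta>)))"

definition poly_degree :: "('n::finite) tensor_poly \<Rightarrow> nat" where
  "poly_degree P = Max (insert 0 ((\<lambda>m. \<Sum>i\<in>Poly_Mapping.keys m. Poly_Mapping.lookup m i) `
     Poly_Mapping.keys P))"

text \<open>The normalized second fundamental form and the (2,2) Riemann tensor at a point of a
  hypersurface, as components in the same graph coordinates, for all such coordinates and for
  both choices of the unit normal.\<close>

definition shape_riemann_at :: "('n::finite, 'p, 'q) hypersurface \<Rightarrow> 'q \<Rightarrow>
    ((real^'n^'n) \<times> 'n tensor22) set" where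
  "shape_riemann_at H p =
     {(normalized_form H c b \<nu> (snd c p), riemann22 (induced_metric H c b) (snd c p)) | c b \<nu>.
        (c, b) \<in> graph_charts H p \<and> \<nu> \<in> unit_normals H c b (snd c p)}"

text \<open>A quantity \<open>Q\<close> depending on \<open>A\<close> is intrinsic at the points where \<open>C\<close> holds if it is a
  continuous function \<open>\<phi>\<close> of the Riemann tensor there. The function is the same for all
  hypersurfaces in the class \<open>\<H>\<close> and for all coordinates; it is defined and continuous on an open
  set of tensors.\<close>

definition intrinsic :: "('n::finite, 'p, 'q) hypersurface set \<Rightarrow> (real^'n^'n \<Rightarrow> bool) \<Rightarrow>
    (real^'n^'n \<Rightarrow> 'b::topological_space) \<Rightarrow> bool" where
  "intrinsic \<H> C Q \<longleftrightarrow> (\<exists>(\<Omega> :: 'n tensor22 set) \<phi>. open \<Omega> \<and> continuous_on \<Omega> \<phi> \<and>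
     (\<forall>H\<in>\<H>. \<forall>p\<in>topspace (topo (base H)). \<forall>(A, R)\<in>shape_riemann_at H p.
        C A \<longrightarrow> R \<in> \<Omega> \<and> Q A = \<phi> R))"

text \<open>Intrinsic once the sign of \<open>s A\<close>, nonzero where \<open>C\<close> holds, has been given.\<close>

definition intrinsic_mod_orientation ::
    "('n::finite, 'p, 'q) hypersurface set \<Rightarrow> (real^'n^'n \<Rightarrow> bool) \<Rightarrow>
    (real^'n^'n \<Rightarrow> real) \<Rightarrow> (real^'n^'n \<Rightarrow> 'b::topological_space) \<Rightarrow> bool" where
  "intrinsic_mod_orientation \<H> C s Q \<longleftrightarrow>
     (\<forall>\<epsilon>\<in>{1, -1}. intrinsic \<H> (\<lambda>A. C A \<and> sgn (s A) = \<epsilon>) Q)"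

end

theory Submission
  imports Defs "HOL-Computational_Algebra.Fundamental_Theorem_Algebra"
begin

text \<open>In graph coordinates the Gauss equation at the base point gives the Riemann tensor as
  \<open>K (\<delta> \<delta> - \<delta> \<delta>)\<close> plus the 2-minors of \<open>A\<close>, so a quantity is a polynomial in the Riemann tensor as soon as it is
  a polynomial in the 2-minors of \<open>A\<close>. A 3-minor times an entry is a quadratic polynomial in the 2-minors.
  Antisymmetrizing pairs of rows in the sums of principal minors, it follows that
  \<open>\<sigma>\<^sub>2\<^sub>k\<^sub>+\<^sub>1(A) A\<close>, and with it \<open>\<sigma>\<^sub>2\<^sub>k\<^sub>+\<^sub>1(A) \<sigma>\<^sub>2\<^sub>l\<^sub>+\<^sub>1(A)\<close>, is a polynomial in the 2-minors
  if \<open>k \<ge> 1\<close>. Dividing by \<open>\<sigma>\<^sub>2\<^sub>k\<^sub>+\<^sub>1(A) = \<plusminus> sqrt (\<sigma>\<^sub>2\<^sub>k\<^sub>+\<^sub>1(A)\<^sup>2)\<close> recovers \<open>A\<close>. If \<open>A\<close> has rank at least three,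
  some 3-minor \<open>m\<close> is nonzero, and \<open>H\<^sup>2 = (\<Sum>m (m H)\<^sup>2) / (\<Sum>m m\<^sup>2)\<close>, \<open>H A = (\<Sum>m (m H) (m A)) / (\<Sum>m m\<^sup>2)\<close> with sums over
  all 3-minors.\<close>

section \<open>Polynomials in the Riemann tensor\<close>

text \<open>Replacing \<open>A\<close> by \<open>-A\<close> leaves all 2-minors unchanged, so
  without an orientation only even functions of \<open>A\<close> can be recovered; and a matrix of
  rank one has vanishing 2-minors whatever its trace is. This is why \<open>k = l = 0\<close> is
  excluded and why some 3-minor has to be present as a factor. The function \<phi> must serve all
  hypersurfaces at once, so the algebra consists of polynomial identities in the entries of an
  arbitrary matrix, and no principal directions are chosen. Real eigenvalues enter only to identify
  \<open>sigma_sym\<close>, which refers to an eigenvalue list, with sums of principal minors. On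
  the geometric side the obstacle is regularity: near the base point the first derivatives of the
  induced metric contain second derivatives of the immersion, which are merely continuous. Curvature
  is therefore computed with lowered indices, where each differentiation at the base point can be
  justified separately.\<close>

definition tensor_monomial :: "(('n::finite \<times> 'n \<times> 'n \<times> 'n) \<Rightarrow>\<^sub>0 nat) \<Rightarrow> 'n tensor22 \<Rightarrow> real" where
  "tensor_monomial m R = (\<Prod>(\<alpha>, \<beta>, \<gamma>, \<eta>)\<in>UNIV. (R $ \<alpha> $ \<beta> $ \<gamma> $ \<eta>) ^ Poly_Mapping.lookup m (\<alpha>, \<beta>, \<gamma>, \<eta>))"

definition total_exponent :: "('i::finite \<Rightarrow>\<^sub>0 nat) \<Rightarrow> nat" where
  "total_exponent m = (\<Sum>i\<in>UNIV. Poly_Mapping.lookup m i)"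

text \<open>Sums over \<open>keys\<close> change with the polynomial. A common finite index set
  makes evaluation additive term by term, and monomials outside the support have coefficient
  zero.\<close>

lemma poly_eval_superset:
  assumes "finite S" "Poly_Mapping.keys P \<subseteq> S"
  shows "poly_eval P R = (\<Sum>m\<in>S. Poly_Mapping.lookup P m * tensor_monomial m R)"
proof -
  have "(\<Prod>(\<alpha>, \<beta>, \<gamma>, \<eta>)\<in>Poly_Mapping.keys m. (R $ \<alpha> $ \<beta> $ \<gamma> $ \<eta>) ^ Poly_Mapping.lookup m (\<alpha>, \<beta>, \<gamma>, \<eta>))
      = tensor_monomial m R" for m
    unfolding tensor_monomial_def
    by (rule prod.mono_neutral_left) (auto simp: in_keys_iff)
  then show ?thesis
    unfolding poly_eval_def using assms
    by (auto intro!: sum.mono_neutral_left simp: in_keys_iff)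
qed

lemma poly_eval_add: "poly_eval (P + Q) R = poly_eval P R + poly_eval Q R"
proof -
  let ?S = "Poly_Mapping.keys P \<union> Poly_Mapping.keys Q"
  have "Poly_Mapping.keys (P + Q) \<subseteq> ?S" by (rule keys_add)
  then show ?thesis
    by (subst (1 2 3) poly_eval_superset[of ?S]) (auto simp: lookup_add algebra_simps sum.distrib)
qed

lemma poly_eval_single: "poly_eval (Poly_Mapping.single m c) R = c * tensor_monomial m R"
  by (subst poly_eval_superset[of "{m}"]) (auto simp: lookup_single)

lemma poly_eval_zero: "poly_eval 0 R = 0"
  by (simp add: poly_eval_def)

lemma poly_eval_sum: "poly_eval (\<Sum>i\<in>I. P i) R = (\<Sum>i\<in>I. poly_eval (P i) R)"
  by (induction I rule: infinite_finite_induct) (auto simp: poly_eval_add poly_eval_zero)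

lemma poly_degree_eq: "poly_degree P = Max (insert 0 (total_exponent ` Poly_Mapping.keys P))"
proof -
  have "(\<Sum>i\<in>Poly_Mapping.keys m. Poly_Mapping.lookup m i) = total_exponent m"
    for m :: "('a \<times> 'a \<times> 'a \<times> 'a) \<Rightarrow>\<^sub>0 nat"
    unfolding total_exponent_def by (rule sum.mono_neutral_left) (auto simp: in_keys_iff)
  then show ?thesis unfolding poly_degree_def by simp
qed

lemma poly_degree_le_iff:
  "poly_degree P \<le> d \<longleftrightarrow> (\<forall>m\<in>Poly_Mapping.keys P. total_exponent m \<le> d)"
  unfolding poly_degree_eq by (subst Max_le_iff) auto

lemma tensor_monomial_add: "tensor_monomial (m + m') R = tensor_monomial m R * tensor_monomial m' R"
  unfolding tensor_monomial_def
  by (subst prod.distrib[symmetric]) (auto intro!: prod.cong simp: lookup_add power_add)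

lemma total_exponent_add: "total_exponent (m + m') = total_exponent m + total_exponent m'"
  by (simp add: total_exponent_def lookup_add sum.distrib)

lemma total_exponent_single [simp]: "total_exponent (Poly_Mapping.single i e) = e"
  by (simp add: total_exponent_def lookup_single when_def)

lemma tensor_monomial_single:
  "tensor_monomial (Poly_Mapping.single (\<alpha>, \<beta>, \<gamma>, \<eta>) e) R = (R $ \<alpha> $ \<beta> $ \<gamma> $ \<eta>) ^ e"
proof -
  have "tensor_monomial (Poly_Mapping.single (\<alpha>, \<beta>, \<gamma>, \<eta>) e) R =
    (\<Prod>i\<in>UNIV. if i = (\<alpha>, \<beta>, \<gamma>, \<eta>) then (R $ \<alpha> $ \<beta> $ \<gamma> $ \<eta>) ^ e else 1)"
    unfolding tensor_monomial_def by (intro prod.cong) (auto simp: lookup_single when_def split: if_splits)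
  then show ?thesis by simp
qed

lemma tensor_monomial_zero [simp]: "tensor_monomial 0 R = 1"
  by (simp add: tensor_monomial_def case_prod_beta)

lemma total_exponent_zero [simp]: "total_exponent 0 = 0"
  by (simp add: total_exponent_def)

lemma continuous_on_poly_eval: "continuous_on S (poly_eval P)"
  unfolding poly_eval_def[abs_def] case_prod_beta by (intro continuous_intros)

text \<open>The value taken by the (2,2) Riemann tensor according to the Gauss equation.\<close>

definition gauss_tensor :: "real \<Rightarrow> real^'n^'n \<Rightarrow> ('n::finite) tensor22" where
  "gauss_tensor K A = (\<chi> \<alpha> \<beta> \<gamma> \<eta>.
     K * (of_bool (\<alpha> = \<gamma>) * of_bool (\<beta> = \<eta>) - of_bool (\<alpha> = \<eta>) * of_bool (\<beta> = \<gamma>))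
     + (A $ \<alpha> $ \<gamma> * A $ \<beta> $ \<eta> - A $ \<alpha> $ \<eta> * A $ \<beta> $ \<gamma>))"

text \<open>The identity is demanded for all matrices, so that no geometry enters. The number
  \<open>d\<close> only bounds the degree: in sums the leading terms may cancel.\<close>

definition curvature_poly :: "real \<Rightarrow> nat \<Rightarrow> (real^'n^'n \<Rightarrow> real) \<Rightarrow> bool" where
  "curvature_poly K d F \<longleftrightarrow>
     (\<exists>P :: ('n::finite) tensor_poly. poly_degree P \<le> d \<and> (\<forall>A. F A = poly_eval P (gauss_tensor K A)))"

lemma curvature_polyI:
  fixes m :: "'i \<Rightarrow> ('n::finite \<times> 'n \<times> 'n \<times> 'n) \<Rightarrow>\<^sub>0 nat"
  assumes "\<And>i. i \<in> I \<Longrightarrow> total_exponent (m i) \<le> d"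
    and "\<And>A. F A = (\<Sum>i\<in>I. c i * tensor_monomial (m i) (gauss_tensor K A))"
  shows "curvature_poly K d F"
proof -
  let ?P = "\<Sum>i\<in>I. Poly_Mapping.single (m i) (c i)"
  have "Poly_Mapping.keys ?P \<subseteq> (\<Union>i\<in>I. Poly_Mapping.keys (Poly_Mapping.single (m i) (c i)))"
    by (rule keys_sum)
  then have "Poly_Mapping.keys ?P \<subseteq> m ` I" by (auto split: if_splits)
  then have "poly_degree ?P \<le> d" using assms(1) by (auto simp: poly_degree_le_iff)
  then show ?thesis unfolding curvature_poly_def using assms(2)
    by (intro exI[of _ ?P]) (simp add: poly_eval_sum poly_eval_single)
qed

lemma curvature_polyE:
  assumes "curvature_poly K d F"
  obtains I :: "(('n::finite \<times> 'n \<times> 'n \<times> 'n) \<Rightarrow>\<^sub>0 nat) set" and c where "finite I"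
    "\<And>m. m \<in> I \<Longrightarrow> total_exponent m \<le> d"
    "\<And>A. F A = (\<Sum>m\<in>I. c m * tensor_monomial m (gauss_tensor K A))"
proof -
  obtain P where P: "poly_degree P \<le> d" "\<And>A. F A = poly_eval P (gauss_tensor K A)"
    using assms unfolding curvature_poly_def by auto
  show thesis
    by (rule that[of "Poly_Mapping.keys P" "Poly_Mapping.lookup P"])
      (use P in \<open>auto simp: poly_degree_le_iff poly_eval_superset[of "Poly_Mapping.keys P"]\<close>)
qed

lemma curvature_poly_const: "curvature_poly K d (\<lambda>A::real^'n::finite^'n. c)"
  by (rule curvature_polyI[where I = "{()}" and m = "\<lambda>_. 0" and c = "\<lambda>_. c"]) auto

lemma curvature_poly_add:
  assumes "curvature_poly K d F" "curvature_poly K d G"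
  shows "curvature_poly K d (\<lambda>A. F A + G A)"
proof -
  obtain P Q where "poly_degree P \<le> d" "\<And>A. F A = poly_eval P (gauss_tensor K A)"
    "poly_degree Q \<le> d" "\<And>A. G A = poly_eval Q (gauss_tensor K A)"
    using assms unfolding curvature_poly_def by auto
  then show ?thesis
    unfolding curvature_poly_def
    by (intro exI[of _ "P + Q"]) (auto simp: poly_degree_le_iff poly_eval_add dest!: subsetD[OF keys_add])
qed

text \<open>Both factors are expanded into monomials. The exponents of a product of two monomials
  add up, which gives the degree bound \<open>d + e\<close>.\<close>

lemma curvature_poly_mult:
  assumes "curvature_poly K d F" "curvature_poly K e G"
  shows "curvature_poly K (d + e) (\<lambda>A. F A * G A)"
proof -
  obtain I c where I: "\<And>m. m \<in> I \<Longrightarrow> total_exponent m \<le> d"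
    "\<And>A. F A = (\<Sum>m\<in>I. c m * tensor_monomial m (gauss_tensor K A))"
    using assms(1) by (elim curvature_polyE) blast
  obtain J b where J: "\<And>m. m \<in> J \<Longrightarrow> total_exponent m \<le> e"
    "\<And>A. G A = (\<Sum>m\<in>J. b m * tensor_monomial m (gauss_tensor K A))"
    using assms(2) by (elim curvature_polyE) blast
  have "F A * G A = (\<Sum>(m, m')\<in>I \<times> J. (c m * b m') * tensor_monomial (m + m') (gauss_tensor K A))" for A
    unfolding I(2) J(2) sum_product sum.cartesian_product
    by (intro sum.cong) (auto simp: tensor_monomial_add)
  then show ?thesis
    by (intro curvature_polyI[where I = "I \<times> J" and m = "\<lambda>(m, m'). m + m'" and c = "\<lambda>(m, m'). c m * b m'"])
      (auto simp: total_exponent_add case_prod_beta intro!: add_mono I(1) J(1))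
qed

lemma curvature_poly_sum:
  "(\<And>i. i \<in> I \<Longrightarrow> curvature_poly K d (F i)) \<Longrightarrow> curvature_poly K d (\<lambda>A. \<Sum>i\<in>I. F i A)"
  by (induction I rule: infinite_finite_induct) (auto intro: curvature_poly_add curvature_poly_const)

lemma curvature_poly_cmult:
  "curvature_poly K d F \<Longrightarrow> curvature_poly K d (\<lambda>A. c * F A)"
  using curvature_poly_mult[OF curvature_poly_const[of K 0 c]] by simp

lemma curvature_poly_diff:
  "curvature_poly K d F \<Longrightarrow> curvature_poly K d G \<Longrightarrow> curvature_poly K d (\<lambda>A. F A - G A)"
  using curvature_poly_add[of K d F "\<lambda>A. -1 * G A"] curvature_poly_cmult[of K d G "-1"] by simp

text \<open>A 2-minor is a component of the tensor minus the corresponding component of the constant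
  curvature model, and the latter does not depend on \<open>A\<close>.\<close>

lemma curvature_poly_minor2:
  "curvature_poly K 1 (\<lambda>A. A $ \<alpha> $ \<gamma> * A $ \<beta> $ \<eta> - A $ \<alpha> $ \<eta> * A $ \<beta> $ \<gamma>)"
proof -
  let ?c = "K * (of_bool (\<alpha> = \<gamma>) * of_bool (\<beta> = \<eta>) - of_bool (\<alpha> = \<eta>) * of_bool (\<beta> = \<gamma>))"
  have "curvature_poly K 1 (\<lambda>A. gauss_tensor K A $ \<alpha> $ \<beta> $ \<gamma> $ \<eta>)"
    by (rule curvature_polyI[where I = "{()}" and m = "\<lambda>_. Poly_Mapping.single (\<alpha>, \<beta>, \<gamma>, \<eta>) 1" and c = "\<lambda>_. 1"])
      (auto simp: tensor_monomial_single)
  from curvature_poly_diff[OF this curvature_poly_const[of K 1 ?c]] show ?thesis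
    by (simp add: gauss_tensor_def)
qed

text \<open>The padding term vanishes because the Riemann tensor is antisymmetric in its lower indices.\<close>

lemma curvature_poly_exact_degree:
  fixes F :: "real^'n::finite^'n \<Rightarrow> real"
  assumes "curvature_poly K d F" "d > 0"
  obtains P :: "'n tensor_poly" where "poly_degree P = d" "\<And>A. F A = poly_eval P (gauss_tensor K A)"
proof -
  obtain P where P: "poly_degree P \<le> d" "\<And>A. F A = poly_eval P (gauss_tensor K A)"
    using assms unfolding curvature_poly_def by auto
  show thesis
  proof (cases "poly_degree P = d")
    case False
    fix a :: 'n
    define m where "m = Poly_Mapping.single (a, a, a, a) d"
    define Q where "Q = P + Poly_Mapping.single m 1"
    have m: "total_exponent m = d" by (simp add: m_def)
    then have "m \<notin> Poly_Mapping.keys P"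
      using False P(1) poly_degree_le_iff[of P "d - 1"]
      by (metis le_antisym poly_degree_le_iff order_le_less)
    then have "m \<in> Poly_Mapping.keys Q"
      by (simp add: Q_def in_keys_iff lookup_add)
    then have "d \<le> poly_degree Q"
      using poly_degree_le_iff[of Q "poly_degree Q"] m by auto
    moreover have "poly_degree Q \<le> d"
      using P(1) m by (auto simp: Q_def poly_degree_le_iff dest!: subsetD[OF keys_add] split: if_splits)
    moreover have "poly_eval Q (gauss_tensor K A) = F A" for A
      using \<open>d > 0\<close> by (simp add: Q_def poly_eval_add poly_eval_single P(2) m_def tensor_monomial_single gauss_tensor_def)
    ultimately show thesis using that[of Q] by simp
  qed (use that P in blast)
qed

section \<open>Products of odd minors as polynomials in the 2-minors\<close>

text \<open>The expansion along the first row. Row and column triples may contain repetitions, for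
  which the value is zero, so that sums over all triples are sums over honest minors.\<close>

definition minor3 :: "real^'n^'n \<Rightarrow> 'n \<times> 'n \<times> 'n \<Rightarrow> 'n \<times> 'n \<times> 'n \<Rightarrow> real" where
  "minor3 A = (\<lambda>(a, b, c) (d, e, f).
     A $ a $ d * (A $ b $ e * A $ c $ f - A $ b $ f * A $ c $ e)
   - A $ a $ e * (A $ b $ d * A $ c $ f - A $ b $ f * A $ c $ d)
   + A $ a $ f * (A $ b $ d * A $ c $ e - A $ b $ e * A $ c $ d))"

definition minor2 :: "real^'n^'n \<Rightarrow> 'n \<Rightarrow> 'n \<Rightarrow> 'n \<Rightarrow> 'n \<Rightarrow> real" where
  "minor2 A a b d e = A $ a $ d * A $ b $ e - A $ a $ e * A $ b $ d"

text \<open>The right-hand side combines products of complementary 2-minors of the block with rows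
  \<open>a\<close>, \<open>b\<close>, \<open>c\<close>, \<open>g\<close> and columns \<open>d\<close>, \<open>e\<close>, \<open>f\<close>, \<open>h\<close>; the coefficients solve a linear system. A single
  odd minor is not a polynomial in the 2-minors, but by this identity its products with the entries are.\<close>

lemma minor3_times_entry:
  "2 * (A $ a $ d * minor3 A (b, c, g) (e, f, h)) =
     - minor2 A a b e f * minor2 A c g d h + minor2 A a b e h * minor2 A c g d f
     - minor2 A a b f h * minor2 A c g d e - minor2 A a c d e * minor2 A b g f h
     + minor2 A a c d f * minor2 A b g e h - minor2 A a c d h * minor2 A b g e f
     + minor2 A a g d e * minor2 A b c f h - minor2 A a g d f * minor2 A b c e h
     + minor2 A a g d h * minor2 A b c e f"
  unfolding minor3_def minor2_def by (simp add: algebra_simps)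

lemma curvature_poly_minor3_entry:
  "curvature_poly K 2 (\<lambda>A. minor3 A (b, c, g) (e, f, h) * A $ a $ d)"
proof -
  have *: "curvature_poly K 2 (\<lambda>A. minor2 A a b d e * minor2 A a' b' d' e')" for a b d e a' b' d' e'
    using curvature_poly_mult[OF curvature_poly_minor2[of K a d b e] curvature_poly_minor2[of K a' d' b' e']]
    by (simp add: minor2_def numeral_2_eq_2)
  \<comment> \<open>The first two terms of the identity are exchanged, so that the expression starts
    without a minus sign and is built from sums and differences alone.\<close>
  have "curvature_poly K 2 (\<lambda>A. (1/2) * (
     minor2 A a b e h * minor2 A c g d f - minor2 A a b e f * minor2 A c g d h
     - minor2 A a b f h * minor2 A c g d e - minor2 A a c d e * minor2 A b g f h
     + minor2 A a c d f * minor2 A b g e h - minor2 A a c d h * minor2 A b g e f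
     + minor2 A a g d e * minor2 A b c f h - minor2 A a g d f * minor2 A b c e h
     + minor2 A a g d h * minor2 A b c e f))"
    by (intro curvature_poly_cmult curvature_poly_add curvature_poly_diff *)
  moreover have "minor3 A (b, c, g) (e, f, h) * A $ a $ d = (1/2) * (
     minor2 A a b e h * minor2 A c g d f - minor2 A a b e f * minor2 A c g d h
     - minor2 A a b f h * minor2 A c g d e - minor2 A a c d e * minor2 A b g f h
     + minor2 A a c d f * minor2 A b g e h - minor2 A a c d h * minor2 A b g e f
     + minor2 A a g d e * minor2 A b c f h - minor2 A a g d f * minor2 A b c e h
     + minor2 A a g d h * minor2 A b c e f)" for A
    using minor3_times_entry[of A a d b c g e f h] by (simp add: algebra_simps)
  ultimately show ?thesis by presburger
qed

text \<open>One of the two factors is expanded along its first row. Each of its entries is paired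
  with the other 3-minor, which costs degree 2, and the remaining 2-minor adds 1.\<close>

lemma curvature_poly_minor3_square: "curvature_poly K 3 (\<lambda>A. (minor3 A x y)\<^sup>2)"
proof -
  obtain a b c d e f where [simp]: "x = (a, b, c)" "y = (d, e, f)" by (metis prod_cases3)
  have *: "curvature_poly K 3 (\<lambda>A. minor3 A (a, b, c) (d, e, f) * A $ i $ j * minor2 A b c l l')" for i j l l'
    using curvature_poly_mult[OF curvature_poly_minor3_entry[of K a b c d e f i j] curvature_poly_minor2[of K b l c l']]
    by (simp add: minor2_def)
  have "curvature_poly K 3 (\<lambda>A. minor3 A (a, b, c) (d, e, f) * A $ a $ d * minor2 A b c e f
     - minor3 A (a, b, c) (d, e, f) * A $ a $ e * minor2 A b c d f
     + minor3 A (a, b, c) (d, e, f) * A $ a $ f * minor2 A b c d e)"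
    by (intro curvature_poly_add curvature_poly_diff *)
  moreover have "(minor3 A x y)\<^sup>2 = minor3 A (a, b, c) (d, e, f) * A $ a $ d * minor2 A b c e f
     - minor3 A (a, b, c) (d, e, f) * A $ a $ e * minor2 A b c d f
     + minor3 A (a, b, c) (d, e, f) * A $ a $ f * minor2 A b c d e" for A
  proof -
    have "(minor3 A x y)\<^sup>2 = minor3 A (a, b, c) (d, e, f) * (A $ a $ d * minor2 A b c e f
       - A $ a $ e * minor2 A b c d f + A $ a $ f * minor2 A b c d e)"
      by (simp add: minor3_def minor2_def power2_eq_square)
    then show ?thesis by (simp add: right_diff_distrib distrib_left mult.assoc)
  qed
  ultimately show ?thesis by presburger
qed

section \<open>Alternating sums over the permutations of a set of rows\<close>

definition perm_sum :: "'n set \<Rightarrow> (('n \<Rightarrow> 'n) \<Rightarrow> real) \<Rightarrow> real" where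
  "perm_sum S F = (\<Sum>\<pi> | \<pi> permutes S. of_int (sign \<pi>) * F \<pi>)"

text \<open>The determinant of the submatrix with rows and columns in \<open>S\<close>, as a Leibniz
  sum because the index range of a matrix is a type whereas \<open>S\<close> is a set. For the empty
  set the value is 1.\<close>

definition principal_minor :: "'n set \<Rightarrow> real^'n^'n \<Rightarrow> real" where
  "principal_minor S A = perm_sum S (\<lambda>\<pi>. \<Prod>i\<in>S. A $ i $ \<pi> i)"

text \<open>Composition with \<tau> is a bijection of the permutations of \<open>S\<close>, and
  signs are multiplicative. For a transposition this is the antisymmetry under the exchange of two
  rows.\<close>

lemma perm_sum_reindex:
  assumes "finite S" "\<tau> permutes S"
  shows "perm_sum S F = of_int (sign \<tau>) * perm_sum S (\<lambda>\<pi>. F (\<pi> \<circ> \<tau>))"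
proof -
  have "perm_sum S F = (\<Sum>\<pi> | \<pi> permutes S. of_int (sign (\<pi> \<circ> \<tau>)) * F (\<pi> \<circ> \<tau>))"
    unfolding perm_sum_def using assms(2) by (rule sum_permutations_compose_right)
  also have "\<dots> = (\<Sum>\<pi> | \<pi> permutes S. of_int (sign \<tau>) * (of_int (sign \<pi>) * F (\<pi> \<circ> \<tau>)))"
  proof (intro sum.cong refl)
    fix \<pi> assume "\<pi> \<in> {\<pi>. \<pi> permutes S}"
    then have "sign (\<pi> \<circ> \<tau>) = sign \<pi> * sign \<tau>"
      using assms by (intro sign_compose) (auto simp: permutation_permutes)
    then show "of_int (sign (\<pi> \<circ> \<tau>)) * F (\<pi> \<circ> \<tau>) =
        of_int (sign \<tau>) * (of_int (sign \<pi>) * F (\<pi> \<circ> \<tau>))"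
      by simp
  qed
  finally show ?thesis unfolding perm_sum_def sum_distrib_left .
qed

lemma perm_sum_cong: "(\<And>\<pi>. \<pi> permutes S \<Longrightarrow> F \<pi> = G \<pi>) \<Longrightarrow> perm_sum S F = perm_sum S G"
  unfolding perm_sum_def by (intro sum.cong) auto

lemma perm_sum_diff: "perm_sum S F - perm_sum S G = perm_sum S (\<lambda>\<pi>. F \<pi> - G \<pi>)"
  by (simp add: perm_sum_def sum_subtractf algebra_simps)

lemma perm_sum_cmult: "perm_sum S (\<lambda>\<pi>. c * F \<pi>) = c * perm_sum S F"
  by (simp add: perm_sum_def sum_distrib_left mult_ac)

text \<open>Exchanging the rows \<open>a\<close> and \<open>b\<close> reverses the sign of the sum
  but does not affect \<open>G\<close>. Half the difference of the sum and its exchanged version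
  replaces the product of two entries by half of a 2-minor.\<close>

lemma perm_sum_pair:
  assumes "finite S" "a \<in> S" "b \<in> S" "a \<noteq> b"
    and inv: "\<And>\<pi>. G (\<pi> \<circ> Transposition.transpose a b) = G \<pi>"
  shows "perm_sum S (\<lambda>\<pi>. A $ a $ \<pi> a * A $ b $ \<pi> b * G \<pi>)
    = (1/2) * perm_sum S (\<lambda>\<pi>. minor2 A a b (\<pi> a) (\<pi> b) * G \<pi>)"
proof -
  let ?F = "\<lambda>\<pi>. A $ a $ \<pi> a * A $ b $ \<pi> b * G \<pi>"
  have "perm_sum S ?F = - perm_sum S (\<lambda>\<pi>. ?F (\<pi> \<circ> Transposition.transpose a b))"
    using perm_sum_reindex[of S "Transposition.transpose a b" ?F] assms
    by (simp add: permutes_swap_id sign_swap_id)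
  then have "2 * perm_sum S ?F = perm_sum S ?F - perm_sum S (\<lambda>\<pi>. ?F (\<pi> \<circ> Transposition.transpose a b))"
    by simp
  also have "\<dots> = perm_sum S (\<lambda>\<pi>. minor2 A a b (\<pi> a) (\<pi> b) * G \<pi>)"
    unfolding perm_sum_diff by (intro perm_sum_cong) (simp only: inv o_apply, simp add: minor2_def algebra_simps)
  finally show ?thesis by simp
qed

text \<open>The factor 1/6 is 1/2 times 1/3. The rows \<open>b\<close> and \<open>c\<close> are
  first combined into a 2-minor; the exchanges of \<open>a\<close> with \<open>b\<close> and of
  \<open>a\<close> with \<open>c\<close> then turn this term into the other two terms of the
  expansion of the 3-minor along row \<open>a\<close>, and the three equal sums are
  averaged.\<close>

lemma perm_sum_triple:
  assumes "finite S" "a \<in> S" "b \<in> S" "c \<in> S" "distinct [a, b, c]"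
    and inv: "\<And>\<pi> x y. x \<in> {a, b, c} \<Longrightarrow> y \<in> {a, b, c} \<Longrightarrow> G (\<pi> \<circ> Transposition.transpose x y) = G \<pi>"
  shows "perm_sum S (\<lambda>\<pi>. A $ a $ \<pi> a * A $ b $ \<pi> b * A $ c $ \<pi> c * G \<pi>)
    = (1/6) * perm_sum S (\<lambda>\<pi>. minor3 A (a, b, c) (\<pi> a, \<pi> b, \<pi> c) * G \<pi>)"
proof -
  let ?F = "\<lambda>\<pi>. A $ a $ \<pi> a * A $ b $ \<pi> b * A $ c $ \<pi> c * G \<pi>"
  let ?H = "\<lambda>\<pi>. minor2 A b c (\<pi> b) (\<pi> c) * (A $ a $ \<pi> a * G \<pi>)"
  have swap: "perm_sum S F = - perm_sum S (\<lambda>\<pi>. F (\<pi> \<circ> Transposition.transpose x y))"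
    if "x \<in> {a, b, c}" "y \<in> {a, b, c}" "x \<noteq> y" for F x y
    using perm_sum_reindex[of S "Transposition.transpose x y" F] that assms
    by (auto simp: permutes_swap_id sign_swap_id)
  have "perm_sum S ?F = perm_sum S (\<lambda>\<pi>. A $ b $ \<pi> b * A $ c $ \<pi> c * (A $ a $ \<pi> a * G \<pi>))"
    by (simp add: mult_ac)
  also have "\<dots> = (1/2) * perm_sum S ?H"
    using assms by (intro perm_sum_pair) (auto simp: inv)
  finally have 1: "perm_sum S ?F = (1/2) * perm_sum S ?H" .
  have 2: "perm_sum S ?H = - perm_sum S (\<lambda>\<pi>. minor2 A b c (\<pi> a) (\<pi> c) * (A $ a $ \<pi> b * G \<pi>))"
    using swap[of a b ?H] assms(5) by (auto simp: inv Transposition.transpose_def)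
  have 3: "perm_sum S ?H = - perm_sum S (\<lambda>\<pi>. minor2 A b c (\<pi> b) (\<pi> a) * (A $ a $ \<pi> c * G \<pi>))"
    using swap[of a c ?H] assms(5) by (auto simp: inv Transposition.transpose_def)
  have "3 * perm_sum S ?H = perm_sum S ?H
      - perm_sum S (\<lambda>\<pi>. minor2 A b c (\<pi> a) (\<pi> c) * (A $ a $ \<pi> b * G \<pi>))
      - perm_sum S (\<lambda>\<pi>. minor2 A b c (\<pi> b) (\<pi> a) * (A $ a $ \<pi> c * G \<pi>))"
    using 2 3 by simp
  also have "\<dots> = perm_sum S (\<lambda>\<pi>. minor3 A (a, b, c) (\<pi> a, \<pi> b, \<pi> c) * G \<pi>)"
    unfolding perm_sum_diff by (intro perm_sum_cong) (simp add: minor3_def minor2_def algebra_simps)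
  finally show ?thesis using 1 by simp
qed

lemma curvature_poly_perm_sum:
  assumes "\<And>\<pi>. curvature_poly K d (F \<pi>)"
  shows "curvature_poly K d (\<lambda>A. perm_sum S (\<lambda>\<pi>. F \<pi> A))"
  unfolding perm_sum_def using assms by (intro curvature_poly_sum curvature_poly_cmult)

text \<open>The entries in the rows \<open>T\<close> are turned into 2-minors one pair of rows at a time.\<close>

lemma curvature_poly_perm_sum_even:
  fixes S :: "'n::finite set"
  assumes "T \<subseteq> S" "card T = 2 * q"
    and "\<And>\<pi>. curvature_poly K d (G \<pi>)"
    and "\<And>\<pi> x y. x \<in> T \<Longrightarrow> y \<in> T \<Longrightarrow> G (\<pi> \<circ> Transposition.transpose x y) = G \<pi>"
  shows "curvature_poly K (d + q) (\<lambda>A. perm_sum S (\<lambda>\<pi>. G \<pi> A * (\<Prod>r\<in>T. A $ r $ \<pi> r)))"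
  using assms
proof (induction q arbitrary: T d G)
  case 0
  then have "T = {}" by simp
  with 0 show ?case by (simp add: curvature_poly_perm_sum)
next
  case (Suc q)
  have "2 \<le> card T" using Suc.prems(2) by simp
  then obtain a b where ab: "a \<in> T" "b \<in> T" "a \<noteq> b"
    by (metis card_2_iff' obtain_subset_with_card_n subset_eq)
  define T' where "T' = T - {a, b}"
  have T: "T = insert a (insert b T')" "a \<notin> T'" "b \<notin> T'" using ab by (auto simp: T'_def)
  have fin: "finite S" "finite T'" by simp_all
  have card: "card T' = 2 * q" using Suc.prems(2) ab unfolding T'_def by (simp add: card_Diff_insert)
  \<comment> \<open>The new 2-minor is absorbed into the factor that is already built. It involves
    only the columns assigned to \<open>a\<close> and \<open>b\<close>, so transpositions of the
    rows left in \<open>T'\<close> do not affect it.\<close>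
  define G' where "G' \<pi> A = minor2 A a b (\<pi> a) (\<pi> b) * G \<pi> A" for \<pi> and A :: "real^'n^'n"
  have G'1: "curvature_poly K (Suc d) (G' \<pi>)" for \<pi>
    using curvature_poly_mult[OF curvature_poly_minor2[of K a "\<pi> a" b "\<pi> b"] Suc.prems(3)[of \<pi>]]
    unfolding G'_def[abs_def] minor2_def by simp
  have G'2: "G' (\<pi> \<circ> Transposition.transpose x y) = G' \<pi>" if "x \<in> T'" "y \<in> T'" for \<pi> x y
  proof -
    have "Transposition.transpose x y a = a" "Transposition.transpose x y b = b"
      using that T by (auto intro!: transpose_apply_other)
    then show ?thesis using Suc.prems(4)[of x y \<pi>] that T by (intro ext) (simp add: G'_def o_def)
  qed
  have "curvature_poly K (Suc d + q) (\<lambda>A. perm_sum S (\<lambda>\<pi>. G' \<pi> A * (\<Prod>r\<in>T'. A $ r $ \<pi> r)))"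
    using Suc.prems(1) T card by (intro Suc.IH G'1 G'2) auto
  then have "curvature_poly K (Suc d + q)
      (\<lambda>A. (1/2) * perm_sum S (\<lambda>\<pi>. G' \<pi> A * (\<Prod>r\<in>T'. A $ r $ \<pi> r)))"
    by (rule curvature_poly_cmult)
  moreover have "perm_sum S (\<lambda>\<pi>. G \<pi> A * (\<Prod>r\<in>T. A $ r $ \<pi> r)) =
      (1/2) * perm_sum S (\<lambda>\<pi>. G' \<pi> A * (\<Prod>r\<in>T'. A $ r $ \<pi> r))" for A
  proof -
    have "perm_sum S (\<lambda>\<pi>. G \<pi> A * (\<Prod>r\<in>T. A $ r $ \<pi> r)) =
       perm_sum S (\<lambda>\<pi>. A $ a $ \<pi> a * A $ b $ \<pi> b * (G \<pi> A * (\<Prod>r\<in>T'. A $ r $ \<pi> r)))"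
      using T ab fin by (intro perm_sum_cong) (simp add: mult_ac)
    also have "\<dots> = (1/2) * perm_sum S (\<lambda>\<pi>. minor2 A a b (\<pi> a) (\<pi> b) * (G \<pi> A * (\<Prod>r\<in>T'. A $ r $ \<pi> r)))"
    proof (rule perm_sum_pair)
      fix \<pi>
      have "(\<Prod>r\<in>T'. A $ r $ (\<pi> \<circ> Transposition.transpose a b) r) = (\<Prod>r\<in>T'. A $ r $ \<pi> r)"
        using T by (intro prod.cong refl) (auto simp: Transposition.transpose_def)
      then show "G (\<pi> \<circ> Transposition.transpose a b) A * (\<Prod>r\<in>T'. A $ r $ (\<pi> \<circ> Transposition.transpose a b) r) =
          G \<pi> A * (\<Prod>r\<in>T'. A $ r $ \<pi> r)"
        by (simp only: Suc.prems(4)[OF ab(1,2)])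
    qed (use ab Suc.prems fin in auto)
    finally show ?thesis by (simp add: G'_def mult_ac)
  qed
  ultimately show ?case by (simp only: add_Suc add_Suc_right)
qed

text \<open>Three rows of \<open>S\<close> form a 3-minor, which together with the entry has degree
  2. The other \<open>2 * (k - 1)\<close> rows are combined in pairs and contribute
  \<open>k - 1\<close>.\<close>

lemma curvature_poly_principal_minor_entry:
  fixes S :: "'n::finite set"
  assumes "card S = 2 * k + 1" "k \<ge> 1"
  shows "curvature_poly K (k + 1) (\<lambda>A. principal_minor S A * A $ i $ j)"
proof -
  obtain q where k: "k = Suc q" using assms(2) by (cases k) auto
  have "3 \<le> card S" using assms by simp
  then obtain U where U: "U \<subseteq> S" "card U = 3" by (meson obtain_subset_with_card_n)
  then obtain a b c where abc: "U = {a, b, c}" "a \<noteq> b" "a \<noteq> c" "b \<noteq> c"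
    by (auto simp: card_3_iff)
  define T where "T = S - U"
  have T: "S = insert a (insert b (insert c T))" "a \<notin> T" "b \<notin> T" "c \<notin> T"
    using abc U by (auto simp: T_def)
  have card: "card T = 2 * q" using U assms(1) k by (simp add: T_def card_Diff_subset)
  have fin: "finite S" "finite T" by simp_all
  define G where "G \<pi> A = minor3 A (a, b, c) (\<pi> a, \<pi> b, \<pi> c) * A $ i $ j"
    for \<pi> :: "'n \<Rightarrow> 'n" and A :: "real^'n^'n"
  have G: "G (\<pi> \<circ> Transposition.transpose x y) = G \<pi>" if "x \<in> T" "y \<in> T" for \<pi> x y
  proof -
    have "Transposition.transpose x y a = a" "Transposition.transpose x y b = b" "Transposition.transpose x y c = c"
      using that T by (auto intro!: transpose_apply_other)
    then show ?thesis by (intro ext) (simp add: G_def)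
  qed
  have "curvature_poly K (2 + q) (\<lambda>A. perm_sum S (\<lambda>\<pi>. G \<pi> A * (\<Prod>r\<in>T. A $ r $ \<pi> r)))"
    using card T by (intro curvature_poly_perm_sum_even G)
      (auto simp: G_def[abs_def] curvature_poly_minor3_entry)
  then have "curvature_poly K (k + 1)
      (\<lambda>A. (1/6) * perm_sum S (\<lambda>\<pi>. G \<pi> A * (\<Prod>r\<in>T. A $ r $ \<pi> r)))"
    unfolding k by (intro curvature_poly_cmult) simp
  moreover have "principal_minor S A * A $ i $ j =
      (1/6) * perm_sum S (\<lambda>\<pi>. G \<pi> A * (\<Prod>r\<in>T. A $ r $ \<pi> r))" for A
  proof -
    have "principal_minor S A * A $ i $ j = perm_sum S (\<lambda>\<pi>. A $ i $ j * (\<Prod>r\<in>S. A $ r $ \<pi> r))"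
      by (simp add: principal_minor_def perm_sum_cmult)
    also have "\<dots> = perm_sum S (\<lambda>\<pi>. A $ a $ \<pi> a * A $ b $ \<pi> b * A $ c $ \<pi> c *
        (A $ i $ j * (\<Prod>r\<in>T. A $ r $ \<pi> r)))"
      by (subst T(1)) (use T abc in \<open>simp add: mult_ac\<close>)
    also have "\<dots> = (1/6) * perm_sum S (\<lambda>\<pi>. minor3 A (a, b, c) (\<pi> a, \<pi> b, \<pi> c) *
        (A $ i $ j * (\<Prod>r\<in>T. A $ r $ \<pi> r)))"
    proof (rule perm_sum_triple)
      fix \<pi> x y assume "x \<in> {a, b, c}" "y \<in> {a, b, c}"
      then have "(\<Prod>r\<in>T. A $ r $ (\<pi> \<circ> Transposition.transpose x y) r) = (\<Prod>r\<in>T. A $ r $ \<pi> r)"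
        using T by (intro prod.cong refl) (auto simp: Transposition.transpose_def)
      then show "A $ i $ j * (\<Prod>r\<in>T. A $ r $ (\<pi> \<circ> Transposition.transpose x y) r) = A $ i $ j * (\<Prod>r\<in>T. A $ r $ \<pi> r)"
        by simp
    qed (use abc T in auto)
    finally show ?thesis by (simp add: G_def mult_ac)
  qed
  ultimately show ?thesis by presburger
qed

text \<open>One row of \<open>S'\<close> lends its entry to the first minor, which makes a
  polynomial of degree \<open>k + 1\<close>. The \<open>2 * l\<close> remaining rows of
  \<open>S'\<close> are even in number and contribute \<open>l\<close>.\<close>

lemma curvature_poly_principal_minor_mult:
  fixes S S' :: "'n::finite set"
  assumes "card S = 2 * k + 1" "k \<ge> 1" "card S' = 2 * l + 1"
  shows "curvature_poly K (k + l + 1) (\<lambda>A. principal_minor S A * principal_minor S' A)"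
proof -
  have "card S' \<noteq> 0" using assms by simp
  then obtain g where g: "g \<in> S'" by (metis card.empty equals0I)
  define T where "T = S' - {g}"
  have T: "S' = insert g T" "g \<notin> T" "card T = 2 * l" using g assms(3) by (auto simp: T_def)
  define G where "G \<pi> A = principal_minor S A * A $ g $ \<pi> g"
    for \<pi> :: "'n \<Rightarrow> 'n" and A :: "real^'n^'n"
  have "G (\<pi> \<circ> Transposition.transpose x y) = G \<pi>" if "x \<in> T" "y \<in> T" for \<pi> x y
  proof -
    have "Transposition.transpose x y g = g"
      using that T by (auto intro!: transpose_apply_other)
    then show ?thesis by (intro ext) (simp add: G_def)
  qed
  then have "curvature_poly K ((k + 1) + l) (\<lambda>A. perm_sum S' (\<lambda>\<pi>. G \<pi> A * (\<Prod>r\<in>T. A $ r $ \<pi> r)))"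
    using T assms by (intro curvature_poly_perm_sum_even)
      (auto simp: G_def[abs_def] intro!: curvature_poly_principal_minor_entry[simplified])
  moreover have "principal_minor S A * principal_minor S' A =
      perm_sum S' (\<lambda>\<pi>. G \<pi> A * (\<Prod>r\<in>T. A $ r $ \<pi> r))" for A
    unfolding principal_minor_def[of S'] perm_sum_cmult[symmetric]
    by (subst (2) T(1)) (use T in \<open>simp add: G_def mult_ac\<close>)
  ultimately show ?thesis by (simp add: add.commute add.left_commute)
qed

section \<open>The characteristic polynomial\<close>

text \<open>Each factor of the Leibniz formula is a sum of an entry of \<open>-A\<close> and a
  diagonal term, and \<open>S\<close> collects the indices where the entry is taken. On the
  complement the diagonal term forces \<pi> to fix the index, so only permutations of
  \<open>S\<close> survive. The ring is general because the formula is applied over the reals and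
  over the complex numbers.\<close>

lemma det_char_expansion:
  fixes A :: "'a::comm_ring_1^'n^'n"
  shows "det (mat t - A) = (\<Sum>S\<in>UNIV. (-1) ^ card S * t ^ (CARD('n) - card S) *
     (\<Sum>\<pi> | \<pi> permutes S. of_int (sign \<pi>) * (\<Prod>i\<in>S. A $ i $ \<pi> i)))"
proof -
  have "det (mat t - A) = (\<Sum>\<pi> | \<pi> permutes UNIV. of_int (sign \<pi>) *
      (\<Prod>i\<in>UNIV. - A $ i $ \<pi> i + of_bool (i = \<pi> i) * t))"
    unfolding det_def by (intro sum.cong refl arg_cong2[of _ _ _ _ "(*)"] prod.cong) (auto simp: mat_def)
  also have "\<dots> = (\<Sum>\<pi> | \<pi> permutes UNIV. \<Sum>S\<in>UNIV. of_int (sign \<pi>) *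
      ((\<Prod>i\<in>S. - A $ i $ \<pi> i) * (\<Prod>i\<in>-S. of_bool (i = \<pi> i) * t)))"
    by (simp only: prod_add[OF finite] sum_distrib_left Compl_eq_Diff_UNIV Pow_UNIV)
  also have "\<dots> = (\<Sum>S\<in>UNIV. \<Sum>\<pi> | \<pi> permutes UNIV. of_int (sign \<pi>) *
      ((\<Prod>i\<in>S. - A $ i $ \<pi> i) * (\<Prod>i\<in>-S. of_bool (i = \<pi> i) * t)))"
    by (rule sum.swap)
  also have "\<dots> = (\<Sum>S\<in>UNIV. (-1) ^ card S * t ^ (CARD('n) - card S) *
     (\<Sum>\<pi> | \<pi> permutes S. of_int (sign \<pi>) * (\<Prod>i\<in>S. A $ i $ \<pi> i)))"
  proof (intro sum.cong refl)
    fix S :: "'n set"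
    have "(\<Sum>\<pi> | \<pi> permutes UNIV. of_int (sign \<pi>) *
      ((\<Prod>i\<in>S. - A $ i $ \<pi> i) * (\<Prod>i\<in>-S. of_bool (i = \<pi> i) * t)))
      = (\<Sum>\<pi> | \<pi> permutes S. of_int (sign \<pi>) *
      ((\<Prod>i\<in>S. - A $ i $ \<pi> i) * (\<Prod>i\<in>-S. of_bool (i = \<pi> i) * t)))"
    proof (rule sum.mono_neutral_right)
      show "{\<pi>. \<pi> permutes S} \<subseteq> {\<pi>. \<pi> permutes UNIV}"
        using permutes_subset by blast
      show "\<forall>\<pi>\<in>{\<pi>. \<pi> permutes UNIV} - {\<pi>. \<pi> permutes S}. of_int (sign \<pi>) *
          ((\<Prod>i\<in>S. - A $ i $ \<pi> i) * (\<Prod>i\<in>-S. of_bool (i = \<pi> i) * t)) = 0"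
      proof
        fix \<pi> assume "\<pi> \<in> {\<pi>. \<pi> permutes UNIV} - {\<pi>. \<pi> permutes S}"
        then obtain i where "i \<notin> S" "\<pi> i \<noteq> i"
          by (auto simp: permutes_def)
        then have "(\<Prod>i\<in>-S. of_bool (i = \<pi> i) * t) = 0"
          by (intro prod_zero) (auto intro!: bexI[of _ i])
        then show "of_int (sign \<pi>) *
          ((\<Prod>i\<in>S. - A $ i $ \<pi> i) * (\<Prod>i\<in>-S. of_bool (i = \<pi> i) * t)) = 0" by simp
      qed
    qed simp
    also have "\<dots> = (\<Sum>\<pi> | \<pi> permutes S. (-1) ^ card S * t ^ (CARD('n) - card S) *
      (of_int (sign \<pi>) * (\<Prod>i\<in>S. A $ i $ \<pi> i)))"
    proof (intro sum.cong refl)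
      fix \<pi> assume "\<pi> \<in> {\<pi>. \<pi> permutes S}"
      then have "(\<Prod>i\<in>-S. of_bool (i = \<pi> i) * t) = (\<Prod>i\<in>-S. t)"
        by (intro prod.cong refl) (simp add: permutes_not_in)
      also have "\<dots> = t ^ (CARD('n) - card S)"
        by (simp add: Compl_eq_Diff_UNIV card_Diff_subset)
      finally show "of_int (sign \<pi>) *
          ((\<Prod>i\<in>S. - A $ i $ \<pi> i) * (\<Prod>i\<in>-S. of_bool (i = \<pi> i) * t)) =
         (-1) ^ card S * t ^ (CARD('n) - card S) * (of_int (sign \<pi>) * (\<Prod>i\<in>S. A $ i $ \<pi> i))"
        using prod_uminus[of "\<lambda>i. A $ i $ \<pi> i" S] by (simp add: mult_ac)
    qed
    finally show "(\<Sum>\<pi> | \<pi> permutes UNIV. of_int (sign \<pi>) *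
      ((\<Prod>i\<in>S. - A $ i $ \<pi> i) * (\<Prod>i\<in>-S. of_bool (i = \<pi> i) * t))) =
      (-1) ^ card S * t ^ (CARD('n) - card S) *
     (\<Sum>\<pi> | \<pi> permutes S. of_int (sign \<pi>) * (\<Prod>i\<in>S. A $ i $ \<pi> i))"
      by (simp add: sum_distrib_left)
  qed
  finally show ?thesis .
qed

text \<open>The common shape of the two sides of \<open>eigenvalue_list\<close>: with principal
  minors as \<open>c\<close> it is the characteristic polynomial, with products of the \<kappa> over
  \<open>S\<close> it is the product of the linear factors.\<close>

definition subset_poly :: "('n::finite set \<Rightarrow> 'a::comm_ring_1) \<Rightarrow> 'a poly" where
  "subset_poly c = (\<Sum>S\<in>UNIV. monom ((-1) ^ card S * c S) (CARD('n) - card S))"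

lemma poly_subset_poly:
  "poly (subset_poly c) t = (\<Sum>S\<in>UNIV. (-1) ^ card S * t ^ (CARD('n) - card S) * c (S :: 'n::finite set))"
  by (simp add: subset_poly_def poly_sum poly_monom mult_ac)

lemma coeff_subset_poly:
  fixes c :: "'n::finite set \<Rightarrow> 'a::comm_ring_1"
  assumes "m \<le> CARD('n)"
  shows "coeff (subset_poly c) (CARD('n) - m) = (-1) ^ m * (\<Sum>S | card S = m. c S)"
proof -
  have "(CARD('n) - card S = CARD('n) - m) = (card S = m)" for S :: "'n set"
    using assms card_mono[of UNIV S] by auto
  then have "coeff (subset_poly c) (CARD('n) - m) = (\<Sum>S\<in>UNIV. if card S = m then (-1) ^ card S * c S else 0)"
    by (simp add: subset_poly_def coeff_sum)
  also have "\<dots> = (\<Sum>S | card S = m. (-1) ^ card S * c S)"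
    by (simp add: sum.If_cases)
  also have "\<dots> = (\<Sum>S | card S = m. (-1) ^ m * c S)" by (intro sum.cong) auto
  finally show ?thesis by (simp add: sum_distrib_left)
qed

lemma prod_char_expansion:
  fixes \<kappa> :: "'n::finite \<Rightarrow> 'a::comm_ring_1"
  shows "(\<Prod>i\<in>UNIV. t - \<kappa> i) = (\<Sum>S\<in>UNIV. (-1) ^ card S * t ^ (CARD('n) - card S) * (\<Prod>i\<in>S. \<kappa> i))"
proof -
  have "(\<Prod>i\<in>UNIV. t - \<kappa> i) = (\<Prod>i\<in>UNIV. - \<kappa> i + t)" by simp
  also have "\<dots> = (\<Sum>S\<in>UNIV. (\<Prod>i\<in>S. - \<kappa> i) * (\<Prod>i\<in>-S. t))"
    by (subst prod_add) (auto simp: Compl_eq_Diff_UNIV)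
  finally show ?thesis
    by (simp add: prod_uminus Compl_eq_Diff_UNIV card_Diff_subset mult_ac)
qed

text \<open>The two polynomials agree at every real number, hence in each coefficient, so the value
  does not depend on the eigenvalue list that is picked. For \<open>m\<close> above the dimension
  both sums are empty.\<close>

lemma sigma_sym_eq_principal_minors:
  fixes A :: "real^'n::finite^'n"
  assumes "\<exists>\<kappa>. eigenvalue_list A \<kappa>"
  shows "sigma_sym m A = (\<Sum>S | card S = m. principal_minor S A)"
proof -
  define \<kappa> where "\<kappa> = (SOME \<kappa>. eigenvalue_list A \<kappa>)"
  have "eigenvalue_list A \<kappa>" unfolding \<kappa>_def using assms by (rule someI_ex)
  then have "poly (subset_poly (\<lambda>S. principal_minor S A)) t = poly (subset_poly (\<lambda>S. \<Prod>i\<in>S. \<kappa> i)) t" for t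
    unfolding eigenvalue_list_def poly_subset_poly principal_minor_def perm_sum_def
      det_char_expansion[symmetric] prod_char_expansion[symmetric] by blast
  then have "subset_poly (\<lambda>S. principal_minor S A) = subset_poly (\<lambda>S. \<Prod>i\<in>S. \<kappa> i)"
    by (simp add: poly_eq_poly_eq_iff[symmetric] fun_eq_iff)
  then have *: "(\<Sum>S | card S = m. principal_minor S A) = (\<Sum>S | card S = m. \<Prod>i\<in>S. \<kappa> i)"
    if "m \<le> CARD('n)"
    using coeff_subset_poly[OF that, of "\<lambda>S. principal_minor S A"]
      coeff_subset_poly[OF that, of "\<lambda>S. \<Prod>i\<in>S. \<kappa> i"] by simp
  have "sigma_sym m A = (\<Sum>S | card S = m. \<Prod>i\<in>S. \<kappa> i)"
    unfolding sigma_sym_def \<kappa>_def Let_def by simp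
  moreover have "{S :: 'n set. card S = m} = {}" if "\<not> m \<le> CARD('n)"
    using that card_mono[of "UNIV :: 'n set"] by auto
  ultimately show ?thesis using * by (cases "m \<le> CARD('n)") auto
qed

text \<open>The assumption describes a complex eigenvector \<open>x + i y\<close> with eigenvalue
  \<open>a + i b\<close> by its real and imaginary parts and says that the eigenvalue is real. In
  this form it can be checked with a real inner product.\<close>

lemma char_poly_splits:
  fixes A :: "real^'n::finite^'n"
  assumes real: "\<And>x y :: real^'n. \<And>a b. A *v x = a *\<^sub>R x - b *\<^sub>R y \<Longrightarrow> A *v y = b *\<^sub>R x + a *\<^sub>R y \<Longrightarrow>
      x \<noteq> 0 \<or> y \<noteq> 0 \<Longrightarrow> b = 0"
  shows "\<exists>\<kappa>. eigenvalue_list A \<kappa>"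
proof -
  define B :: "complex^'n^'n" where "B = (\<chi> i j. of_real (A $ i $ j))"
  define p where "p = subset_poly (\<lambda>S. principal_minor S A)"
  define q where "q = subset_poly (\<lambda>S. complex_of_real (principal_minor S A))"
  have q: "poly q z = det (mat z - B)" for z
    unfolding q_def poly_subset_poly det_char_expansion
    by (simp add: B_def principal_minor_def perm_sum_def)
  have p: "poly p t = det (mat t - A)" for t
    unfolding p_def poly_subset_poly det_char_expansion
    by (simp add: principal_minor_def perm_sum_def)
  have qp: "poly q (of_real t) = of_real (poly p t)" for t
    unfolding p_def q_def poly_subset_poly by simp
  \<comment> \<open>The subset of size zero carries the leading coefficient, and its principal minor
    is 1. So \<open>q\<close> is monic of degree \<open>CARD('n)\<close> and has exactly as many
    roots as there are indices.\<close>
  have "coeff q (CARD('n) - 0) = (-1) ^ 0 * (\<Sum>S :: 'n set | card S = 0. complex_of_real (principal_minor S A))"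
    unfolding q_def by (intro coeff_subset_poly) simp
  also have "{S :: 'n set. card S = 0} = {{}}" by auto
  finally have top: "coeff q CARD('n) = 1" by (simp add: principal_minor_def perm_sum_def)
  have deg: "degree q = CARD('n)"
  proof (rule antisym)
    show "degree q \<le> CARD('n)"
      unfolding q_def subset_poly_def
      by (intro degree_sum_le) (auto intro: order.trans[OF degree_monom_le])
    show "CARD('n) \<le> degree q" using top by (intro le_degree) simp
  qed
  then have lead: "lead_coeff q = 1" using top by simp
  then have "q \<noteq> 0" by auto
  then obtain Z where Z: "size Z = degree q" "q = smult (lead_coeff q) (\<Prod>z\<in>#Z. [:-z, 1:])"
    using alg_closed_imp_factorization by blast
  have real_root: "Im z = 0" if "z \<in># Z" for z
  proof -
    have "poly q z = 0"
      using that by (subst Z(2)) (auto simp: poly_prod_mset prod_mset_zero_iff)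
    then have "det (mat z - B) = 0" by (simp add: q)
    then have "\<not> invertible (mat z - B)" by (simp add: invertible_det_nz)
    then obtain v where v: "(mat z - B) *v v = 0" "v \<noteq> 0"
      by (auto simp: invertible_left_inverse matrix_left_invertible_ker)
    have "mat z *v v = z *s v"
      by (simp add: vec_eq_iff matrix_vector_mult_def mat_def if_distrib[of "\<lambda>x. x * _"] cong: if_cong)
    then have "B *v v = z *s v"
      using v(1) by (simp add: matrix_vector_mult_diff_rdistrib)
    then have ev: "(\<Sum>j\<in>UNIV. of_real (A $ i $ j) * v $ j) = z * v $ i" for i
      by (simp add: vec_eq_iff matrix_vector_mult_def B_def)
    define x y where "x = (\<chi> i. Re (v $ i))" and "y = (\<chi> i. Im (v $ i))"
    have "A *v x = Re z *\<^sub>R x - Im z *\<^sub>R y"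
      using arg_cong[OF ev, of Re] by (simp add: vec_eq_iff matrix_vector_mult_def x_def y_def)
    moreover have "A *v y = Im z *\<^sub>R x + Re z *\<^sub>R y"
      using arg_cong[OF ev, of Im] by (simp add: vec_eq_iff matrix_vector_mult_def x_def y_def algebra_simps)
    moreover have "x \<noteq> 0 \<or> y \<noteq> 0"
      using v(2) by (auto simp: vec_eq_iff x_def y_def complex_eq_iff)
    ultimately show ?thesis by (rule real)
  qed
  obtain zs where zs: "mset zs = Z" using ex_mset by blast
  have "length zs = CARD('n)" using zs Z(1) deg by (metis size_mset)
  \<comment> \<open>The roots come as a list, while an eigenvalue list is indexed by the type of the
    matrix indices.\<close>
  then have "\<exists>h. bij_betw h (UNIV :: 'n set) {..<length zs}"
    by (intro finite_same_card_bij) simp_all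
  then obtain h :: "'n \<Rightarrow> nat" where h: "bij_betw h UNIV {..<length zs}" ..
  define \<kappa> where "\<kappa> i = Re (zs ! h i)" for i
  have \<kappa>_eq: "of_real (\<kappa> i) = zs ! h i" for i
  proof -
    have "h i < length zs" using h by (auto simp: bij_betw_def)
    then have "zs ! h i \<in># Z" using zs nth_mem_mset by blast
    then show ?thesis using real_root by (simp add: \<kappa>_def complex_eq_iff)
  qed
  then have \<kappa>: "of_real t - zs ! h i = of_real (t - \<kappa> i)" for i t
    by (simp only: of_real_diff \<kappa>_eq)
  have "poly p t = (\<Prod>i\<in>UNIV. t - \<kappa> i)" for t
  proof -
    have "of_real (poly p t) = poly q (of_real t)" by (simp add: qp)
    also have "\<dots> = (\<Prod>z\<in>#Z. of_real t - z)"
      by (subst Z(2)) (simp add: lead poly_prod_mset)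
    also have "\<dots> = prod_list (map (\<lambda>z. of_real t - z) zs)"
      by (simp add: zs[symmetric] prod_mset_prod_list[symmetric])
    also have "\<dots> = (\<Prod>j<length zs. of_real t - zs ! j)"
      by (simp add: prod.list_conv_set_nth atLeast0LessThan)
    also have "\<dots> = (\<Prod>i\<in>UNIV. of_real t - zs ! h i)"
      by (rule prod.reindex_bij_betw[OF h, symmetric])
    also have "\<dots> = of_real (\<Prod>i\<in>UNIV. t - \<kappa> i)" by (simp only: \<kappa> of_real_prod)
    finally show ?thesis by (simp only: of_real_eq_iff)
  qed
  then show ?thesis unfolding eigenvalue_list_def using p by metis
qed

section \<open>Consequences of the Gauss equation\<close>

text \<open>If some 2-minor is nonzero, its two rows span all rows, because the vanishing 3-minors
  express any third row through them. If all 2-minors vanish, all rows are multiples of a single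
  one, or all are zero.\<close>

lemma rank_le_2I:
  fixes A :: "real^'n::finite^'m::finite"
  assumes "\<And>a b c d e f. A $ a $ d * (A $ b $ e * A $ c $ f - A $ b $ f * A $ c $ e)
   - A $ a $ e * (A $ b $ d * A $ c $ f - A $ b $ f * A $ c $ d)
   + A $ a $ f * (A $ b $ d * A $ c $ e - A $ b $ e * A $ c $ d) = 0"
  shows "rank A \<le> 2"
proof -
  have "\<exists>u v. \<forall>r. \<exists>\<alpha> \<beta>. row r A = \<alpha> *\<^sub>R u + \<beta> *\<^sub>R v"
  proof (cases "\<exists>a b d e. A $ a $ d * A $ b $ e - A $ a $ e * A $ b $ d \<noteq> 0")
    case True
    then obtain a b d e where m: "A $ a $ d * A $ b $ e - A $ a $ e * A $ b $ d \<noteq> 0" by blast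
    define m where "m = A $ a $ d * A $ b $ e - A $ a $ e * A $ b $ d"
    \<comment> \<open>The coefficients come from Cramer's rule in the columns \<open>d\<close> and
      \<open>e\<close>; the vanishing of the 3-minor with a further column \<open>f\<close> says
      that they also fit there.\<close>
    have "row r A = ((A $ r $ d * A $ b $ e - A $ r $ e * A $ b $ d) / m) *\<^sub>R row a A
       + ((A $ r $ e * A $ a $ d - A $ r $ d * A $ a $ e) / m) *\<^sub>R row b A" for r
    proof -
      have "m * A $ r $ f = (A $ r $ d * A $ b $ e - A $ r $ e * A $ b $ d) * A $ a $ f
       + (A $ r $ e * A $ a $ d - A $ r $ d * A $ a $ e) * A $ b $ f" for f
        using assms[of r f a d b e] unfolding m_def by (simp add: algebra_simps)
      moreover have "m \<noteq> 0" using m by (simp add: m_def)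
      ultimately have 1: "A $ r $ f = ((A $ r $ d * A $ b $ e - A $ r $ e * A $ b $ d) * A $ a $ f
       + (A $ r $ e * A $ a $ d - A $ r $ d * A $ a $ e) * A $ b $ f) / m" for f
        by (simp add: nonzero_eq_divide_eq mult.commute)
      show ?thesis
        by (rule vec_eq_iff[THEN iffD2], rule allI)
          (subst row_def, subst vec_lambda_beta, subst 1, simp add: row_def add_divide_distrib)
    qed
    then show ?thesis by blast
  next
    case False
    then have z: "A $ a $ d * A $ b $ e = A $ a $ e * A $ b $ d" for a b d e by simp
    show ?thesis
    proof (cases "\<exists>a d. A $ a $ d \<noteq> 0")
      case True
      then obtain a d where "A $ a $ d \<noteq> 0" by blast
      then have 2: "A $ r $ f = A $ r $ d / A $ a $ d * A $ a $ f" for r f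
        unfolding times_divide_eq_left
        by (rule nonzero_eq_divide_eq[THEN iffD2]) (metis z mult.commute)
      have "row r A = (A $ r $ d / A $ a $ d) *\<^sub>R row a A + 0 *\<^sub>R 0" for r
        by (rule vec_eq_iff[THEN iffD2], rule allI)
          (subst row_def, subst vec_lambda_beta, subst 2, simp add: row_def)
      then show ?thesis by blast
    next
      case False
      then have "row r A = 0 *\<^sub>R 0 + 0 *\<^sub>R 0" for r by (simp add: vec_eq_iff row_def)
      then show ?thesis by blast
    qed
  qed
  then obtain u v where uv: "\<And>r. \<exists>\<alpha> \<beta>. row r A = \<alpha> *\<^sub>R u + \<beta> *\<^sub>R v" by blast
  have "rows A \<subseteq> span {u, v}"
  proof
    fix w assume "w \<in> rows A"
    then obtain r where "w = row r A" by (auto simp: rows_def)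
    then show "w \<in> span {u, v}"
      using uv[of r] by (auto intro!: span_add span_mul simp: span_base)
  qed
  then have "rank A \<le> card {u, v}"
    unfolding row_rank_def by (intro dim_le_card) auto
  also have "\<dots> \<le> 2" by (simp add: card_insert_if)
  finally show ?thesis .
qed

text \<open>A substitute for \<open>sigma_sym\<close> that is a polynomial in the entries of every
  matrix and agrees with it whenever all eigenvalues are real.\<close>

definition minor_sum :: "nat \<Rightarrow> real^'n^'n \<Rightarrow> real" where
  "minor_sum m (A :: real^'n::finite^'n) = (\<Sum>S | card S = m. principal_minor S A)"

lemma curvature_poly_minor_sum_entry:
  "k \<ge> 1 \<Longrightarrow> curvature_poly K (k + 1) (\<lambda>A. minor_sum (2 * k + 1) A * A $ i $ j)"
  unfolding minor_sum_def sum_distrib_right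
  by (intro curvature_poly_sum curvature_poly_principal_minor_entry) auto

lemma curvature_poly_minor_sum_mult:
  assumes "k + l \<ge> 1"
  shows "curvature_poly K (k + l + 1) (\<lambda>A. minor_sum (2 * k + 1) A * minor_sum (2 * l + 1) A)"
proof -
  have *: "curvature_poly K (k + l + 1) (\<lambda>A. minor_sum (2 * k + 1) A * minor_sum (2 * l + 1) A)"
    if "k \<ge> 1" for k l
    unfolding minor_sum_def sum_product
    using that by (intro curvature_poly_sum curvature_poly_principal_minor_mult) auto
  show ?thesis
  proof (cases "k \<ge> 1")
    case False
    then have "l \<ge> 1" using assms by simp
    from *[OF this, of k] show ?thesis by (simp only: add.commute mult.commute)
  qed (rule *)
qed

lemma minor_sum_1: "minor_sum 1 A = (\<Sum>i\<in>UNIV. A $ i $ i)"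
proof -
  have "{S :: 'a set. card S = 1} = (\<lambda>i. {i}) ` UNIV" by (auto simp: card_1_singleton_iff)
  moreover have "principal_minor {i} A = A $ i $ i" for i
  proof -
    have "{\<pi>. \<pi> permutes {i}} = {id}" by auto
    then show ?thesis by (simp add: principal_minor_def perm_sum_def)
  qed
  ultimately show ?thesis by (simp add: minor_sum_def sum.reindex)
qed

lemma curvature_poly_minor3_trace: "curvature_poly K 2 (\<lambda>A. minor3 A x y * minor_sum 1 A)"
  unfolding minor_sum_1 sum_distrib_left
  by (cases x, cases y) (auto intro!: curvature_poly_sum curvature_poly_minor3_entry)

lemma curvature_polyD:
  assumes "curvature_poly K d F"
  obtains f where "continuous_on UNIV f" "\<And>A. F A = f (gauss_tensor K A)"
  using assms continuous_on_poly_eval unfolding curvature_poly_def by blast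

text \<open>This isolates what the algebra takes from the geometry: the value of the Riemann tensor
  and the reality of the principal curvatures.\<close>

locale gauss_family =
  fixes \<H> :: "('n::finite, 'p, 'q) hypersurface set" and K :: real
  assumes gauss: "H \<in> \<H> \<Longrightarrow> p \<in> topspace (topo (base H)) \<Longrightarrow> (A, R) \<in> shape_riemann_at H p \<Longrightarrow>
      R = gauss_tensor K A \<and> (\<exists>\<kappa>. eigenvalue_list A \<kappa>)"
begin

lemma intrinsicI:
  assumes "open \<Omega>" "continuous_on \<Omega> \<phi>"
    and "\<And>A. \<exists>\<kappa>. eigenvalue_list A \<kappa> \<Longrightarrow> C A \<Longrightarrow> gauss_tensor K A \<in> \<Omega> \<and> Q A = \<phi> (gauss_tensor K A)"
  shows "intrinsic \<H> C Q"
  unfolding intrinsic_def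
  using assms gauss by (intro exI[of _ \<Omega>] exI[of _ \<phi>]) blast

text \<open>The functions \<open>N\<close> and \<open>D\<close> express
  \<open>s A *\<^sub>R Q A\<close> and \<open>(s A)\<^sup>2\<close>, neither of which requires a
  choice of sign in the applications. The given sign picks the root of \<open>D\<close>, and the
  restriction to \<open>D > 0\<close> keeps the domain open and the quotient continuous.\<close>

lemma intrinsic_mod_orientationI:
  fixes Q :: "real^'n^'n \<Rightarrow> 'b::real_normed_vector"
  assumes "open \<Omega>" "continuous_on \<Omega> N" "continuous_on \<Omega> D"
    and *: "\<And>A. \<exists>\<kappa>. eigenvalue_list A \<kappa> \<Longrightarrow> C A \<Longrightarrow> gauss_tensor K A \<in> \<Omega> \<and>
      (s A)\<^sup>2 = D (gauss_tensor K A) \<and> s A *\<^sub>R Q A = N (gauss_tensor K A)"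
  shows "intrinsic_mod_orientation \<H> C s Q"
  unfolding intrinsic_mod_orientation_def
proof
  fix \<epsilon> :: real assume \<epsilon>: "\<epsilon> \<in> {1, -1}"
  have "open (\<Omega> \<inter> D -` {0<..})"
    using assms by (intro continuous_open_preimage) auto
  moreover have "continuous_on (\<Omega> \<inter> D -` {0<..}) (\<lambda>R. (1 / (\<epsilon> * sqrt (D R))) *\<^sub>R N R)"
    using assms \<epsilon> by (auto intro!: continuous_intros intro: continuous_on_subset)
  ultimately show "intrinsic \<H> (\<lambda>A. C A \<and> sgn (s A) = \<epsilon>) Q"
  proof (rule intrinsicI)
    fix A assume A: "\<exists>\<kappa>. eigenvalue_list A \<kappa>" "C A \<and> sgn (s A) = \<epsilon>"
    have nz: "s A \<noteq> 0" using A \<epsilon> by auto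
    have eq: "\<epsilon> * sqrt ((s A)\<^sup>2) = s A" using A by (auto simp: sgn_mult_abs)
    have 1: "gauss_tensor K A \<in> \<Omega>" "D (gauss_tensor K A) = (s A)\<^sup>2" "N (gauss_tensor K A) = s A *\<^sub>R Q A"
      using *[of A] A by simp_all
    show "gauss_tensor K A \<in> \<Omega> \<inter> D -` {0<..} \<and>
        Q A = (1 / (\<epsilon> * sqrt (D (gauss_tensor K A)))) *\<^sub>R N (gauss_tensor K A)"
      unfolding 1(2,3) eq using 1(1,2) nz by simp
  qed
qed

lemma sigma_sym_minor_sum: "\<exists>\<kappa>. eigenvalue_list A \<kappa> \<Longrightarrow> sigma_sym m A = minor_sum m A"
  by (simp add: sigma_sym_eq_principal_minors minor_sum_def)

lemma curvature_poly_matrix: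
  fixes F :: "real^'n^'n \<Rightarrow> real^'n^'n"
  assumes "\<And>i j. curvature_poly K d (\<lambda>A. F A $ i $ j)"
  obtains f where "continuous_on UNIV f" "\<And>A. F A = f (gauss_tensor K A)"
proof -
  \<comment> \<open>Every entry comes with some continuous function of its own; choice turns them
    into one matrix-valued function.\<close>
  define f where "f i j = (SOME f. continuous_on UNIV f \<and> (\<forall>A. F A $ i $ j = f (gauss_tensor K A)))" for i j
  have "\<exists>f. continuous_on UNIV f \<and> (\<forall>A. F A $ i $ j = f (gauss_tensor K A))" for i j
    by (rule curvature_polyD[OF assms[of i j]]) blast
  from someI_ex[OF this] have f: "continuous_on UNIV (f i j)" "F A $ i $ j = f i j (gauss_tensor K A)" for i j A
    unfolding f_def by blast+
  show thesis
    by (rule that[of "\<lambda>R. \<chi> i j. f i j R"])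
      (auto intro!: continuous_on_vec_lambda f(1) simp: vec_eq_iff f(2))
qed

lemma intrinsic_sigma_mult:
  assumes "k + l \<ge> 1"
  shows "intrinsic \<H> (\<lambda>A. True) (\<lambda>A. sigma_sym (2*k+1) A * sigma_sym (2*l+1) A)"
    and "\<exists>P :: 'n tensor_poly. poly_degree P = k + l + 1 \<and>
           (\<forall>H\<in>\<H>. \<forall>p\<in>topspace (topo (base H)). \<forall>(A, R)\<in>shape_riemann_at H p.
              sigma_sym (2*k+1) A * sigma_sym (2*l+1) A = poly_eval P R)"
proof -
  obtain P :: "'n tensor_poly" where P: "poly_degree P = k + l + 1"
    "\<And>A. minor_sum (2*k+1) A * minor_sum (2*l+1) A = poly_eval P (gauss_tensor K A)"
    using curvature_poly_exact_degree[OF curvature_poly_minor_sum_mult[OF assms, of K]] by auto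
  show "intrinsic \<H> (\<lambda>A. True) (\<lambda>A. sigma_sym (2*k+1) A * sigma_sym (2*l+1) A)"
    by (rule intrinsicI[OF open_UNIV continuous_on_poly_eval[of _ P]])
      (simp add: sigma_sym_minor_sum P(2)[symmetric])
  have "sigma_sym (2*k+1) A * sigma_sym (2*l+1) A = poly_eval P R"
    if "H \<in> \<H>" "p \<in> topspace (topo (base H))" "(A, R) \<in> shape_riemann_at H p" for H p A R
    using gauss[OF that] by (simp add: sigma_sym_minor_sum P(2)[symmetric])
  then show "\<exists>P :: 'n tensor_poly. poly_degree P = k + l + 1 \<and>
           (\<forall>H\<in>\<H>. \<forall>p\<in>topspace (topo (base H)). \<forall>(A, R)\<in>shape_riemann_at H p.
              sigma_sym (2*k+1) A * sigma_sym (2*l+1) A = poly_eval P R)"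
    using P(1) by blast
qed

lemma intrinsic_mod_orientation_sigma:
  assumes "k \<ge> 1"
  shows "intrinsic_mod_orientation \<H> (\<lambda>A. sigma_sym (2*k+1) A \<noteq> 0)
           (sigma_sym (2*k+1)) (sigma_sym (2*l+1))"
    and "intrinsic_mod_orientation \<H> (\<lambda>A. sigma_sym (2*k+1) A \<noteq> 0) (sigma_sym (2*k+1)) (\<lambda>A. A)"
proof -
  \<comment> \<open>The case \<open>l = k\<close> of the product supplies the square that is needed
    as the denominator \<open>D\<close>.\<close>
  have kl: "k + l \<ge> 1" for l using assms by simp
  obtain D :: "'n tensor22 \<Rightarrow> real" where D: "continuous_on UNIV D"
    "\<And>A. minor_sum (2*k+1) A * minor_sum (2*k+1) A = D (gauss_tensor K A)"
    by (rule curvature_polyD[OF curvature_poly_minor_sum_mult[OF kl[of k], of K]]) blast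
  obtain N :: "'n tensor22 \<Rightarrow> real" where N: "continuous_on UNIV N"
    "\<And>A. minor_sum (2*k+1) A * minor_sum (2*l+1) A = N (gauss_tensor K A)"
    by (rule curvature_polyD[OF curvature_poly_minor_sum_mult[OF kl[of l], of K]]) blast
  show "intrinsic_mod_orientation \<H> (\<lambda>A. sigma_sym (2*k+1) A \<noteq> 0)
           (sigma_sym (2*k+1)) (sigma_sym (2*l+1))"
    by (rule intrinsic_mod_orientationI[OF open_UNIV N(1) D(1)])
      (simp add: sigma_sym_minor_sum D(2)[symmetric] N(2)[symmetric] power2_eq_square)
  obtain M :: "'n tensor22 \<Rightarrow> real^'n^'n" where M: "continuous_on UNIV M"
    "\<And>A. minor_sum (2*k+1) A *\<^sub>R A = M (gauss_tensor K A)"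
    by (rule curvature_poly_matrix[of "k + 1" "\<lambda>A. minor_sum (2*k+1) A *\<^sub>R A"])
      (use curvature_poly_minor_sum_entry[OF assms] in auto)
  show "intrinsic_mod_orientation \<H> (\<lambda>A. sigma_sym (2*k+1) A \<noteq> 0) (sigma_sym (2*k+1)) (\<lambda>A. A)"
    by (rule intrinsic_mod_orientationI[OF open_UNIV M(1) D(1)])
      (simp add: sigma_sym_minor_sum D(2)[symmetric] M(2)[symmetric] power2_eq_square)
qed

text \<open>No single 3-minor is nonzero at all points of rank at least three. Summing over all of
  them yields one quotient with denominator \<open>W\<close>, valid at every such point, hence a
  single continuous function on the open set where \<open>w\<close> is positive.\<close>

lemma intrinsic_mean_curvature:
  shows "intrinsic \<H> (\<lambda>A. rank A \<ge> 3) (\<lambda>A. (sigma_sym 1 A)\<^sup>2)"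
    and "intrinsic_mod_orientation \<H> (\<lambda>A. rank A \<ge> 3 \<and> sigma_sym 1 A \<noteq> 0) (sigma_sym 1) (\<lambda>A. A)"
proof -
  define W where "W A = (\<Sum>x\<in>UNIV. \<Sum>y\<in>UNIV. (minor3 A x y)\<^sup>2)" for A :: "real^'n^'n"
  define H where "H A = minor_sum 1 A" for A :: "real^'n^'n"
  have "curvature_poly K 3 W"
    unfolding W_def[abs_def] by (intro curvature_poly_sum curvature_poly_minor3_square)
  then obtain w where w: "continuous_on UNIV w" "\<And>A. W A = w (gauss_tensor K A)"
    by (rule curvature_polyD) blast
  have "curvature_poly K (2 + 2) (\<lambda>A. \<Sum>x\<in>UNIV. \<Sum>y\<in>UNIV. (minor3 A x y * H A) * (minor3 A x y * H A))"
    unfolding H_def by (intro curvature_poly_sum curvature_poly_mult curvature_poly_minor3_trace)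
  moreover have "(\<Sum>x\<in>UNIV. \<Sum>y\<in>UNIV. (minor3 A x y * H A) * (minor3 A x y * H A)) = (H A)\<^sup>2 * W A" for A
    by (simp add: W_def sum_distrib_left power2_eq_square mult_ac)
  ultimately obtain h where h: "continuous_on UNIV h" "\<And>A. (H A)\<^sup>2 * W A = h (gauss_tensor K A)"
    by (auto elim!: curvature_polyD)
  have M1: "curvature_poly K (2 + 2) (\<lambda>A. \<Sum>x\<in>UNIV. \<Sum>y\<in>UNIV. (minor3 A x y * H A) * (minor3 A x y * A $ i $ j))"
    for i j
  proof -
    have "curvature_poly K 2 (\<lambda>A. minor3 A x y * A $ i $ j)" for x y
      by (cases x, cases y) (auto intro: curvature_poly_minor3_entry)
    then show ?thesis
      unfolding H_def by (intro curvature_poly_sum curvature_poly_mult curvature_poly_minor3_trace)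
  qed
  have M2: "(\<Sum>x\<in>UNIV. \<Sum>y\<in>UNIV. (minor3 A x y * H A) * (minor3 A x y * A $ i $ j)) =
      ((H A * W A) *\<^sub>R A) $ i $ j" for A i j
    by (simp add: W_def sum_distrib_left sum_distrib_right power2_eq_square mult_ac)
  have "curvature_poly K (2 + 2) (\<lambda>A. ((H A * W A) *\<^sub>R A) $ i $ j)" for i j
    using M1[of i j] unfolding M2 .
  then obtain M where M: "continuous_on UNIV M" "\<And>A. (H A * W A) *\<^sub>R A = M (gauss_tensor K A)"
    by (rule curvature_poly_matrix) blast
  have pos: "W A > 0" if "rank A \<ge> 3" for A :: "real^'n^'n"
  proof -
    have "\<not> rank A \<le> 2" using that by simp
    then obtain a b c d e f where "minor3 A (a, b, c) (d, e, f) \<noteq> 0"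
      using rank_le_2I[of A] by (force simp: minor3_def)
    then obtain x y where "minor3 A x y \<noteq> 0" by blast
    then have "0 < (\<Sum>z\<in>UNIV. (minor3 A x z)\<^sup>2)"
      by (intro sum_pos2[of _ y]) auto
    also have "\<dots> \<le> W A"
      unfolding W_def
      by (rule member_le_sum[of x _ "\<lambda>x. \<Sum>z\<in>UNIV. (minor3 A x z)\<^sup>2"]) (auto intro!: sum_nonneg)
    finally show ?thesis .
  qed
  let ?\<Omega> = "w -` {0<..}"
  have open_\<Omega>: "open ?\<Omega>" using w(1) by (intro open_vimage) auto
  have cont: "continuous_on ?\<Omega> (\<lambda>R. h R / w R)" "continuous_on ?\<Omega> (\<lambda>R. (1 / w R) *\<^sub>R M R)"
    using w(1) h(1) M(1) by (auto intro!: continuous_intros intro: continuous_on_subset)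
  have sq: "(H A)\<^sup>2 = h (gauss_tensor K A) / w (gauss_tensor K A)" if "rank A \<ge> 3" for A :: "real^'n^'n"
    using pos[OF that] by (simp add: h(2)[symmetric] w(2)[symmetric])
  have H: "sigma_sym 1 A = H A" if "\<exists>\<kappa>. eigenvalue_list A \<kappa>" for A :: "real^'n^'n"
    using sigma_sym_minor_sum[OF that, of 1] by (simp add: H_def)
  have \<Omega>: "gauss_tensor K A \<in> ?\<Omega>" if "rank A \<ge> 3" for A :: "real^'n^'n"
    using pos[OF that] by (simp add: w(2))
  show "intrinsic \<H> (\<lambda>A. rank A \<ge> 3) (\<lambda>A. (sigma_sym 1 A)\<^sup>2)"
    by (rule intrinsicI[OF open_\<Omega> cont(1)]) (use sq \<Omega> H in auto)
  show "intrinsic_mod_orientation \<H> (\<lambda>A. rank A \<ge> 3 \<and> sigma_sym 1 A \<noteq> 0) (sigma_sym 1) (\<lambda>A. A)"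
  proof (rule intrinsic_mod_orientationI[OF open_\<Omega> cont(2,1)])
    fix A :: "real^'n^'n" assume A: "\<exists>\<kappa>. eigenvalue_list A \<kappa>" "rank A \<ge> 3 \<and> sigma_sym 1 A \<noteq> 0"
    have "sigma_sym 1 A *\<^sub>R A = (1 / w (gauss_tensor K A)) *\<^sub>R M (gauss_tensor K A)"
      using pos[of A] A unfolding H[OF A(1)] by (simp add: M(2)[symmetric] w(2)[symmetric])
    then show "gauss_tensor K A \<in> ?\<Omega> \<and>
      (sigma_sym 1 A)\<^sup>2 = h (gauss_tensor K A) / w (gauss_tensor K A) \<and>
      sigma_sym 1 A *\<^sub>R A = (1 / w (gauss_tensor K A)) *\<^sub>R M (gauss_tensor K A)"
      using sq[of A] \<Omega>[of A] A unfolding H[OF A(1)] by simp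
  qed
qed

end

section \<open>Second derivatives\<close>

lemma frechet_derivative_eqI: "(f has_derivative f') (at x) \<Longrightarrow> frechet_derivative f (at x) = f'"
  using frechet_derivative_at by metis

lemma has_derivative_frechet: "f differentiable (at x) \<Longrightarrow> (f has_derivative frechet_derivative f (at x)) (at x)"
  by (simp add: frechet_derivative_works)

text \<open>Near \<open>x\<close> the factor \<open>h\<close> is bounded by a multiple of the
  distance to \<open>x\<close>, so its product with \<open>f - f x\<close> is of smaller order, and
  \<open>h * f\<close> differs from \<open>h * f x\<close> only by this product. Continuity of
  \<open>f\<close> thus suffices for a product rule at a zero of \<open>h\<close>.\<close>

lemma has_derivative_mult_vanishing:
  fixes h f :: "'a::real_normed_vector \<Rightarrow> real"
  assumes h: "(h has_derivative h') (at x)" and h0: "h x = 0" and f: "isCont f x"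
  shows "((\<lambda>y. h y * f y) has_derivative (\<lambda>d. h' d * f x)) (at x)"
proof -
  have bl: "bounded_linear h'" using h by (rule has_derivative_bounded_linear)
  obtain B where B: "B > 0" "\<And>d. norm (h' d) \<le> norm d * B"
    using bounded_linear.pos_bounded[OF bl] by blast
  have "((\<lambda>y. h y * (f y - f x)) has_derivative (\<lambda>d. 0)) (at x)"
    unfolding has_derivative_at_alt
  proof (intro conjI allI impI)
    fix e :: real assume e: "e > 0"
    obtain d1 where d1: "d1 > 0" "\<And>y. norm (y - x) < d1 \<Longrightarrow> norm (h y - h x - h' (y - x)) \<le> 1 * norm (y - x)"
      using h unfolding has_derivative_at_alt by (meson zero_less_one)
    \<comment> \<open>\<open>B + 1\<close> is the constant in the bound of \<open>h\<close> by the
      distance to \<open>x\<close>: \<open>B\<close> from the derivative and 1 from the error term,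
      taken with tolerance 1.\<close>
    have "e / (B + 1) > 0" using e B by simp
    then obtain d2 where d2: "d2 > 0" "\<And>y. norm (y - x) < d2 \<Longrightarrow> norm (f y - f x) < e / (B + 1)"
      using f unfolding isCont_def LIM_def by (metis dist_norm dist_self norm_zero right_minus_eq)
    show "\<exists>d>0. \<forall>y. norm (y - x) < d \<longrightarrow>
        norm (h y * (f y - f x) - h x * (f x - f x) - 0) \<le> e * norm (y - x)"
    proof (intro exI[of _ "min d1 d2"] conjI allI impI)
      fix y assume y: "norm (y - x) < min d1 d2"
      have "norm (h y) \<le> norm (h' (y - x)) + norm (h y - h x - h' (y - x))"
        using norm_triangle_ineq[of "h' (y - x)" "h y - h x - h' (y - x)"] by (simp add: h0)
      also have "\<dots> \<le> (B + 1) * norm (y - x)"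
        using B(2)[of "y - x"] d1(2)[of y] y by (simp add: algebra_simps)
      finally have "norm (h y) * norm (f y - f x) \<le> ((B + 1) * norm (y - x)) * (e / (B + 1))"
        using d2(2)[of y] y by (intro mult_mono) auto
      also have "\<dots> = e * norm (y - x)" using B(1) by (simp add: field_simps)
      finally show "norm (h y * (f y - f x) - h x * (f x - f x) - 0) \<le> e * norm (y - x)"
        by (simp add: h0 abs_mult)
    qed (use d1 d2 in auto)
  qed simp
  moreover have "((\<lambda>y. h y * f x) has_derivative (\<lambda>d. h' d * f x)) (at x)"
    by (intro has_derivative_mult_left h)
  ultimately have "((\<lambda>y. h y * (f y - f x) + h y * f x) has_derivative (\<lambda>d. 0 + h' d * f x)) (at x)"
    by (rule has_derivative_add)
  then show ?thesis by (simp add: algebra_simps)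
qed

lemma linear_basis_expansion:
  fixes L :: "'a::euclidean_space \<Rightarrow> real"
  assumes "linear L"
  shows "L y = (\<Sum>b\<in>Basis. (y \<bullet> b) * L b)"
proof -
  have "L y = L (\<Sum>b\<in>Basis. (y \<bullet> b) *\<^sub>R b)" by (simp add: euclidean_representation)
  also have "\<dots> = (\<Sum>b\<in>Basis. (y \<bullet> b) * L b)"
    using assms by (simp add: linear_sum linear_cmul)
  finally show ?thesis .
qed

text \<open>The product rule for a family of linear forms evaluated at a moving vector. Expansion in
  a basis reduces it to products of real functions.\<close>

lemma has_derivative_linear_family:
  fixes F :: "'c::real_normed_vector \<Rightarrow> 'a::euclidean_space \<Rightarrow> real"
  assumes U: "open U" "x0 \<in> U" and lin: "\<And>x. x \<in> U \<Longrightarrow> linear (F x)"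
    and F: "\<And>v. ((\<lambda>x. F x v) has_derivative F' v) (at x0)"
    and Y: "(Y has_derivative Y') (at x0)"
  shows "((\<lambda>x. F x (Y x)) has_derivative (\<lambda>d. F' (Y x0) d + F x0 (Y' d))) (at x0)"
proof -
  have "((\<lambda>x. \<Sum>b\<in>Basis. (Y x \<bullet> b) * F x b) has_derivative
      (\<lambda>d. \<Sum>b\<in>Basis. (Y x0 \<bullet> b) * F' b d + (Y' d \<bullet> b) * F x0 b)) (at x0)"
    by (intro has_derivative_sum has_derivative_mult F has_derivative_inner_left Y)
  \<comment> \<open>The derivatives \<open>F' v\<close> are given separately for each
    \<open>v\<close>; uniqueness of derivatives shows that they depend linearly on
    \<open>v\<close>.\<close>
  moreover have "F' (Y x0) = (\<lambda>d. \<Sum>b\<in>Basis. (Y x0 \<bullet> b) * F' b d)"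
  proof (rule has_derivative_unique[OF F])
    have "((\<lambda>x. \<Sum>b\<in>Basis. (Y x0 \<bullet> b) * F x b) has_derivative
        (\<lambda>d. \<Sum>b\<in>Basis. (Y x0 \<bullet> b) * F' b d)) (at x0)"
      by (intro has_derivative_sum has_derivative_mult_right F)
    then show "((\<lambda>x. F x (Y x0)) has_derivative (\<lambda>d. \<Sum>b\<in>Basis. (Y x0 \<bullet> b) * F' b d)) (at x0)"
      by (rule has_derivative_transform_within_open[OF _ U]) (metis linear_basis_expansion lin)
  qed
  moreover have "F x0 (Y' d) = (\<Sum>b\<in>Basis. (Y' d \<bullet> b) * F x0 b)" for d
    using linear_basis_expansion[OF lin[OF U(2)]] .
  ultimately have "((\<lambda>x. \<Sum>b\<in>Basis. (Y x \<bullet> b) * F x b) has_derivative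
      (\<lambda>d. F' (Y x0) d + F x0 (Y' d))) (at x0)"
    by (simp add: sum.distrib)
  then show ?thesis
    by (rule has_derivative_transform_within_open[OF _ U]) (metis linear_basis_expansion lin)
qed

section \<open>Symmetry of second derivatives\<close>

lemma second_difference:
  fixes f :: "'a::real_normed_vector \<Rightarrow> real"
  assumes f: "\<And>y. y \<in> U \<Longrightarrow> f differentiable (at y)"
    and fv: "\<And>y. y \<in> U \<Longrightarrow> (\<lambda>y. frechet_derivative f (at y) v) differentiable (at y)"
    and h: "h > 0" and U: "\<And>s t. 0 \<le> s \<Longrightarrow> s \<le> h \<Longrightarrow> 0 \<le> t \<Longrightarrow> t \<le> h \<Longrightarrow> x + s *\<^sub>R v + t *\<^sub>R w \<in> U"
  shows "\<exists>s t. 0 \<le> s \<and> s \<le> h \<and> 0 \<le> t \<and> t \<le> h \<and>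
    f (x + h *\<^sub>R v + h *\<^sub>R w) - f (x + h *\<^sub>R v) - (f (x + h *\<^sub>R w) - f x) =
    h * h * frechet_derivative (\<lambda>y. frechet_derivative f (at y) v) (at (x + s *\<^sub>R v + t *\<^sub>R w)) w"
proof -
  define Df where "Df y = frechet_derivative f (at y) v" for y
  have DERIV_line: "((\<lambda>s. g (z + s *\<^sub>R u)) has_real_derivative frechet_derivative g (at (z + s *\<^sub>R u)) u) (at s)"
    if "g differentiable (at (z + s *\<^sub>R u))" for g :: "'a \<Rightarrow> real" and z u s
  proof -
    have "((\<lambda>s. z + s *\<^sub>R u) has_derivative (\<lambda>d. 0 + d *\<^sub>R u)) (at s)"
      by (intro derivative_intros)
    then have "((\<lambda>s. g (z + s *\<^sub>R u)) has_derivative (\<lambda>d. frechet_derivative g (at (z + s *\<^sub>R u)) (d *\<^sub>R u))) (at s)"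
      using has_derivative_compose[where f = "\<lambda>s. z + s *\<^sub>R u" and g = g, OF _ has_derivative_frechet[OF that]]
      by simp
    moreover have "frechet_derivative g (at (z + s *\<^sub>R u)) (d *\<^sub>R u) = frechet_derivative g (at (z + s *\<^sub>R u)) u * d" for d
      using linear_cmul[OF linear_frechet_derivative[OF that]] by simp
    ultimately show ?thesis by (simp add: has_field_derivative_def)
  qed
  have 1: "((\<lambda>s. f (x + s *\<^sub>R v + t *\<^sub>R w)) has_real_derivative Df (x + s *\<^sub>R v + t *\<^sub>R w)) (at s)"
    if "0 \<le> s" "s \<le> h" "0 \<le> t" "t \<le> h" for s t
    using DERIV_line[of f "x + t *\<^sub>R w" s v] f[OF U[OF that]] by (simp add: Df_def add_ac)
  \<comment> \<open>The mean value theorem is applied in direction \<open>v\<close> to the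
    difference of \<open>f\<close> on two opposite edges of the parallelogram; a second application,
    in direction \<open>w\<close>, follows.\<close>
  have "\<exists>s>0. s < h \<and> (f (x + h *\<^sub>R v + h *\<^sub>R w) - f (x + h *\<^sub>R v + 0 *\<^sub>R w)) - (f (x + 0 *\<^sub>R v + h *\<^sub>R w) - f (x + 0 *\<^sub>R v + 0 *\<^sub>R w))
      = (h - 0) * (Df (x + s *\<^sub>R v + h *\<^sub>R w) - Df (x + s *\<^sub>R v + 0 *\<^sub>R w))"
    using h by (intro MVT2 DERIV_diff 1) auto
  then obtain s where s: "0 < s" "s < h"
    "f (x + h *\<^sub>R v + h *\<^sub>R w) - f (x + h *\<^sub>R v) - (f (x + h *\<^sub>R w) - f x)
      = h * (Df (x + s *\<^sub>R v + h *\<^sub>R w) - Df (x + s *\<^sub>R v))"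
    by auto
  have "((\<lambda>t. Df (x + s *\<^sub>R v + t *\<^sub>R w)) has_real_derivative
      frechet_derivative Df (at (x + s *\<^sub>R v + t *\<^sub>R w)) w) (at t)"
    if "0 \<le> t" "t \<le> h" for t
    using fv[OF U[of s t]] that s by (intro DERIV_line) (auto simp: Df_def)
  then have "\<exists>t>0. t < h \<and> Df (x + s *\<^sub>R v + h *\<^sub>R w) - Df (x + s *\<^sub>R v + 0 *\<^sub>R w)
      = (h - 0) * frechet_derivative Df (at (x + s *\<^sub>R v + t *\<^sub>R w)) w"
    using h by (intro MVT2) auto
  then obtain t where "0 < t" "t < h" "Df (x + s *\<^sub>R v + h *\<^sub>R w) - Df (x + s *\<^sub>R v)
      = h * frechet_derivative Df (at (x + s *\<^sub>R v + t *\<^sub>R w)) w"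
    by auto
  with s show ?thesis
    by (intro exI[of _ s] exI[of _ t]) (simp add: Df_def[abs_def])
qed

text \<open>The second difference over a parallelogram is symmetric in \<open>v\<close> and
  \<open>w\<close>. It equals \<open>h * h\<close> times either mixed derivative at some point of
  the parallelogram, and by continuity these values approach those at \<open>x\<close>.\<close>

lemma symmetric_second_derivative_real:
  fixes f :: "'a::real_normed_vector \<Rightarrow> real"
  assumes "open U" "x \<in> U"
    and f: "\<And>y. y \<in> U \<Longrightarrow> f differentiable (at y)"
    and D: "\<And>y v. y \<in> U \<Longrightarrow> (\<lambda>y. frechet_derivative f (at y) v) differentiable (at y)"
    and cont: "\<And>v w. isCont (\<lambda>y. frechet_derivative (\<lambda>y. frechet_derivative f (at y) v) (at y) w) x"
  shows "frechet_derivative (\<lambda>y. frechet_derivative f (at y) v) (at x) w =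
    frechet_derivative (\<lambda>y. frechet_derivative f (at y) w) (at x) v"
proof -
  let ?D = "\<lambda>v w y. frechet_derivative (\<lambda>y. frechet_derivative f (at y) v) (at y) w"
  have "\<bar>?D v w x - ?D w v x\<bar> \<le> e" if e: "e > 0" for e
  proof -
    obtain d1 where d1: "d1 > 0" "\<And>y. dist y x < d1 \<Longrightarrow> dist (?D v w y) (?D v w x) < e / 2"
      using cont[of v w] e unfolding continuous_at_eps_delta by (meson half_gt_zero)
    obtain d2 where d2: "d2 > 0" "\<And>y. dist y x < d2 \<Longrightarrow> dist (?D w v y) (?D w v x) < e / 2"
      using cont[of w v] e unfolding continuous_at_eps_delta by (meson half_gt_zero)
    obtain d3 where d3: "d3 > 0" "ball x d3 \<subseteq> U"
      using \<open>open U\<close> \<open>x \<in> U\<close> open_contains_ball by blast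
    define d where "d = min d1 (min d2 d3)"
    have d: "d > 0" "d \<le> d1" "d \<le> d2" "d \<le> d3" using d1 d2 d3 by (auto simp: d_def)
    define N where "N = norm v + norm w + 1"
    have nv: "N > 0" by (simp add: N_def add_nonneg_pos)
    \<comment> \<open>With this step the parallelogram stays within distance \<open>d / 2\<close> of
      \<open>x\<close>; the summand 1 in \<open>N\<close> guards against
      \<open>v = w = 0\<close>.\<close>
    define h where "h = d / (2 * N)"
    have h: "h > 0" using d nv by (simp add: h_def)
    have near: "dist (x + s *\<^sub>R v + t *\<^sub>R w) x < d" if "0 \<le> s" "s \<le> h" "0 \<le> t" "t \<le> h" for s t
    proof -
      have "dist (x + s *\<^sub>R v + t *\<^sub>R w) x \<le> s * norm v + t * norm w"
        using norm_triangle_ineq[of "s *\<^sub>R v" "t *\<^sub>R w"] that by (simp add: dist_norm)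
      also have "\<dots> \<le> h * norm v + h * norm w"
        using that by (intro add_mono mult_right_mono) auto
      also have "\<dots> < h * N" using h by (simp add: N_def algebra_simps)
      also have "\<dots> = d / 2" using nv by (simp add: h_def)
      also have "\<dots> < d" using d by simp
      finally show ?thesis .
    qed
    have near': "dist (x + s *\<^sub>R w + t *\<^sub>R v) x < d" if "0 \<le> s" "s \<le> h" "0 \<le> t" "t \<le> h" for s t
      using near[OF that(3,4,1,2)] by (simp add: add_ac)
    have inU: "y \<in> U" if "dist y x < d" for y
      using that d d3 by (auto simp: dist_commute subset_iff)
    obtain s t where st: "0 \<le> s" "s \<le> h" "0 \<le> t" "t \<le> h"
      "f (x + h *\<^sub>R v + h *\<^sub>R w) - f (x + h *\<^sub>R v) - (f (x + h *\<^sub>R w) - f x) =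
        h * h * ?D v w (x + s *\<^sub>R v + t *\<^sub>R w)"
      using second_difference[of U f v h x w] f D h inU near by blast
    obtain s' t' where st': "0 \<le> s'" "s' \<le> h" "0 \<le> t'" "t' \<le> h"
      "f (x + h *\<^sub>R w + h *\<^sub>R v) - f (x + h *\<^sub>R w) - (f (x + h *\<^sub>R v) - f x) =
        h * h * ?D w v (x + s' *\<^sub>R w + t' *\<^sub>R v)"
      using second_difference[of U f w h x v] f D h inU near' by blast
    have comm: "x + h *\<^sub>R w + h *\<^sub>R v = x + h *\<^sub>R v + h *\<^sub>R w" by simp
    have "h * h * ?D v w (x + s *\<^sub>R v + t *\<^sub>R w) = h * h * ?D w v (x + s' *\<^sub>R w + t' *\<^sub>R v)"
      unfolding st(5)[symmetric] st'(5)[symmetric] comm by simp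
    then have "?D v w (x + s *\<^sub>R v + t *\<^sub>R w) = ?D w v (x + s' *\<^sub>R w + t' *\<^sub>R v)"
      using h by simp
    moreover have "dist (?D v w (x + s *\<^sub>R v + t *\<^sub>R w)) (?D v w x) < e / 2"
      using near[OF st(1-4)] d by (intro d1(2)) linarith
    moreover have "dist (?D w v (x + s' *\<^sub>R w + t' *\<^sub>R v)) (?D w v x) < e / 2"
      using near'[OF st'(1-4)] d by (intro d2(2)) linarith
    ultimately show ?thesis unfolding dist_real_def by linarith
  qed
  then have "\<bar>?D v w x - ?D w v x\<bar> \<le> 0" by (rule field_le_epsilon[of _ 0, simplified])
  then show ?thesis by simp
qed

lemma frechet_derivative_inner_left:
  assumes "f differentiable (at x)"
  shows "frechet_derivative (\<lambda>y. f y \<bullet> b) (at x) v = frechet_derivative f (at x) v \<bullet> b"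
  using has_derivative_inner_left[OF has_derivative_frechet[OF assms], of b]
  by (simp add: frechet_derivative_eqI)

lemma frechet_derivative_cong_open:
  assumes "open U" "x \<in> U" "\<And>y. y \<in> U \<Longrightarrow> f y = g y" 
  shows "frechet_derivative f (at x) = frechet_derivative g (at x)"
proof -
  have "(f has_derivative f') (at x) = (g has_derivative f') (at x)" for f'
    using has_derivative_transform_within_open[OF _ assms(1,2)] assms(3) by metis
  then show ?thesis unfolding frechet_derivative_def by simp
qed

lemma differentiable_inner_left:
  "f differentiable (at x) \<Longrightarrow> (\<lambda>y. f y \<bullet> b) differentiable (at x)"
  unfolding differentiable_def using has_derivative_inner_left by blast

lemma symmetric_second_derivative:
  fixes f :: "'a::real_normed_vector \<Rightarrow> 'b::euclidean_space"
  assumes U: "open U" "x \<in> U"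
    and f: "\<And>y. y \<in> U \<Longrightarrow> f differentiable (at y)"
    and D: "\<And>y v. y \<in> U \<Longrightarrow> (\<lambda>y. frechet_derivative f (at y) v) differentiable (at y)"
    and cont: "\<And>v w. isCont (\<lambda>y. frechet_derivative (\<lambda>y. frechet_derivative f (at y) v) (at y) w) x"
  shows "frechet_derivative (\<lambda>y. frechet_derivative f (at y) v) (at x) w =
    frechet_derivative (\<lambda>y. frechet_derivative f (at y) w) (at x) v"
proof (rule euclidean_eqI)
  fix b :: 'b
  let ?f = "\<lambda>y. f y \<bullet> b"
  have 1: "frechet_derivative ?f (at y) v = frechet_derivative f (at y) v \<bullet> b" if "y \<in> U" for y v
    using frechet_derivative_inner_left f that by blast
  have d1: "(\<lambda>y. frechet_derivative ?f (at y) v) differentiable (at y)" if "y \<in> U" for y v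
    using has_derivative_transform_within_open[OF
        has_derivative_frechet[OF differentiable_inner_left[OF D[OF that, of v], of b]] U(1) that] 1
    unfolding differentiable_def by metis
  have 2: "frechet_derivative (\<lambda>y. frechet_derivative ?f (at y) v) (at y) w =
      frechet_derivative (\<lambda>y. frechet_derivative f (at y) v) (at y) w \<bullet> b" if "y \<in> U" for y v w
    using frechet_derivative_cong_open[OF U(1) that, of "\<lambda>y. frechet_derivative ?f (at y) v"
        "\<lambda>y. frechet_derivative f (at y) v \<bullet> b"] 1 frechet_derivative_inner_left[OF D[OF that]]
    by simp
  have 3: "isCont (\<lambda>y. frechet_derivative (\<lambda>y. frechet_derivative ?f (at y) v) (at y) w) x" for v w
  proof -
    have "isCont (\<lambda>y. frechet_derivative (\<lambda>y. frechet_derivative f (at y) v) (at y) w \<bullet> b) x"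
      using cont by (intro continuous_intros)
    moreover have "\<forall>\<^sub>F y in nhds x. frechet_derivative (\<lambda>y. frechet_derivative ?f (at y) v) (at y) w =
        frechet_derivative (\<lambda>y. frechet_derivative f (at y) v) (at y) w \<bullet> b"
      using eventually_nhds_in_open[OF U] by eventually_elim (rule 2)
    ultimately show ?thesis using isCont_cong by fast
  qed
  have "frechet_derivative (\<lambda>y. frechet_derivative ?f (at y) v) (at x) w =
      frechet_derivative (\<lambda>y. frechet_derivative ?f (at y) w) (at x) v"
    using U differentiable_inner_left[OF f] d1 3 by (intro symmetric_second_derivative_real[of U]) auto
  then show "frechet_derivative (\<lambda>y. frechet_derivative f (at y) v) (at x) w \<bullet> b =
      frechet_derivative (\<lambda>y. frechet_derivative f (at y) w) (at x) v \<bullet> b"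
    by (simp add: 2[OF U(2)])
qed

section \<open>The Levi-Civita connection of a metric of low regularity\<close>

text \<open>The Christoffel symbols with lowered index. They are linear in each vector argument and
  do not involve the inverse of the metric.\<close>

definition koszul :: "'a::euclidean_space local_metric \<Rightarrow> 'a \<Rightarrow> 'a \<Rightarrow> 'a \<Rightarrow> 'a \<Rightarrow> real" where
  "koszul g x v w u =
     (frechet_derivative (\<lambda>x. g x w u) (at x) v
      + frechet_derivative (\<lambda>x. g x v u) (at x) w
      - frechet_derivative (\<lambda>x. g x v w) (at x) u) / 2"

lemma christoffel_koszul: "christoffel g x v w = (THE z. \<forall>u. g x z u = koszul g x v w u)"
  by (simp add: christoffel_def koszul_def)

text \<open>Mere differentiability of the coefficients is assumed, so that the induced metric of a
  \<open>C^2\<close> graph is an instance as well as the ambient metric.\<close>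

locale local_metric_on =
  fixes U :: "'a::euclidean_space set" and g :: "'a local_metric"
  assumes open_U: "open U"
    and bilinear: "x \<in> U \<Longrightarrow> bilinear (g x)"
    and sym: "x \<in> U \<Longrightarrow> g x v w = g x w v"
    and pos: "x \<in> U \<Longrightarrow> v \<noteq> 0 \<Longrightarrow> 0 < g x v v"
    and differentiable: "x \<in> U \<Longrightarrow> (\<lambda>x. g x v w) differentiable (at x)"
begin

lemma linear_left: "x \<in> U \<Longrightarrow> linear (\<lambda>v. g x v w)"
  and linear_right: "x \<in> U \<Longrightarrow> linear (g x v)"
  using bilinear unfolding bilinear_def by blast+

lemmas g_simps = linear_add[OF linear_left] linear_add[OF linear_right]
  linear_diff[OF linear_left] linear_diff[OF linear_right]
  linear_cmul[OF linear_left] linear_cmul[OF linear_right]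
  linear_0[OF linear_left] linear_0[OF linear_right]

lemma has_derivative_g:
  "x \<in> U \<Longrightarrow> ((\<lambda>x. g x v w) has_derivative frechet_derivative (\<lambda>x. g x v w) (at x)) (at x)"
  by (rule has_derivative_frechet[OF differentiable])

lemma dg_linear_dir: "x \<in> U \<Longrightarrow> linear (frechet_derivative (\<lambda>x. g x v w) (at x))"
  by (rule linear_frechet_derivative[OF differentiable])

lemma dg_sym:
  assumes "x \<in> U"
  shows "frechet_derivative (\<lambda>x. g x v w) (at x) = frechet_derivative (\<lambda>x. g x w v) (at x)"
  by (rule frechet_derivative_cong_open[OF open_U assms]) (rule sym)

lemma dg_linear_left:
  assumes x: "x \<in> U"
  shows "linear (\<lambda>v. frechet_derivative (\<lambda>x. g x v w) (at x) a)"
proof (rule linearI)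
  fix v v' c
  have "((\<lambda>x. g x (v + v') w) has_derivative
      (\<lambda>a. frechet_derivative (\<lambda>x. g x v w) (at x) a + frechet_derivative (\<lambda>x. g x v' w) (at x) a)) (at x)"
    by (rule has_derivative_transform_within_open[OF
          has_derivative_add[OF has_derivative_g[OF x] has_derivative_g[OF x]] open_U x])
      (simp add: g_simps)
  from frechet_derivative_eqI[OF this]
  show "frechet_derivative (\<lambda>x. g x (v + v') w) (at x) a =
      frechet_derivative (\<lambda>x. g x v w) (at x) a + frechet_derivative (\<lambda>x. g x v' w) (at x) a" by simp
  have "((\<lambda>x. g x (c *\<^sub>R v) w) has_derivative (\<lambda>a. c * frechet_derivative (\<lambda>x. g x v w) (at x) a)) (at x)"
    by (rule has_derivative_transform_within_open[OF
          has_derivative_mult_right[OF has_derivative_g[OF x]] open_U x])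
      (simp add: g_simps)
  from frechet_derivative_eqI[OF this]
  show "frechet_derivative (\<lambda>x. g x (c *\<^sub>R v) w) (at x) a =
      c *\<^sub>R frechet_derivative (\<lambda>x. g x v w) (at x) a" by simp
qed

lemma dg_linear_right:
  assumes x: "x \<in> U"
  shows "linear (\<lambda>w. frechet_derivative (\<lambda>x. g x v w) (at x) a)"
  using dg_linear_left[OF x, of v a] by (simp add: dg_sym[OF x, of _ v])

lemmas dg_simps = linear_add[OF dg_linear_left] linear_add[OF dg_linear_right] linear_add[OF dg_linear_dir]
  linear_cmul[OF dg_linear_left] linear_cmul[OF dg_linear_right] linear_cmul[OF dg_linear_dir]

lemma koszul_linear:
  assumes x: "x \<in> U"
  shows "linear (\<lambda>v. koszul g x v w u)" "linear (\<lambda>w. koszul g x v w u)" "linear (koszul g x v w)"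
  by (rule linearI; simp add: koszul_def dg_simps[OF x] field_simps)+

lemma koszul_sym: "x \<in> U \<Longrightarrow> koszul g x v w u = koszul g x w v u"
  by (simp add: koszul_def dg_sym[of x v w])

lemma metric_compatible:
  assumes "x \<in> U"
  shows "frechet_derivative (\<lambda>x. g x v w) (at x) a = koszul g x a v w + koszul g x a w v"
  using dg_sym[OF assms, of v w] by (simp add: koszul_def field_simps)

text \<open>Lowering an index is an injective linear map because the metric is definite, hence it is
  surjective in finite dimension.\<close>

lemma represent:
  assumes x: "x \<in> U" and L: "linear L"
  shows "\<exists>z. \<forall>u. g x z u = L u"
proof -
  define T where "T z = (\<Sum>b\<in>Basis. g x z b *\<^sub>R b)" for z
  have T: "T z \<bullet> u = g x z u" for z u
    using linear_basis_expansion[OF linear_right[OF x], of z u]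
    by (simp add: T_def inner_sum_left inner_commute[of u] mult.commute)
  have "linear T"
    by (rule linearI) (simp_all add: T_def g_simps[OF x] algebra_simps sum.distrib scaleR_sum_right)
  moreover have "inj T"
  proof (rule injI)
    fix y z assume "T y = T z"
    then have "g x (y - z) (y - z) = 0" using T[of y "y - z"] T[of z "y - z"] by (simp add: g_simps(3)[OF x])
    then show "y = z" using pos[OF x, of "y - z"] by force
  qed
  ultimately have "surj T" by (rule linear_inj_imp_surj)
  then obtain z where "T z = (\<Sum>b\<in>Basis. L b *\<^sub>R b)" by (metis surjD)
  then have "g x z u = L u" for u
    using T[of z u] linear_basis_expansion[OF L, of u] by (simp add: inner_sum_left inner_commute[of u] mult.commute)
  then show ?thesis by blast
qed

lemma eqI_metric:
  assumes x: "x \<in> U" and "\<And>u. g x y u = g x z u"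
  shows "y = z"
  using assms(2)[of "y - z"] pos[OF x, of "y - z"] g_simps(3)[OF x, of y z "y - z"] by force

lemma christoffel:
  assumes x: "x \<in> U"
  shows "g x (christoffel g x v w) u = koszul g x v w u"
proof -
  have "\<exists>!z. \<forall>u. g x z u = koszul g x v w u"
    using represent[OF x koszul_linear(3)[OF x]] eqI_metric[OF x] by (metis (no_types, lifting))
  from theI'[OF this] show ?thesis unfolding christoffel_koszul by blast
qed

text \<open>The constant is the minimum of the quadratic form on the compact unit sphere. The sphere
  is empty in the zero space, which is treated separately.\<close>

lemma coercive:
  assumes p: "p \<in> U"
  obtains m where "m > 0" "\<And>z. m * (norm z)\<^sup>2 \<le> g p z z"
proof (cases "(UNIV :: 'a set) = {0}")
  case True
  then have "z = 0" for z :: 'a by auto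
  then show thesis by (intro that[of 1]) (auto simp: g_simps[OF p])
next
  case False
  then obtain y :: 'a where "y \<noteq> 0" by auto
  have "g p z z = (\<Sum>b\<in>Basis. (z \<bullet> b) * g p b z)" for z
    by (rule linear_basis_expansion[OF linear_left[OF p]])
  moreover have "continuous_on S (\<lambda>z. g p b z)" for S b
    using linear_right[OF p] by (rule linear_continuous_on[OF linear_conv_bounded_linear[THEN iffD1]])
  ultimately have "continuous_on (sphere 0 1) (\<lambda>z. g p z z)"
    by (simp add: continuous_intros)
  moreover have "sphere 0 1 \<noteq> ({} :: 'a set)"
    using \<open>y \<noteq> 0\<close> by (auto simp: ex_in_conv[symmetric] intro!: exI[of _ "y /\<^sub>R norm y"])
  ultimately obtain s where s: "s \<in> sphere 0 1" "\<And>z. z \<in> sphere 0 1 \<Longrightarrow> g p s s \<le> g p z z"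
    using continuous_attains_inf[of "sphere 0 1" "\<lambda>z. g p z z"] compact_sphere by blast
  show thesis
  proof (rule that)
    show "g p s s > 0" using s(1) by (intro pos[OF p]) auto
    fix z :: 'a
    show "g p s s * (norm z)\<^sup>2 \<le> g p z z"
    proof (cases "z = 0")
      case False
      then have "g p s s \<le> g p (z /\<^sub>R norm z) (z /\<^sub>R norm z)" by (intro s(2)) auto
      also have "\<dots> = g p z z / (norm z)\<^sup>2" by (simp add: g_simps[OF p] field_simps power2_eq_square)
      finally show ?thesis using False by (simp add: field_simps)
    qed (simp add: g_simps[OF p])
  qed
qed

text \<open>The only source of differentiability at \<open>p\<close> is \<open>g\<close> and \<open>c\<close>; the solution \<open>z\<close> is first shown to be
  continuous at \<open>p\<close>, and then \<open>g p (z x) u = c x u - (g x - g p) (z x) u\<close> is differentiable because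
  \<open>g x - g p\<close> vanishes at \<open>p\<close>.\<close>

lemma solution_isCont:
  assumes p: "p \<in> U" and z: "\<And>x u. x \<in> U \<Longrightarrow> g x (z x) u = c x u"
    and c: "\<And>u. isCont (\<lambda>x. c x u) p"
  shows "isCont z p"
proof -
  obtain m where m: "m > 0" "\<And>z. m * (norm z)\<^sup>2 \<le> g p z z" using coercive[OF p] by blast
  define M where "M x = (\<Sum>b\<in>Basis. \<Sum>b'\<in>Basis. \<bar>g x b b' - g p b b'\<bar>)" for x
  define N where "N x = (\<Sum>b\<in>Basis. \<bar>c x b - c p b\<bar>)" for x
  have M: "\<bar>g x y w - g p y w\<bar> \<le> M x * norm y * norm w" if x: "x \<in> U" for x y w
  proof -
    have e: "g x y w = (\<Sum>b\<in>Basis. \<Sum>b'\<in>Basis. (y \<bullet> b) * ((w \<bullet> b') * g x b b'))" if "x \<in> U" for x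
      by (subst linear_basis_expansion[OF linear_left[OF that]],
          subst linear_basis_expansion[OF linear_right[OF that]]) (simp add: sum_distrib_left)
    have "\<bar>g x y w - g p y w\<bar> = \<bar>\<Sum>b\<in>Basis. \<Sum>b'\<in>Basis. (y \<bullet> b) * ((w \<bullet> b') * (g x b b' - g p b b'))\<bar>"
      unfolding e[OF x] e[OF p] by (simp add: sum_subtractf algebra_simps)
    also have "\<dots> \<le> (\<Sum>b\<in>Basis. \<Sum>b'\<in>Basis. \<bar>(y \<bullet> b) * ((w \<bullet> b') * (g x b b' - g p b b'))\<bar>)"
      by (rule order.trans[OF sum_abs]) (intro sum_mono sum_abs)
    also have "\<dots> \<le> (\<Sum>b\<in>Basis. \<Sum>b'\<in>Basis. norm y * (norm w * \<bar>g x b b' - g p b b'\<bar>))"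
      unfolding abs_mult by (intro sum_mono mult_mono Basis_le_norm mult_nonneg_nonneg) auto
    also have "\<dots> = M x * norm y * norm w"
      by (simp add: M_def sum_distrib_left sum_distrib_right mult_ac)
    finally show ?thesis .
  qed
  have linc: "linear (c x)" if "x \<in> U" for x
  proof -
    have "c x = g x (z x)" using z[OF that] by auto
    then show ?thesis using linear_right[OF that] by simp
  qed
  have N: "\<bar>c x u - c p u\<bar> \<le> N x * norm u" if x: "x \<in> U" for x u
  proof -
    have "\<bar>c x u - c p u\<bar> = \<bar>\<Sum>b\<in>Basis. (u \<bullet> b) * (c x b - c p b)\<bar>"
      by (subst (1 2) linear_basis_expansion[OF linc]) (use x p in \<open>auto simp: sum_subtractf algebra_simps\<close>)
    also have "\<dots> \<le> (\<Sum>b\<in>Basis. \<bar>(u \<bullet> b) * (c x b - c p b)\<bar>)" by (rule sum_abs)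
    also have "\<dots> \<le> (\<Sum>b\<in>Basis. norm u * \<bar>c x b - c p b\<bar>)"
      unfolding abs_mult by (intro sum_mono mult_mono Basis_le_norm) auto
    also have "\<dots> = N x * norm u" by (simp add: N_def sum_distrib_left mult_ac)
    finally show ?thesis .
  qed
  have isCont_g: "isCont (\<lambda>x. g x v w) p" for v w
    using differentiable[OF p] differentiable_imp_continuous_within by blast
  have "isCont M p" unfolding M_def by (intro continuous_intros isCont_g)
  then have Mlim: "(M \<longlongrightarrow> 0) (at p)" unfolding isCont_def by (simp add: M_def)
  have "isCont N p" unfolding N_def by (intro continuous_intros c)
  then have Nlim: "(N \<longlongrightarrow> 0) (at p)" unfolding isCont_def by (simp add: N_def)
  \<comment> \<open>The smallness of \<open>M x\<close> allows the part of the error proportional to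
    \<open>norm (z x - z p)\<close> to be absorbed into the left-hand side at the price of half of
    \<open>m\<close>, hence the factor \<open>2 / m\<close>.\<close>
  have bound: "norm (z x - z p) \<le> 2 / m * (M x * norm (z p) + N x)" if x: "x \<in> U" and small: "M x < m / 2" for x
  proof -
    let ?d = "z x - z p"
    have "m * (norm ?d)\<^sup>2 \<le> g p ?d ?d" by (rule m)
    also have "\<dots> = (g p (z x) ?d - g x (z x) ?d) + (c x ?d - c p ?d)"
      by (simp add: g_simps(3)[OF p] z[OF x] z[OF p])
    also have "\<dots> \<le> M x * norm (z x) * norm ?d + N x * norm ?d"
      using M[OF x, of "z x" ?d] N[OF x, of ?d] by linarith
    finally have 1: "m * norm ?d * norm ?d \<le> (M x * norm (z x) + N x) * norm ?d"
      by (simp add: power2_eq_square algebra_simps)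
    have N0: "N x \<ge> 0" "M x \<ge> 0" by (auto simp: N_def M_def intro!: sum_nonneg)
    have "m * norm ?d \<le> M x * norm (z x) + N x"
    proof (cases "?d = 0")
      case False
      then show ?thesis using 1 by simp
    qed (use N0 in auto)
    also have "\<dots> \<le> M x * (norm (z p) + norm ?d) + N x"
      using norm_triangle_ineq[of "z p" ?d] N0 by (intro add_mono mult_left_mono) auto
    also have "\<dots> \<le> M x * norm (z p) + N x + m / 2 * norm ?d"
      using mult_right_mono[of "M x" "m / 2" "norm ?d"] small by (simp add: algebra_simps)
    finally have "m / 2 * norm ?d \<le> M x * norm (z p) + N x" by simp
    then show ?thesis using m(1) by (simp add: field_simps)
  qed
  have "((\<lambda>x. z x - z p) \<longlongrightarrow> 0) (at p)"
  proof (rule Lim_null_comparison)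
    have "\<forall>\<^sub>F x in at p. M x < m / 2" using Mlim m(1) by (intro order_tendstoD) auto
    moreover have "\<forall>\<^sub>F x in at p. x \<in> U" using open_U p by (rule eventually_at_in_open')
    ultimately show "\<forall>\<^sub>F x in at p. norm (z x - z p) \<le> 2 / m * (M x * norm (z p) + N x)"
      by eventually_elim (rule bound)
    show "((\<lambda>x. 2 / m * (M x * norm (z p) + N x)) \<longlongrightarrow> 0) (at p)"
      by (rule tendsto_eq_intros Mlim Nlim refl | simp)+
  qed
  then show ?thesis unfolding isCont_def by (rule LIM_zero_cancel)
qed

lemma solution_differentiable:
  assumes p: "p \<in> U" and z: "\<And>x u. x \<in> U \<Longrightarrow> g x (z x) u = c x u"
    and c: "\<And>u. (\<lambda>x. c x u) differentiable (at p)"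
  shows "z differentiable (at p)"
proof -
  have contz: "isCont z p"
    using p z c differentiable_imp_continuous_within by (intro solution_isCont[of p z c]) blast+
  have D: "(\<lambda>x. g p (z x) u) differentiable (at p)" for u
  proof -
    have "((\<lambda>x. (g x b u - g p b u) * (z x \<bullet> b)) has_derivative
        (\<lambda>d. frechet_derivative (\<lambda>x. g x b u) (at p) d * (z p \<bullet> b))) (at p)" for b
      using has_derivative_diff[OF has_derivative_g[OF p, of b u] has_derivative_const, of "g p b u"] contz
      by (intro has_derivative_mult_vanishing) (auto intro!: continuous_intros)
    then have "(\<lambda>x. (g x b u - g p b u) * (z x \<bullet> b)) differentiable (at p)" for b
      unfolding differentiable_def by blast
    then have "(\<lambda>x. c x u - (\<Sum>b\<in>Basis. (g x b u - g p b u) * (z x \<bullet> b))) differentiable (at p)"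
      by (intro differentiable_diff c differentiable_sum) auto
    moreover have "c x u - (\<Sum>b\<in>Basis. (g x b u - g p b u) * (z x \<bullet> b)) = g p (z x) u" if x: "x \<in> U" for x
      using linear_basis_expansion[OF linear_left[OF x], of "z x" u]
        linear_basis_expansion[OF linear_left[OF p], of "z x" u] z[OF x, of u]
      by (simp add: sum_subtractf algebra_simps)
    ultimately show ?thesis
      unfolding differentiable_def by (meson has_derivative_transform_within_open open_U p)
  qed
  have "(\<lambda>x. z x \<bullet> b) differentiable (at p)" for b
  proof -
    have "linear (\<lambda>y. y \<bullet> b)" by (rule linearI) (auto simp: inner_left_distrib)
    \<comment> \<open>Each coordinate of \<open>z x\<close> is its \<open>g p\<close>-product with a
      fixed vector, so the differentiability of all these products carries over to
      \<open>z\<close>.\<close>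
    then obtain w where w: "\<And>y. g p w y = y \<bullet> b" using represent[OF p] by metis
    then have "z x \<bullet> b = g p (z x) w" for x using sym[OF p] by metis
    then show ?thesis using D[of w] by simp
  qed
  then show ?thesis by (subst differentiable_componentwise_within) blast
qed

text \<open>Differentiating the defining equation of the Christoffel symbols and using compatibility
  with the metric trades their derivative for that of the Koszul expression. Differentiability of
  the latter is required at the one point \<open>p\<close> only.\<close>

lemma curvature_koszul:
  assumes p: "p \<in> U" and K: "\<And>v w u. (\<lambda>x. koszul g x v w u) differentiable (at p)"
  shows "g p (curvature g p a v w) u =
    frechet_derivative (\<lambda>x. koszul g x v w u) (at p) a - frechet_derivative (\<lambda>x. koszul g x a w u) (at p) v
    - g p (christoffel g p a u) (christoffel g p v w) + g p (christoffel g p v u) (christoffel g p a w)"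
proof -
  have 1: "g p (frechet_derivative (\<lambda>x. christoffel g x v w) (at p) a) u
      + g p (christoffel g p a (christoffel g p v w)) u
      = frechet_derivative (\<lambda>x. koszul g x v w u) (at p) a
      - g p (christoffel g p a u) (christoffel g p v w)" for a v w
  proof -
    let ?z = "\<lambda>x. christoffel g x v w"
    have z: "?z differentiable (at p)"
      using p christoffel K by (rule solution_differentiable)
    have "((\<lambda>x. g x (?z x) u) has_derivative (\<lambda>d. frechet_derivative (\<lambda>x. g x (?z p) u) (at p) d
        + g p (frechet_derivative ?z (at p) d) u)) (at p)"
      by (rule has_derivative_linear_family[OF open_U p linear_left has_derivative_g[OF p]
            has_derivative_frechet[OF z]])
    then have "((\<lambda>x. koszul g x v w u) has_derivative (\<lambda>d. frechet_derivative (\<lambda>x. g x (?z p) u) (at p) d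
        + g p (frechet_derivative ?z (at p) d) u)) (at p)"
      by (rule has_derivative_transform_within_open[OF _ open_U p]) (rule christoffel)
    from frechet_derivative_eqI[OF this]
    show ?thesis
      by (simp add: metric_compatible[OF p] christoffel[OF p])
  qed
  show ?thesis
    using 1[of v w a] 1[of a w v] unfolding curvature_def by (simp add: g_simps[OF p])
qed

end

section \<open>Metrics of constant curvature\<close>

text \<open>Polarizing the vanishing sectional curvature in the outer pair and then in the inner
  pair makes \<open>T\<close> antisymmetric in its second and third arguments. With the antisymmetry
  in the first two, \<open>T\<close> is invariant under cyclic permutations of the first three, and
  the Bianchi identity becomes \<open>3 * T = 0\<close>.\<close>

lemma curvature_like_zero:
  fixes T :: "'a::real_vector \<Rightarrow> 'a \<Rightarrow> 'a \<Rightarrow> 'a \<Rightarrow> real"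
  assumes add1: "\<And>a a' v w u. T (a + a') v w u = T a v w u + T a' v w u"
    and anti: "\<And>a v w u. T a v w u = - T v a w u"
    and pair: "\<And>a v w u. T a v w u = T w u a v"
    and bianchi: "\<And>a v w u. T a v w u + T v w a u + T w a v u = 0"
    and sectional: "\<And>a v. T a v v a = 0"
  shows "T a v w u = 0"
proof -
  have add2: "T a (v + v') w u = T a v w u + T a v' w u" for a v v' w u
    by (simp add: anti[of a] add1)
  have add3: "T a v (w + w') u = T a v w u + T a v w' u" for a v w w' u
    by (simp add: pair[of a v] add1)
  have add4: "T a v w (u + u') = T a v w u + T a v w u'" for a v w u u'
    by (simp add: pair[of a v] add2)
  have 1: "T a v v c = 0" for a v c
  proof -
    have "T a v v c + T c v v a = 0"
      using sectional[of "a + c" v] sectional[of a v] sectional[of c v] by (simp add: add1 add4)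
    moreover have "T c v v a = T a v v c"
      using pair[of c v v a] anti[of v a c v] pair[of a v c v] anti[of c v a v] pair[of v c a v] by simp
    ultimately show ?thesis by simp
  qed
  have 2: "T a v w c = - T a w v c" for a v w c
    using 1[of a "v + w" c] 1[of a v c] 1[of a w c] by (simp add: add2 add3)
  have 3: "T a v w c = T w a v c" for a v w c
    using 2[of a v w c] anti[of a w v c] by simp
  show ?thesis
    using bianchi[of a v w u] 3[of a v w u] 3[of w a v u] by simp
qed

locale C2_metric_on = local_metric_on +
  assumes C2: "Ck_on 2 (\<lambda>x. g x v w) U"
begin

lemma dg_differentiable:
  "x \<in> U \<Longrightarrow> (\<lambda>x. frechet_derivative (\<lambda>x. g x v w) (at x) a) differentiable (at x)"
  using C2[of v w] by (auto simp: numeral_2_eq_2)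

definition hess :: "'a \<Rightarrow> 'a \<Rightarrow> 'a \<Rightarrow> 'a \<Rightarrow> 'a \<Rightarrow> real" where
  "hess x a b v w = frechet_derivative (\<lambda>x. frechet_derivative (\<lambda>x. g x v w) (at x) b) (at x) a"

lemma hess_commute:
  assumes x: "x \<in> U"
  shows "hess x a b v w = hess x b a v w"
  unfolding hess_def
proof (rule symmetric_second_derivative_real[OF open_U x differentiable dg_differentiable])
  fix b a
  have "continuous_on U (\<lambda>x. frechet_derivative (\<lambda>x. frechet_derivative (\<lambda>x. g x v w) (at x) b) (at x) a)"
    using C2[of v w] by (simp add: numeral_2_eq_2)
  then show "isCont (\<lambda>x. frechet_derivative (\<lambda>x. frechet_derivative (\<lambda>x. g x v w) (at x) b) (at x) a) x"
    using open_U x by (simp add: continuous_on_eq_continuous_at)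
qed

lemma hess_sym:
  assumes x: "x \<in> U"
  shows "hess x a b v w = hess x a b w v"
proof -
  have "frechet_derivative (\<lambda>x. frechet_derivative (\<lambda>x. g x v w) (at x) b) (at x)
      = frechet_derivative (\<lambda>x. frechet_derivative (\<lambda>x. g x w v) (at x) b) (at x)"
    by (rule frechet_derivative_cong_open[OF open_U x]) (simp add: dg_sym[of _ v w])
  then show ?thesis by (simp add: hess_def)
qed

lemma hess_add_dir: "x \<in> U \<Longrightarrow> hess x (a + a') b v w = hess x a b v w + hess x a' b v w"
  unfolding hess_def by (rule linear_add[OF linear_frechet_derivative[OF dg_differentiable]])

lemma hess_add_left:
  assumes x: "x \<in> U"
  shows "hess x a b (v + v') w = hess x a b v w + hess x a b v' w"
proof -
  let ?D = "\<lambda>v x. frechet_derivative (\<lambda>x. g x v w) (at x) b"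
  have "((?D (v + v')) has_derivative (\<lambda>a. frechet_derivative (?D v) (at x) a + frechet_derivative (?D v') (at x) a)) (at x)"
    by (rule has_derivative_transform_within_open[OF has_derivative_add[OF
          has_derivative_frechet[OF dg_differentiable[OF x]] has_derivative_frechet[OF dg_differentiable[OF x]]] open_U x])
      (simp add: dg_simps)
  from frechet_derivative_eqI[OF this] show ?thesis by (simp add: hess_def)
qed

lemma has_derivative_koszul:
  assumes x: "x \<in> U"
  shows "((\<lambda>x. koszul g x v w u) has_derivative
    (\<lambda>a. (hess x a v w u + hess x a w v u - hess x a u v w) / 2)) (at x)"
proof -
  let ?d = "\<lambda>v w u x. frechet_derivative (\<lambda>x. g x v w) (at x) u"
  have "((\<lambda>x. (1/2) * (?d w u v x + ?d v u w x - ?d v w u x)) has_derivative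
    (\<lambda>a. (1/2) * (hess x a v w u + hess x a w v u - hess x a u v w))) (at x)"
    unfolding hess_def
    by (intro has_derivative_mult_right has_derivative_add has_derivative_diff
        has_derivative_frechet dg_differentiable x)
  then show ?thesis by (simp add: koszul_def)
qed

lemma koszul_differentiable: "x \<in> U \<Longrightarrow> (\<lambda>x. koszul g x v w u) differentiable (at x)"
  using has_derivative_koszul unfolding differentiable_def by blast

text \<open>The terms \<open>hess x a v w u\<close> and \<open>hess x v a w u\<close> cancel by the
  symmetry of second derivatives. The symmetries of the curvature tensor can be read off from the
  rest.\<close>

lemma curvature_hess:
  assumes x: "x \<in> U"
  shows "g x (curvature g x a v w) u =
    (hess x a w v u - hess x a u v w - hess x v w a u + hess x v u a w) / 2
    - g x (christoffel g x a u) (christoffel g x v w) + g x (christoffel g x v u) (christoffel g x a w)"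
  using hess_commute[OF x, of a v w u]
  by (simp add: curvature_koszul[OF x koszul_differentiable[OF x]]
      frechet_derivative_eqI[OF has_derivative_koszul[OF x]] field_simps)

text \<open>Only sectional curvatures are prescribed. The difference \<open>T\<close> between the
  curvature and the constant curvature model has the symmetries of a curvature tensor and vanishing
  sectional values, so it vanishes altogether.\<close>

lemma constant_curvature:
  assumes x: "x \<in> U"
    and K: "\<And>u v. g x (curvature g x u v v) u = K * (g x u u * g x v v - (g x u v)\<^sup>2)"
  shows "g x (curvature g x a v w) u = K * (g x a u * g x v w - g x v u * g x a w)"
proof -
  define k where "k a u v w = g x (christoffel g x a u) (christoffel g x v w)" for a u v w
  define T where "T a v w u = g x (curvature g x a v w) u - K * (g x a u * g x v w - g x v u * g x a w)" for a v w u
  have T: "T a v w u = (hess x a w v u - hess x a u v w - hess x v w a u + hess x v u a w) / 2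
      - k a u v w + k v u a w - K * (g x a u * g x v w - g x v u * g x a w)" for a v w u
    by (simp add: T_def k_def curvature_hess[OF x])
  have k_sym1: "k a u v w = k u a v w" for a u v w
    unfolding k_def using christoffel[OF x] koszul_sym[OF x] by metis
  have k_sym2: "k a u v w = k v w a u" for a u v w
    unfolding k_def by (rule sym[OF x])
  have k_add: "k (a + a') u v w = k a u v w + k a' u v w" for a a' u v w
    unfolding k_def christoffel[OF x] by (rule linear_add[OF koszul_linear(1)[OF x]])
  have k_add2: "k a u (v + v') w = k a u v w + k a u v' w" for a u v v' w
    using k_add[of v v' w a u] by (simp add: k_sym2[of _ _ a u])
  have hs: "hess x a b v w = hess x b a v w" "hess x a b v w = hess x a b w v" for a b v w
    using hess_commute[OF x] hess_sym[OF x] by blast+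
  have gs: "g x a b = g x b a" for a b by (rule sym[OF x])
  have "T a v w u = 0"
  proof (rule curvature_like_zero[of T])
    fix a a' v w u
    show "T (a + a') v w u = T a v w u + T a' v w u"
      by (simp add: T hess_add_dir[OF x] hess_add_left[OF x] k_add k_add2 g_simps[OF x] field_simps)
    show "T a v w u = - T v a w u" by (simp add: T field_simps)
    show "T a v w u = T w u a v"
      using hs(1)[of a w v u] hs(2)[of a w v u] hs(2)[of w a v u] hs(1)[of a u v w] hs(2)[of a u v w] hs(2)[of u a v w]
        hs(1)[of v w a u] hs(2)[of v w a u] hs(2)[of w v a u] hs(1)[of v u a w] hs(2)[of v u a w] hs(2)[of u v a w]
        k_sym1[of a u v w] k_sym2[of u a v w] k_sym1[of v w u a] k_sym1[of v u a w] k_sym2[of u v a w]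
        k_sym1[of a w u v] k_sym2[of v u a w] k_sym1[of w a v u] k_sym1[of v w a u] k_sym2[of a u v w] k_sym2[of w a u v]
        gs[of a u] gs[of v w] gs[of v u] gs[of a w]
      by (simp add: T field_simps)
    show "T a v w u + T v w a u + T w a v u = 0"
      using hs[of a w v u] hs[of a u v w] hs[of v w a u] hs[of v u a w]
        hs[of v a w u] hs[of v u w a] hs[of w a v u] hs[of w u v a] hs[of w v a u] hs[of w u a v]
        hs[of a v w u] hs[of a u w v]
        k_sym1[of v w a u] k_sym1[of a w v u] k_sym1[of v a w u] k_sym2 k_sym1
        gs[of v w] gs[of a w] gs[of a v]
      by (simp add: T field_simps)
    show "T a v v a = 0" by (simp add: T_def K power2_eq_square gs[of v a])
  qed
  then show ?thesis by (simp add: T_def)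
qed

end

section \<open>The Gauss equation for graphs\<close>

text \<open>A hypersurface written in a pair of graph charts. Tangency and orthogonality hold at
  \<open>p\<close>, where the Riemann tensor is evaluated.\<close>

locale graph_hypersurface = C2_metric_on V G
  for V :: "('a::euclidean_space \<times> real) set" and G +
  fixes U :: "'a set" and X :: "'a \<Rightarrow> 'a \<times> real" and p :: 'a
  assumes U: "open U" "p \<in> U"
    and X_in: "x \<in> U \<Longrightarrow> X x \<in> V"
    and X_C2: "Ck_on 2 X U"
    and graph: "x \<in> U \<Longrightarrow> fst (X x) = x"
    and tangent: "frechet_derivative (\<lambda>x. snd (X x)) (at p) v = 0"
    and orthogonal: "G (X p) (v, 0) (0, 1) = 0"
begin

abbreviation DX :: "'a \<Rightarrow> 'a \<Rightarrow> 'a \<times> real" where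
  "DX x v \<equiv> frechet_derivative X (at x) v"

abbreviation DDX :: "'a \<Rightarrow> 'a \<Rightarrow> 'a \<Rightarrow> 'a \<times> real" where
  "DDX x v w \<equiv> frechet_derivative (\<lambda>x. frechet_derivative X (at x) w) (at x) v"

text \<open>Normal to the graph at \<open>p\<close>, but not necessarily of length one; the
  quotients by \<open>G (X p) N N\<close> below account for this.\<close>

abbreviation N :: "'a \<times> real" where "N \<equiv> (0, 1)"

definition pullback :: "'a local_metric" where
  "pullback x v w = G (X x) (DX x v) (DX x w)"

lemma X_differentiable: "x \<in> U \<Longrightarrow> X differentiable (at x)"
  and DX_differentiable: "x \<in> U \<Longrightarrow> (\<lambda>x. DX x v) differentiable (at x)"
  using X_C2 by (auto simp: numeral_2_eq_2)

lemma X_deriv: "x \<in> U \<Longrightarrow> (X has_derivative DX x) (at x)"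
  and DX_deriv: "x \<in> U \<Longrightarrow> ((\<lambda>x. DX x w) has_derivative (\<lambda>v. DDX x v w)) (at x)"
  by (rule has_derivative_frechet[OF X_differentiable] has_derivative_frechet[OF DX_differentiable]; assumption)+

lemma DDX_isCont:
  assumes "x \<in> U"
  shows "isCont (\<lambda>x. DDX x v w) x"
proof -
  have "continuous_on U (\<lambda>x. DDX x v w)"
    using X_C2 by (simp add: numeral_2_eq_2)
  then show ?thesis using U(1) assms by (simp add: continuous_on_eq_continuous_at)
qed

lemma DDX_commute: "x \<in> U \<Longrightarrow> DDX x v w = DDX x w v"
  by (rule symmetric_second_derivative[OF U(1)]) (auto intro: X_differentiable DX_differentiable DDX_isCont)

lemma fst_DX:
  assumes x: "x \<in> U"
  shows "fst (DX x v) = v"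
proof -
  have "((\<lambda>x. fst (X x)) has_derivative (\<lambda>v. fst (DX x v))) (at x)"
    by (rule has_derivative_fst[OF X_deriv[OF x]])
  then have "((\<lambda>x. x) has_derivative (\<lambda>v. fst (DX x v))) (at x)"
    by (rule has_derivative_transform_within_open[OF _ U(1) x]) (rule graph)
  from has_derivative_unique[OF this has_derivative_ident] show ?thesis by metis
qed

text \<open>The first component of \<open>DX x w\<close> is constantly \<open>w\<close>. This is the
  gain from graph coordinates: second derivatives of the immersion occur only in the fixed direction
  \<open>N\<close>.\<close>

lemma fst_DDX:
  assumes x: "x \<in> U"
  shows "fst (DDX x v w) = 0"
proof -
  have "((\<lambda>x. fst (DX x w)) has_derivative (\<lambda>v. fst (DDX x v w))) (at x)"
    by (rule has_derivative_fst[OF DX_deriv[OF x]])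
  then have "((\<lambda>x. w) has_derivative (\<lambda>v. fst (DDX x v w))) (at x)"
    by (rule has_derivative_transform_within_open[OF _ U(1) x]) (rule fst_DX)
  from has_derivative_unique[OF this has_derivative_const] show ?thesis by metis
qed

lemma DDX_eq: "x \<in> U \<Longrightarrow> DDX x v w = snd (DDX x v w) *\<^sub>R N"
  by (simp add: prod_eq_iff fst_DDX)

lemma DX_p: "DX p v = (v, 0)"
proof -
  have "((\<lambda>x. snd (X x)) has_derivative (\<lambda>v. snd (DX p v))) (at p)"
    by (rule has_derivative_snd[OF X_deriv[OF U(2)]])
  from frechet_derivative_eqI[OF this] tangent[of v] fst_DX[OF U(2), of v]
  show ?thesis by (simp add: prod_eq_iff)
qed

lemma linear_DX: "x \<in> U \<Longrightarrow> linear (DX x)"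
  by (rule linear_frechet_derivative[OF X_differentiable])

text \<open>The chain rule treats frozen vectors; each of the two vector slots is then released by
  one application of the product rule for linear families.\<close>

lemma has_derivative_G_along:
  assumes x: "x \<in> U" and Y: "(Y has_derivative Y') (at x)" and Z: "(Z has_derivative Z') (at x)"
  shows "((\<lambda>x. G (X x) (Y x) (Z x)) has_derivative
    (\<lambda>d. frechet_derivative (\<lambda>q. G q (Y x) (Z x)) (at (X x)) (DX x d)
      + G (X x) (Y x) (Z' d) + G (X x) (Y' d) (Z x))) (at x)"
proof -
  have 0: "((\<lambda>x. G (X x) y z) has_derivative
      (\<lambda>d. frechet_derivative (\<lambda>q. G q y z) (at (X x)) (DX x d))) (at x)" for y z
    by (rule has_derivative_compose[where g = "\<lambda>q. G q y z", OF X_deriv[OF x] has_derivative_g[OF X_in[OF x]]])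
  have 1: "((\<lambda>x. G (X x) y (Z x)) has_derivative
      (\<lambda>d. frechet_derivative (\<lambda>q. G q y (Z x)) (at (X x)) (DX x d) + G (X x) y (Z' d))) (at x)" for y
    by (rule has_derivative_linear_family[where F = "\<lambda>x z. G (X x) y z", OF U(1) x linear_right[OF X_in] 0 Z])
  show ?thesis
    by (rule has_derivative_linear_family[where F = "\<lambda>x y. G (X x) y (Z x)", OF U(1) x linear_left[OF X_in] 1 Y])
qed

lemma has_derivative_koszul_along:
  assumes x: "x \<in> U" and W: "(W has_derivative W') (at x)" and Y: "(Y has_derivative Y') (at x)"
    and Z: "(Z has_derivative Z') (at x)"
  shows "((\<lambda>x. koszul G (X x) (W x) (Y x) (Z x)) has_derivative
    (\<lambda>d. frechet_derivative (\<lambda>q. koszul G q (W x) (Y x) (Z x)) (at (X x)) (DX x d)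
      + koszul G (X x) (W x) (Y x) (Z' d) + koszul G (X x) (W x) (Y' d) (Z x)
      + koszul G (X x) (W' d) (Y x) (Z x))) (at x)"
proof -
  have 0: "((\<lambda>x. koszul G (X x) w y z) has_derivative
      (\<lambda>d. frechet_derivative (\<lambda>q. koszul G q w y z) (at (X x)) (DX x d))) (at x)" for w y z
    by (rule has_derivative_compose[where g = "\<lambda>q. koszul G q w y z", OF X_deriv[OF x]
          has_derivative_frechet[OF koszul_differentiable[OF X_in[OF x]]]])
  have 1: "((\<lambda>x. koszul G (X x) w y (Z x)) has_derivative
      (\<lambda>d. frechet_derivative (\<lambda>q. koszul G q w y (Z x)) (at (X x)) (DX x d)
        + koszul G (X x) w y (Z' d))) (at x)" for w y
    by (rule has_derivative_linear_family[where F = "\<lambda>x z. koszul G (X x) w y z",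
          OF U(1) x koszul_linear(3)[OF X_in] 0 Z])
  have 2: "((\<lambda>x. koszul G (X x) w (Y x) (Z x)) has_derivative
      (\<lambda>d. frechet_derivative (\<lambda>q. koszul G q w (Y x) (Z x)) (at (X x)) (DX x d)
        + koszul G (X x) w (Y x) (Z' d) + koszul G (X x) w (Y' d) (Z x))) (at x)" for w
    by (rule has_derivative_linear_family[where F = "\<lambda>x y. koszul G (X x) w y (Z x)",
          OF U(1) x koszul_linear(2)[OF X_in] 1 Y])
  show ?thesis
    by (rule has_derivative_linear_family[where F = "\<lambda>x w. koszul G (X x) w (Y x) (Z x)",
          OF U(1) x koszul_linear(1)[OF X_in] 2 W])
qed

lemma has_derivative_pullback:
  "x \<in> U \<Longrightarrow> ((\<lambda>x. pullback x v w) has_derivative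
    (\<lambda>d. frechet_derivative (\<lambda>q. G q (DX x v) (DX x w)) (at (X x)) (DX x d)
      + G (X x) (DX x v) (DDX x d w) + G (X x) (DDX x d v) (DX x w))) (at x)"
  unfolding pullback_def by (rule has_derivative_G_along[OF _ DX_deriv DX_deriv])

sublocale induced: local_metric_on U pullback
proof
  show "open U" by (rule U)
  fix x v w assume x: "x \<in> U"
  show "bilinear (pullback x)"
    unfolding bilinear_def pullback_def
    by (auto intro!: linear_compose[unfolded o_def, OF linear_DX[OF x]] linear_left linear_right X_in x)
  show "pullback x v w = pullback x w v" unfolding pullback_def by (rule sym[OF X_in[OF x]])
  show "(\<lambda>x. pullback x v w) differentiable (at x)"
    using has_derivative_pullback[OF x] unfolding differentiable_def by blast
  assume "v \<noteq> 0"
  then have "DX x v \<noteq> 0" using fst_DX[OF x, of v] by auto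
  then show "0 < pullback x v v" unfolding pullback_def by (rule pos[OF X_in[OF x]])
qed

text \<open>The three derivatives of the pullback contain six terms with second derivatives of
  \<open>X\<close>. By symmetry four of them cancel and the other two coincide.\<close>

lemma koszul_pullback:
  assumes x: "x \<in> U"
  shows "koszul pullback x v w u = koszul G (X x) (DX x v) (DX x w) (DX x u) + G (X x) (DDX x v w) (DX x u)"
  using DDX_commute[OF x, of u v] DDX_commute[OF x, of u w] DDX_commute[OF x, of w v]
    sym[OF X_in[OF x], of "DX x v" "DDX x w u"] sym[OF X_in[OF x], of "DX x w" "DDX x v u"]
  unfolding koszul_def[of pullback] frechet_derivative_eqI[OF has_derivative_pullback[OF x]]
  by (simp add: koszul_def field_simps)

text \<open>The second derivatives of the graph function are only continuous. They enter the first
  derivatives of the induced metric with the factor \<open>G N (DX u)\<close>, which vanishes at \<open>p\<close>, so that their product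
  is still differentiable at \<open>p\<close>.\<close>

lemma has_derivative_koszul_pullback:
  "((\<lambda>x. koszul pullback x v w u) has_derivative
    (\<lambda>a. frechet_derivative (\<lambda>q. koszul G q (v, 0) (w, 0) (u, 0)) (at (X p)) (a, 0)
      + koszul G (X p) (v, 0) (w, 0) (DDX p a u) + koszul G (X p) (v, 0) (DDX p a w) (u, 0)
      + koszul G (X p) (DDX p a v) (w, 0) (u, 0)
      + (frechet_derivative (\<lambda>q. G q N (u, 0)) (at (X p)) (a, 0) + G (X p) N (DDX p a u)) * snd (DDX p v w)))
    (at p)"
proof -
  note p = U(2)
  have "G (X p) N (DX p u) = 0"
    using orthogonal[of u] sym[OF X_in[OF p], of N "(u, 0)"] by (simp add: DX_p)
  moreover have "((\<lambda>x. G (X x) N (DX x u)) has_derivative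
      (\<lambda>d. frechet_derivative (\<lambda>q. G q N (DX p u)) (at (X p)) (DX p d) + G (X p) N (DDX p d u)
        + G (X p) 0 (DX p u))) (at p)"
    by (rule has_derivative_G_along[OF p has_derivative_const DX_deriv[OF p]])
  moreover have "isCont (\<lambda>x. snd (DDX x v w)) p"
    using DDX_isCont[OF p] by (intro continuous_intros)
  ultimately have "((\<lambda>x. G (X x) N (DX x u) * snd (DDX x v w)) has_derivative
      (\<lambda>d. (frechet_derivative (\<lambda>q. G q N (DX p u)) (at (X p)) (DX p d) + G (X p) N (DDX p d u)
        + G (X p) 0 (DX p u)) * snd (DDX p v w))) (at p)"
    by (intro has_derivative_mult_vanishing)
  from has_derivative_add[OF has_derivative_koszul_along[OF p DX_deriv[OF p] DX_deriv[OF p] DX_deriv[OF p]] this]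
  have "((\<lambda>x. koszul G (X x) (DX x v) (DX x w) (DX x u) + G (X x) N (DX x u) * snd (DDX x v w)) has_derivative
    (\<lambda>a. frechet_derivative (\<lambda>q. koszul G q (v, 0) (w, 0) (u, 0)) (at (X p)) (a, 0)
      + koszul G (X p) (v, 0) (w, 0) (DDX p a u) + koszul G (X p) (v, 0) (DDX p a w) (u, 0)
      + koszul G (X p) (DDX p a v) (w, 0) (u, 0)
      + (frechet_derivative (\<lambda>q. G q N (u, 0)) (at (X p)) (a, 0) + G (X p) N (DDX p a u)) * snd (DDX p v w)))
    (at p)"
    by (simp add: DX_p g_simps[OF X_in[OF p]])
  then show ?thesis
  proof (rule has_derivative_transform_within_open[OF _ U])
    fix x assume x: "x \<in> U"
    have "G (X x) (DDX x v w) (DX x u) = snd (DDX x v w) * G (X x) N (DX x u)"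
      by (subst DDX_eq[OF x]) (simp add: g_simps(5)[OF X_in[OF x]] del: scaleR_Pair)
    then show "koszul G (X x) (DX x v) (DX x w) (DX x u) + G (X x) N (DX x u) * snd (DDX x v w) = koszul pullback x v w u"
      by (simp add: koszul_pullback[OF x])
  qed
qed

text \<open>At \<open>p\<close> the vectors \<open>(v, 0)\<close> are orthogonal to
  \<open>N\<close>, so the tangential projection is simply \<open>fst\<close>.\<close>

lemma G_decompose: "G (X p) y z = G (X p) (fst y, 0) (fst z, 0) + G (X p) y N * G (X p) z N / G (X p) N N"
proof -
  note s = g_simps[OF X_in[OF U(2)]]
  have nz: "G (X p) N N \<noteq> 0" using pos[OF X_in[OF U(2)], of N] by (simp add: zero_prod_def)
  have 1: "y = (fst y, 0) + snd y *\<^sub>R N" for y :: "'a \<times> real" by (simp add: prod_eq_iff)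
  have o: "G (X p) (v, 0) N = 0" "G (X p) N (v, 0) = 0" for v
    using orthogonal sym[OF X_in[OF U(2)]] by metis+
  have yN: "G (X p) y N = snd y * G (X p) N N" for y
    by (subst 1[of y]) (simp only: s(1,5) o real_scaleR_def add_0_left)
  have "G (X p) y z = G (X p) (fst y, 0) (fst z, 0) + snd y * (snd z * G (X p) N N)"
    by (subst 1[of y], subst 1[of z]) (simp only: s(1,2,5,6) o mult_zero_right add_0_left add_0_right real_scaleR_def mult.left_commute)
  then show ?thesis using nz by (simp add: yN[of y] yN[of z])
qed

text \<open>The second fundamental form paired with \<open>N\<close> instead of a unit
  normal.\<close>

definition normal_part :: "'a \<Rightarrow> 'a \<Rightarrow> real" where
  "normal_part v w = G (X p) (DDX p v w + christoffel G (X p) (v, 0) (w, 0)) N"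

text \<open>The induced connection is the tangential part of the ambient one; the second derivatives
  of \<open>X\<close> are normal at \<open>p\<close> and drop out.\<close>

lemma christoffel_pullback: "christoffel pullback p v w = fst (christoffel G (X p) (v, 0) (w, 0))"
proof (rule induced.eqI_metric[OF U(2)])
  fix u
  note Xp = X_in[OF U(2)]
  let ?c = "christoffel G (X p) (v, 0) (w, 0)"
  have o: "G (X p) N (u, 0) = 0" "G (X p) (u, 0) N = 0" using orthogonal sym[OF Xp] by metis+
  have "G (X p) (DDX p v w) (u, 0) = 0"
    by (subst DDX_eq[OF U(2)]) (simp add: g_simps(5)[OF Xp] o del: scaleR_Pair)
  then have "pullback p (christoffel pullback p v w) u = G (X p) ?c (u, 0)"
    by (simp add: induced.christoffel[OF U(2)] koszul_pullback[OF U(2)] DX_p christoffel[OF Xp])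
  also have "\<dots> = pullback p (fst ?c) u"
    by (subst G_decompose) (simp add: o pullback_def DX_p)
  finally show "pullback p (christoffel pullback p v w) u = pullback p (fst ?c) u" .
qed

text \<open>Both curvatures are written through Koszul expressions, and the ambient derivatives
  \<open>dK\<close> cancel. What remains are the second derivatives \<open>f\<close> of the graph
  and, from the Christoffel products, the normal components \<open>k\<close> of the ambient
  connection; they combine into products of \<open>f * n + k\<close>, divided by
  \<open>n\<close>.\<close>

lemma gauss_equation:
  "pullback p (curvature pullback p a v w) u = G (X p) (curvature G (X p) (a, 0) (v, 0) (w, 0)) (u, 0)
     + (normal_part a u * normal_part v w - normal_part v u * normal_part a w) / G (X p) N N"
proof -
  note p = U(2)
  note Xp = X_in[OF p]
  define f where "f v w = snd (DDX p v w)" for v w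
  define k where "k v w u = koszul G (X p) v w u" for v w u
  define n where "n = G (X p) N N"
  define dK where "dK a v w u = frechet_derivative (\<lambda>q. koszul G q (v, 0) (w, 0) (u, 0)) (at (X p)) (a, 0)" for a v w u
  have n: "n > 0" unfolding n_def using pos[OF Xp, of N] by (simp add: zero_prod_def)
  have DDX: "DDX p v w = f v w *\<^sub>R N" for v w unfolding f_def by (rule DDX_eq[OF p])
  have f_sym: "f v w = f w v" for v w by (simp add: f_def DDX_commute[OF p])
  have k_sym: "k v w u = k w v u" for v w u by (simp add: k_def koszul_sym[OF Xp])
  have k_scale: "k (c *\<^sub>R v) w u = c * k v w u" "k v (c *\<^sub>R w) u = c * k v w u" "k v w (c *\<^sub>R u) = c * k v w u" for c v w u
    unfolding k_def using linear_cmul[OF koszul_linear(1)[OF Xp]] linear_cmul[OF koszul_linear(2)[OF Xp]]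
      linear_cmul[OF koszul_linear(3)[OF Xp]] by simp_all
  have b: "normal_part v w = f v w * n + k (v, 0) (w, 0) N" for v w
    unfolding normal_part_def DDX g_simps(1,5)[OF Xp] christoffel[OF Xp] n_def k_def real_scaleR_def ..
  have D: "frechet_derivative (\<lambda>x. koszul pullback x v w u) (at p) a = dK a v w u
      + f a u * k (v, 0) (w, 0) N + f a w * k (v, 0) N (u, 0) + f a v * k N (w, 0) (u, 0)
      + (k (a, 0) N (u, 0) + k (a, 0) (u, 0) N + f a u * n) * f v w" for v w u a
    unfolding frechet_derivative_eqI[OF has_derivative_koszul_pullback] dK_def[symmetric] k_def[symmetric]
      DDX k_scale metric_compatible[OF Xp] g_simps(6)[OF Xp] n_def[symmetric]
    by (simp add: f_def)
  have chr: "pullback p (christoffel pullback p v w) (christoffel pullback p a u) =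
      G (X p) (christoffel G (X p) (v, 0) (w, 0)) (christoffel G (X p) (a, 0) (u, 0))
      - k (v, 0) (w, 0) N * k (a, 0) (u, 0) N / n" for v w a u
    using G_decompose[of "christoffel G (X p) (v, 0) (w, 0)" "christoffel G (X p) (a, 0) (u, 0)"]
    by (simp add: christoffel_pullback pullback_def DX_p christoffel[OF Xp] k_def n_def)
  have kdiff: "(\<lambda>x. koszul pullback x v w u) differentiable (at p)" for v w u
    using has_derivative_koszul_pullback unfolding differentiable_def by blast
  have "pullback p (curvature pullback p a v w) u - G (X p) (curvature G (X p) (a, 0) (v, 0) (w, 0)) (u, 0)
    = f a u * k (v, 0) (w, 0) N + k (a, 0) (u, 0) N * f v w + f a u * f v w * n + k (a, 0) (u, 0) N * k (v, 0) (w, 0) N / n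
    - (f v u * k (a, 0) (w, 0) N + k (v, 0) (u, 0) N * f a w + f v u * f a w * n + k (v, 0) (u, 0) N * k (a, 0) (w, 0) N / n)"
    unfolding induced.curvature_koszul[OF p kdiff] curvature_koszul[OF Xp koszul_differentiable[OF Xp]] D chr
    using f_sym[of a v] k_sym[of "(v, 0)" N "(u, 0)"] k_sym[of "(a, 0)" N "(u, 0)"]
    by (simp add: dK_def algebra_simps)
  also have "\<dots> = (normal_part a u * normal_part v w - normal_part v u * normal_part a w) / n"
    using n by (simp add: b field_simps)
  finally show ?thesis by (simp add: n_def)
qed

end

text \<open>A unit normal at \<open>p\<close> is a multiple of \<open>N\<close> whose squared
  coefficient is \<open>1 / G (X p) N N\<close>. Its sign disappears from products of two values of
  \<open>h\<close>, so both orientations give the same result.\<close>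

lemma (in graph_hypersurface) second_form_product:
  assumes unit: "G (X p) \<nu> \<nu> = 1" and normal: "\<And>v. G (X p) (DX p v) \<nu> = 0"
  defines "h \<equiv> \<lambda>v w. G (X p) (DDX p v w + christoffel G (X p) (DX p v) (DX p w)) \<nu>"
  shows "h a u * h v w = normal_part a u * normal_part v w / G (X p) N N" and "h v w = h w v"
proof -
  note Xp = X_in[OF U(2)]
  have eq: "\<nu> = (fst \<nu>, 0) + snd \<nu> *\<^sub>R N" by (simp add: prod_eq_iff)
  \<comment> \<open>The tangential part of \<nu> is orthogonal to \<nu> and to \<open>N\<close>,
    hence to itself.\<close>
  have "G (X p) (fst \<nu>, 0) \<nu> = 0" using normal[of "fst \<nu>"] by (simp add: DX_p)
  then have "G (X p) (fst \<nu>, 0) (fst \<nu>, 0) = 0"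
    by (subst (asm) (2) eq) (simp add: g_simps(2,6)[OF Xp] orthogonal del: scaleR_Pair add_Pair)
  then have "fst \<nu> = 0" using pos[OF Xp, of "(fst \<nu>, 0)"] by (force simp: zero_prod_def)
  then have \<nu>: "\<nu> = snd \<nu> *\<^sub>R N" using eq by (simp add: prod_eq_iff)
  have "snd \<nu> * (snd \<nu> * G (X p) N N) = 1"
    using unit by (subst (asm) (1 2) \<nu>) (simp only: g_simps(5,6)[OF Xp] real_scaleR_def)
  moreover from this have "G (X p) N N \<noteq> 0" by auto
  ultimately have s: "snd \<nu> * snd \<nu> = 1 / G (X p) N N" by (simp add: field_simps)
  have h: "h v w = snd \<nu> * normal_part v w" for v w
    unfolding h_def normal_part_def DX_p by (subst \<nu>) (simp only: g_simps(6)[OF Xp] real_scaleR_def)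
  have "h a u * h v w = (snd \<nu> * snd \<nu>) * (normal_part a u * normal_part v w)" by (simp add: h mult_ac)
  then show "h a u * h v w = normal_part a u * normal_part v w / G (X p) N N" by (simp add: s)
  have "normal_part v w = normal_part w v"
    by (simp add: normal_part_def g_simps(1)[OF Xp] christoffel[OF Xp] koszul_sym[OF Xp, of "(v, 0)"] DDX_commute[OF U(2), of v])
  then show "h v w = h w v" by (simp add: h)
qed

lemma (in graph_hypersurface) gauss_equation_constant_curvature:
  assumes K: "\<And>u v. G (X p) (curvature G (X p) u v v) u =
      K * (G (X p) u u * G (X p) v v - (G (X p) u v)\<^sup>2)"
    and unit: "G (X p) \<nu> \<nu> = 1" and normal: "\<And>v. G (X p) (DX p v) \<nu> = 0"
  defines "h \<equiv> \<lambda>v w. G (X p) (DDX p v w + christoffel G (X p) (DX p v) (DX p w)) \<nu>"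
  shows "pullback p (curvature pullback p a v w) u =
    K * (pullback p a u * pullback p v w - pullback p v u * pullback p a w) + (h a u * h v w - h v u * h a w)"
  unfolding gauss_equation constant_curvature[OF X_in[OF U(2)] K] h_def
    second_form_product(1)[OF unit normal]
  by (simp add: pullback_def DX_p diff_divide_distrib)

section \<open>Matrices of the fundamental forms\<close>

locale inner_form =
  fixes g :: "real^'n::finite \<Rightarrow> real^'n \<Rightarrow> real"
  assumes bil: "bilinear g" and g_sym: "g v w = g w v" and g_pos: "v \<noteq> 0 \<Longrightarrow> 0 < g v v"
begin

lemma expand_right: "g v w = (\<Sum>j\<in>UNIV. w $ j * g v (axis j 1))"
proof -
  have lin: "linear (g v)" using bil by (simp add: bilinear_def)
  have "g v w = g v (\<Sum>j\<in>UNIV. w $ j *\<^sub>R axis j 1)"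
    using basis_expansion[of w] by (simp add: scalar_mult_eq_scaleR)
  then show ?thesis by (simp add: linear_sum[OF lin] linear_cmul[OF lin])
qed

lemma form_matrix_inner: "g v w = v \<bullet> (form_matrix g *v w)"
proof -
  have "g v w = (\<Sum>j\<in>UNIV. w $ j * (\<Sum>i\<in>UNIV. v $ i * g (axis j 1) (axis i 1)))"
    by (subst expand_right, subst g_sym, subst expand_right) simp
  also have "\<dots> = (\<Sum>j\<in>UNIV. \<Sum>i\<in>UNIV. v $ i * (g (axis i 1) (axis j 1) * w $ j))"
    by (simp add: sum_distrib_left g_sym mult_ac)
  also have "\<dots> = (\<Sum>i\<in>UNIV. \<Sum>j\<in>UNIV. v $ i * (g (axis i 1) (axis j 1) * w $ j))"
    by (rule sum.swap)
  also have "\<dots> = v \<bullet> (form_matrix g *v w)"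
    by (simp add: inner_vec_def matrix_vector_mult_def form_matrix_def sum_distrib_left)
  finally show ?thesis .
qed

lemma invertible_form_matrix: "invertible (form_matrix g)"
  unfolding invertible_left_inverse matrix_left_invertible_ker
proof (intro allI impI)
  fix x assume "form_matrix g *v x = 0"
  then have "g x x = 0" by (simp add: form_matrix_inner)
  then show "x = 0" using g_pos[of x] by force
qed

lemma inverse_form_matrix:
  "matrix_inv (form_matrix g) ** form_matrix g = mat 1"
  "form_matrix g ** matrix_inv (form_matrix g) = mat 1"
  using someI_ex[OF invertible_form_matrix[unfolded invertible_def]] unfolding matrix_inv_def by blast+

lemma inverse_sum: "(\<Sum>\<rho>\<in>UNIV. matrix_inv (form_matrix g) $ \<alpha> $ \<rho> * g (axis \<gamma> 1) (axis \<rho> 1)) = of_bool (\<alpha> = \<gamma>)"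
proof -
  have "(matrix_inv (form_matrix g) ** form_matrix g) $ \<alpha> $ \<gamma> = of_bool (\<alpha> = \<gamma>)"
    by (simp add: inverse_form_matrix mat_def)
  then show ?thesis
    by (simp add: matrix_matrix_mult_def form_matrix_def g_sym[of "axis \<gamma> 1"])
qed

text \<open>Raising an index: the vector is recovered from its products with the coordinate
  basis.\<close>

lemma component_inverse: "z $ \<alpha> = (\<Sum>\<rho>\<in>UNIV. matrix_inv (form_matrix g) $ \<alpha> $ \<rho> * g z (axis \<rho> 1))"
proof -
  have "(form_matrix g *v z) $ \<rho> = g z (axis \<rho> 1)" for \<rho>
    using form_matrix_inner[of "axis \<rho> 1" z] by (simp add: g_sym[of z] inner_axis')
  moreover have "z = matrix_inv (form_matrix g) *v (form_matrix g *v z)"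
    by (simp add: matrix_vector_mul_assoc inverse_form_matrix)
  ultimately show ?thesis
    by (metis (no_types, lifting) matrix_vector_mult_def sum.cong vec_lambda_beta)
qed

text \<open>Two indices of the Gauss equation are raised with the inverse metric. For each of the
  four products the double sum factorizes; factors with \<open>g\<close> become Kronecker deltas and
  factors with \<open>h\<close> become entries of the normalized form.\<close>

lemma riemann22_gauss:
  assumes gauss: "\<And>a v w u. g (curvature \<gamma> x a v w) u = K * (g a u * g v w - g v u * g a w) + (h a u * h v w - h v u * h a w)"
    and h_sym: "\<And>v w. h v w = h w v" and \<gamma>: "\<gamma> x = g"
  shows "riemann22 \<gamma> x = gauss_tensor K (matrix_inv (form_matrix g) ** form_matrix h)"
proof -
  let ?S = "matrix_inv (form_matrix g)"
  let ?A = "?S ** form_matrix h"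
  let ?e = "\<lambda>i. axis i (1::real)"
  have A: "(\<Sum>\<rho>\<in>UNIV. ?S $ \<alpha> $ \<rho> * h (?e i) (?e \<rho>)) = ?A $ \<alpha> $ i" for \<alpha> i
    by (simp add: matrix_matrix_mult_def form_matrix_def h_sym[of "axis i 1"])
  have prod: "(\<Sum>\<mu>\<in>UNIV. \<Sum>\<rho>\<in>UNIV. ?S $ \<beta> $ \<mu> * (?S $ \<alpha> $ \<rho> * (f i \<rho> * f j \<mu>)))
     = (\<Sum>\<rho>\<in>UNIV. ?S $ \<alpha> $ \<rho> * f i \<rho>) * (\<Sum>\<mu>\<in>UNIV. ?S $ \<beta> $ \<mu> * f j \<mu>)"
    for f :: "'n \<Rightarrow> 'n \<Rightarrow> real" and \<alpha> \<beta> i j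
    unfolding sum_product by (subst sum.swap) (simp add: mult_ac)
  have "riemann22 \<gamma> x $ \<alpha> $ \<beta> $ i $ j = gauss_tensor K ?A $ \<alpha> $ \<beta> $ i $ j" for \<alpha> \<beta> i j
  proof -
    have "riemann22 \<gamma> x $ \<alpha> $ \<beta> $ i $ j = (\<Sum>\<mu>\<in>UNIV. \<Sum>\<rho>\<in>UNIV. ?S $ \<beta> $ \<mu> * (?S $ \<alpha> $ \<rho> *
        (K * (g (?e i) (?e \<rho>) * g (?e j) (?e \<mu>) - g (?e j) (?e \<rho>) * g (?e i) (?e \<mu>))
         + (h (?e i) (?e \<rho>) * h (?e j) (?e \<mu>) - h (?e j) (?e \<rho>) * h (?e i) (?e \<mu>)))))"
      unfolding riemann22_def \<gamma> vec_lambda_beta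
      by (subst component_inverse) (simp only: gauss sum_distrib_left)
    also have "\<dots> = K * ((\<Sum>\<mu>\<in>UNIV. \<Sum>\<rho>\<in>UNIV. ?S $ \<beta> $ \<mu> * (?S $ \<alpha> $ \<rho> * (g (?e i) (?e \<rho>) * g (?e j) (?e \<mu>))))
        - (\<Sum>\<mu>\<in>UNIV. \<Sum>\<rho>\<in>UNIV. ?S $ \<beta> $ \<mu> * (?S $ \<alpha> $ \<rho> * (g (?e j) (?e \<rho>) * g (?e i) (?e \<mu>)))))
        + ((\<Sum>\<mu>\<in>UNIV. \<Sum>\<rho>\<in>UNIV. ?S $ \<beta> $ \<mu> * (?S $ \<alpha> $ \<rho> * (h (?e i) (?e \<rho>) * h (?e j) (?e \<mu>))))
        - (\<Sum>\<mu>\<in>UNIV. \<Sum>\<rho>\<in>UNIV. ?S $ \<beta> $ \<mu> * (?S $ \<alpha> $ \<rho> * (h (?e j) (?e \<rho>) * h (?e i) (?e \<mu>)))))"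
      unfolding sum_distrib_left sum_subtractf[symmetric] sum.distrib[symmetric]
      by (intro sum.cong refl) (simp add: algebra_simps)
    also have "\<dots> = gauss_tensor K ?A $ \<alpha> $ \<beta> $ i $ j"
      unfolding prod[of \<beta> \<alpha> "\<lambda>i \<rho>. g (?e i) (?e \<rho>)"] prod[of \<beta> \<alpha> "\<lambda>i \<rho>. h (?e i) (?e \<rho>)"]
        inverse_sum A gauss_tensor_def vec_lambda_beta by simp
    finally show ?thesis .
  qed
  then show ?thesis by (simp add: vec_eq_iff)
qed

text \<open>Self-adjointness with respect to \<open>g\<close>, applied to the real and imaginary
  parts of a complex eigenvector, gives \<open>b * (g x x + g y y) = 0\<close>, and definiteness
  forces \<open>b = 0\<close>.\<close>

lemma eigenvalue_list_exists:
  assumes h_sym: "\<And>v w. h v w = h w v"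
  shows "\<exists>\<kappa>. eigenvalue_list (matrix_inv (form_matrix g) ** form_matrix h) \<kappa>"
proof (rule char_poly_splits)
  let ?M = "form_matrix g" and ?H = "form_matrix h"
  let ?A = "matrix_inv ?M ** ?H"
  fix x y :: "real^'n" and a b
  assume x: "?A *v x = a *\<^sub>R x - b *\<^sub>R y" and y: "?A *v y = b *\<^sub>R x + a *\<^sub>R y" and nz: "x \<noteq> 0 \<or> y \<noteq> 0"
  have MA: "?H *v z = ?M *v (?A *v z)" for z
    by (simp add: matrix_vector_mul_assoc matrix_mul_assoc inverse_form_matrix)
  have "transpose ?H = ?H"
    by (simp add: Finite_Cartesian_Product.transpose_def form_matrix_def vec_eq_iff h_sym)
  then have "y \<bullet> (?H *v x) = x \<bullet> (?H *v y)"
    by (metis dot_lmul_matrix inner_commute transpose_matrix_vector)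
  then have "y \<bullet> (?M *v (a *\<^sub>R x - b *\<^sub>R y)) = x \<bullet> (?M *v (b *\<^sub>R x + a *\<^sub>R y))"
    unfolding MA x y .
  then have "g y (a *\<^sub>R x - b *\<^sub>R y) = g x (b *\<^sub>R x + a *\<^sub>R y)"
    by (simp only: form_matrix_inner)
  then have "a * g y x - b * g y y = b * g x x + a * g x y"
    using bil by (simp add: bilinear_rsub bilinear_radd bilinear_rmul)
  then have "b * (g x x + g y y) = 0" by (simp add: g_sym[of y x] algebra_simps)
  moreover have "g x x + g y y > 0"
  proof -
    have "g z z \<ge> 0" for z using g_pos[of z] bilinear_lzero[OF bil] by (cases "z = 0") (auto simp: less_imp_le)
    then show ?thesis using nz g_pos by (metis add_nonneg_pos add_pos_nonneg)
  qed
  ultimately show "b = 0" by simp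
qed

end

section \<open>From charts to the coordinate computations\<close>

lemma chartD:
  assumes "is_manifold r M" "c \<in> atlas M"
  shows "open (snd c ` fst c)" "inj_on (snd c) (fst c)"
proof -
  have "is_chart (topo M) c" using assms by (auto simp: is_manifold_def)
  then have c: "openin (topo M) (fst c)" "open (snd c ` fst c)"
    "homeomorphic_map (subtopology (topo M) (fst c)) (top_of_set (snd c ` fst c)) (snd c)"
    by (auto simp: is_chart_def)
  then show "open (snd c ` fst c)" by simp
  have "topspace (subtopology (topo M) (fst c)) = fst c"
    using openin_subset[OF c(1)] by auto
  with homeomorphic_imp_injective_map[OF c(3)] show "inj_on (snd c) (fst c)" by simp
qed

lemma shape_riemann_gauss:
  fixes H :: "('n::finite, 'p, 'q) hypersurface"
  assumes H: "is_C2_hypersurface K H" and AR: "(A, R) \<in> shape_riemann_at H p"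
  shows "R = gauss_tensor K A \<and> (\<exists>\<kappa>. eigenvalue_list A \<kappa>)"
proof -
  obtain c b \<nu> where cb: "(c, b) \<in> graph_charts H p" and \<nu>: "\<nu> \<in> unit_normals H c b (snd c p)"
    and A: "A = normalized_form H c b \<nu> (snd c p)" and R: "R = riemann22 (induced_metric H c b) (snd c p)"
    using AR unfolding shape_riemann_at_def by blast
  have cb: "c \<in> atlas (base H)" "b \<in> atlas (ambient H)" "p \<in> fst c" "immersion H ` fst c \<subseteq> fst b"
    "\<And>x. x \<in> snd c ` fst c \<Longrightarrow> fst (local_rep H c b x) = x"
    "\<And>v. frechet_derivative (\<lambda>x. snd (local_rep H c b x)) (at (snd c p)) v = 0"
    "\<And>v. metric (ambient H) b (snd b (immersion H p)) (v, 0) (0, 1) = 0"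
    using cb unfolding graph_charts_def by blast+
  have H': "space_form K (ambient H)" "is_manifold 2 (base H)"
    "Cr_on 2 (local_rep H c b) (snd c ` (fst c \<inter> immersion H -` fst b))"
    using H cb(1,2) unfolding is_C2_hypersurface_def Let_def by blast+
  define X where "X = local_rep H c b"
  define G where "G = metric (ambient H) b"
  define U where "U = snd c ` fst c"
  define V where "V = snd b ` fst b"
  have riem: "is_riemannian (ambient H)" using H'(1) by (simp add: space_form_def)
  then have amb: "is_manifold \<infinity> (ambient H)" by (simp add: is_riemannian_def)
  have G: "x \<in> V \<Longrightarrow> bilinear (G x)" "x \<in> V \<Longrightarrow> G x v w = G x w v" "x \<in> V \<Longrightarrow> v \<noteq> 0 \<Longrightarrow> 0 < G x v v"
    and G_smooth: "Cr_on \<infinity> (\<lambda>x. G x v w) V" for x v w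
    using riem cb(2) unfolding is_riemannian_def G_def V_def by blast+
  have G2: "Ck_on 2 (\<lambda>x. G x v w) V" for v w
    using G_smooth[of v w] by (simp add: Cr_on_def)
  \<comment> \<open>In graph charts the whole coordinate domain is mapped into the ambient chart, so
    the local representation is of class \<open>C^2\<close> on all of \<open>U\<close>.\<close>
  have "fst c \<inter> immersion H -` fst b = fst c" using cb(4) by auto
  then have X2: "Ck_on 2 X U"
    using H'(3) by (auto simp: Cr_on_def X_def U_def numeral_eq_enat)
  have X: "X (snd c q) = snd b (immersion H q)" if "q \<in> fst c" for q
    using the_inv_into_f_f[OF chartD(2)[OF H'(2) cb(1)] that] by (simp add: X_def local_rep_def)
  interpret gh: graph_hypersurface V G U X "snd c p"
  proof
    show "open V" "open U" using chartD(1)[OF amb cb(2)] chartD(1)[OF H'(2) cb(1)] by (simp_all add: V_def U_def)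
    show "snd c p \<in> U" using cb(3) by (simp add: U_def)
    show "(\<lambda>x. G x v w) differentiable at x" if "x \<in> V" for x v w
      using G2[of v w] that by (simp add: numeral_2_eq_2)
    show "X x \<in> V" if "x \<in> U" for x using that X cb(4) by (auto simp: U_def V_def)
    show "G (X (snd c p)) (v, 0) (0, 1) = 0" for v using cb(7) by (simp add: X[OF cb(3)] G_def)
  qed (use G G2 X2 cb(5,6) in \<open>auto simp: X_def U_def\<close>)
  define x where "x = snd c p"
  have x: "x \<in> U" by (simp add: x_def gh.U)
  have pullback: "induced_metric H c b = gh.pullback"
    by (intro ext) (simp add: induced_metric_def gh.pullback_def X_def[symmetric] G_def[symmetric] Let_def)
  have unit: "G (X x) \<nu> \<nu> = 1" "\<And>v. G (X x) (gh.DX x v) \<nu> = 0"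
    using \<nu> by (auto simp: unit_normals_def X_def G_def x_def Let_def)
  have K: "G (X x) (curvature G (X x) u v v) u = K * (G (X x) u u * G (X x) v v - (G (X x) u v)\<^sup>2)" for u v
    using H'(1) cb(2) gh.X_in[OF x] unfolding space_form_def G_def V_def Let_def by blast
  define h where "h = second_form H c b \<nu> x"
  have h: "h v w = G (X x) (gh.DDX x v w + christoffel G (X x) (gh.DX x v) (gh.DX x w)) \<nu>" for v w
    by (simp add: h_def second_form_def X_def G_def Let_def)
  have h_sym: "h v w = h w v" for v w
    unfolding h using gh.second_form_product(2)[of \<nu>] unit by (simp add: x_def)
  interpret form: inner_form "gh.pullback x"
    by unfold_locales (use gh.induced.bilinear[OF x] gh.induced.sym[OF x] gh.induced.pos[OF x] in auto)
  have gauss: "gh.pullback x (curvature gh.pullback x a v w) u = K * (gh.pullback x a u * gh.pullback x v w - gh.pullback x v u * gh.pullback x a w)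
      + (h a u * h v w - h v u * h a w)" for a v w u
    unfolding h x_def
    by (rule gh.gauss_equation_constant_curvature) (use K unit in \<open>simp_all add: x_def\<close>)
  have "A = matrix_inv (form_matrix (gh.pullback x)) ** form_matrix h"
    by (simp add: A normalized_form_def pullback h_def x_def)
  moreover have "R = riemann22 gh.pullback x" by (simp add: R pullback x_def)
  ultimately show ?thesis
    using form.riemann22_gauss[OF gauss h_sym refl] form.eigenvalue_list_exists[OF h_sym] by simp
qed

theorem lemma1p1:
  fixes K :: real and \<H> :: "('n::finite, 'p, 'q) hypersurface set"
  assumes "K \<in> {0, 1, -1}" and "\<H> = {H. is_C2_hypersurface K H}"
  shows
    "(\<forall>k l. k + l \<ge> 1 \<longrightarrow>
        intrinsic \<H> (\<lambda>A. True) (\<lambda>A. sigma_sym (2*k+1) A * sigma_sym (2*l+1) A) \<and>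
        (\<exists>P :: 'n tensor_poly. poly_degree P = k + l + 1 \<and>
           (\<forall>H\<in>\<H>. \<forall>p\<in>topspace (topo (base H)). \<forall>(A, R)\<in>shape_riemann_at H p.
              sigma_sym (2*k+1) A * sigma_sym (2*l+1) A = poly_eval P R))) \<and>
     (\<forall>k\<ge>1.
        (\<forall>l. intrinsic_mod_orientation \<H> (\<lambda>A. sigma_sym (2*k+1) A \<noteq> 0)
               (sigma_sym (2*k+1)) (sigma_sym (2*l+1))) \<and>
        intrinsic_mod_orientation \<H> (\<lambda>A. sigma_sym (2*k+1) A \<noteq> 0)
          (sigma_sym (2*k+1)) (\<lambda>A. A)) \<and>
     intrinsic \<H> (\<lambda>A. rank A \<ge> 3) (\<lambda>A. (sigma_sym 1 A)\<^sup>2) \<and>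
     intrinsic_mod_orientation \<H> (\<lambda>A. rank A \<ge> 3 \<and> sigma_sym 1 A \<noteq> 0) (sigma_sym 1) (\<lambda>A. A)"
proof -
  interpret gauss_family \<H> K
  proof
    fix H p A R assume "H \<in> \<H>" "(A, R) \<in> shape_riemann_at H p"
    then show "R = gauss_tensor K A \<and> (\<exists>\<kappa>. eigenvalue_list A \<kappa>)"
      using assms(2) shape_riemann_gauss by simp
  qed
  show ?thesis
    using intrinsic_sigma_mult intrinsic_mod_orientation_sigma intrinsic_mean_curvature by blast
qed

end
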